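(* Let $(\rho_{\sigma,\tau})_{0\le\sigma\le\tau}$ be a dynamic risk measure on $(\Omega,\mathcal F_\infty,(\mathcal F_t)_{t\in\mathbb R^+},P)$ that is continuous from above. It is time consistent if and only if, for all stopping times $\nu\le\sigma\le\tau$, the following two properties are satisfied: 1) (supermartingale property) for every probability measure $Q$ on $(\Omega,\mathcal F_\tau)$ absolutely continuous with respect to $P$ such that $E_Q(\alpha^m_{\nu,\tau}(Q))$ is finite, and for every $X\in L^\infty(\Omega,\mathcal F_\tau,P)$, $$E_Q\big(\rho_{\sigma,\tau}(X)+\alpha^m_{\sigma,\tau}(Q)\mid\mathcal F_\nu\big)\le\rho_{\nu,\tau}(X)+\alpha^m_{\nu,\tau}(Q)\quad Q\text{-a.s.};$$ 2) for every $Z\in L^\infty(\mathcal F_\sigma)$, $\rho_{\nu,\sigma}(Z)=\rho_{\nu,\tau}(Z+\rho_{\sigma,\tau}(0))$.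
   Context: Setting: $(\Omega,\mathcal F_\infty,(\mathcal F_t)_{t\in\mathbb R^+},P)$ is a filtered probability space; the filtration is right continuous and $\mathcal F_0$ is the $\sigma$-algebra generated by the $P$-null sets of $\mathcal F_\infty$. Stopping times may take the value $\infty$; $\mathcal F_\tau=\{A\in\mathcal F_\infty: A\cap\{\tau\le t\}\in\mathcal F_t\ \forall t\in\mathbb R^+\}$. Functions are identified with their classes in $L^\infty(\mathcal F_\tau)=L^\infty(\Omega,\mathcal F_\tau,P)$. Dynamic risk measure: a family of maps $\rho_{\sigma,\tau}:L^\infty(\mathcal F_\tau)\to L^\infty(\mathcal F_\sigma)$, indexed by pairs of stopping times $0\le\sigma\le\tau$, each satisfying ($P$-a.s.): monotonicity ($X\le Y\Rightarrow\rho_{\sigma,\tau}(X)\ge\rho_{\sigma,\tau}(Y)$); translation invariance ($\rho_{\sigma,\tau}(X+Z)=\rho_{\sigma,\tau}(X)-Z$ for $Z\in L^\infty(\mathcal F_\sigma)$); convexity ($\rho_{\sigma,\tau}(\lambda X+(1-\lambda)Y)\le\lambda\rho_{\sigma,\tau}(X)+(1-\lambda)\rho_{\sigma,\tau}(Y)$ for $\lambda\in[0,1]$). It is not assumed that $\rho_{\sigma,\tau}(0)=0$. Continuous from above: for all $\sigma\le\tau$ and every decreasing sequence $X_n$ in $L^\infty(\mathcal F_\tau)$ with a.s. limit $X\in L^\infty(\mathcal F_\tau)$, the increasing sequence $\rho_{\sigma,\tau}(X_n)$ has limit $\rho_{\sigma,\tau}(X)$ a.s. Time consistent: for all stopping times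 $0\le\nu\le\sigma\le\tau$ and all $X\in L^\infty(\mathcal F_\tau)$, $\rho_{\nu,\sigma}(-\rho_{\sigma,\tau}(X))=\rho_{\nu,\tau}(X)$. Minimal penalty: for $Q\ll P$, $$\alpha^m_{\sigma,\tau}(Q)=Q\text{-}\operatorname{ess\,sup}_{X\in L^\infty(\Omega,\mathcal F_\tau,P)}\big(E_Q(-X\mid\mathcal F_\sigma)-\rho_{\sigma,\tau}(X)\big).$$ It equals $Q\text{-}\operatorname{ess\,sup}\{E_Q(-Y\mid\mathcal F_\sigma): Y\in L^\infty(\Omega,\mathcal F_\tau,P),\ \rho_{\sigma,\tau}(Y)\le 0\ P\text{-a.s.}\}$, may take the value $+\infty$, and is bounded below (by $-\rho_{\sigma,\tau}(0)$), so the expectations and conditional expectations above are well defined in $(-\infty,+\infty]$. *)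

theory Defs
  imports "HOL-Probability.Probability"
begin

text \<open>
  The filtration is indexed by \<^typ>\<open>ennreal\<close>: the values \<open>F t\<close> for \<open>t < \<infinity>\<close> form the filtration
  indexed by the nonnegative reals, and \<open>F \<infinity>\<close> is the \<open>\<sigma>\<close>-algebra of \<open>M\<close>, the given \<open>\<sigma>\<close>-algebra at
  infinity. With this index type, \<^const>\<open>stopping_time\<close> is the usual notion of a stopping time
  with values in \<open>[0, \<infinity>]\<close>, and the condition at \<open>t = \<infinity>\<close> in \<^const>\<open>filtration.pre_sigma\<close> is
  membership in the \<open>\<sigma>\<close>-algebra of \<open>M\<close>. Only the sets of \<open>F t\<close> matter, not its measure.
\<close>

locale filtered_prob_space =
  prob_space M + filtration "space M" F
  for M :: "'a measure" and F :: "ennreal \<Rightarrow> 'a measure" +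
  assumes sets_F_infinity: "sets (F \<infinity>) = sets M"
    and right_continuous: "\<And>t. t < \<infinity> \<Longrightarrow> sets (F t) = (\<Inter>s\<in>{t<..<\<infinity>}. sets (F s))"
    and sets_F_0: "sets (F 0) = sigma_sets (space M) (null_sets M)"

abbreviation stopped_sigma :: "'a measure \<Rightarrow> (ennreal \<Rightarrow> 'a measure) \<Rightarrow> ('a \<Rightarrow> ennreal) \<Rightarrow> 'a measure"
  where "stopped_sigma M F \<tau> \<equiv> filtration.pre_sigma (space M) F \<tau>"

definition ordered_stopping_times ::
    "'a measure \<Rightarrow> (ennreal \<Rightarrow> 'a measure) \<Rightarrow> ('a \<Rightarrow> ennreal) \<Rightarrow> ('a \<Rightarrow> ennreal) \<Rightarrow> bool"
  where "ordered_stopping_times M F \<sigma> \<tau> \<longleftrightarrow>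
    stopping_time F \<sigma> \<and> stopping_time F \<tau> \<and> (\<forall>\<omega>\<in>space M. \<sigma> \<omega> \<le> \<tau> \<omega>)"

text \<open>Representatives of the elements of \<open>L\<^sup>\<infinity>(\<Omega>, G, P)\<close>, where \<open>M\<close> carries the measure \<open>P\<close>.\<close>

definition Linf :: "'a measure \<Rightarrow> 'a measure \<Rightarrow> ('a \<Rightarrow> real) set"
  where "Linf M G = {X \<in> borel_measurable G. \<exists>C. AE \<omega> in M. \<bar>X \<omega>\<bar> \<le> C}"

text \<open>
  The maps act on representatives. Monotonicity, applied in both directions, shows that they
  respect almost sure equality and so are maps between the spaces of classes.
\<close>

definition dynamic_risk_measure ::
    "'a measure \<Rightarrow> (ennreal \<Rightarrow> 'a measure) \<Rightarrow>
      (('a \<Rightarrow> ennreal) \<Rightarrow> ('a \<Rightarrow> ennreal) \<Rightarrow> ('a \<Rightarrow> real) \<Rightarrow> ('a \<Rightarrow> real)) \<Rightarrow> bool"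
  where "dynamic_risk_measure M F \<rho> \<longleftrightarrow>
    (\<forall>\<sigma> \<tau>. ordered_stopping_times M F \<sigma> \<tau> \<longrightarrow>
      (\<forall>X \<in> Linf M (stopped_sigma M F \<tau>). \<rho> \<sigma> \<tau> X \<in> Linf M (stopped_sigma M F \<sigma>)) \<and>
      (\<forall>X \<in> Linf M (stopped_sigma M F \<tau>). \<forall>Y \<in> Linf M (stopped_sigma M F \<tau>).
         (AE \<omega> in M. X \<omega> \<le> Y \<omega>) \<longrightarrow> (AE \<omega> in M. \<rho> \<sigma> \<tau> X \<omega> \<ge> \<rho> \<sigma> \<tau> Y \<omega>)) \<and>
      (\<forall>X \<in> Linf M (stopped_sigma M F \<tau>). \<forall>Z \<in> Linf M (stopped_sigma M F \<sigma>).
         AE \<omega> in M. \<rho> \<sigma> \<tau> (\<lambda>\<omega>'. X \<omega>' + Z \<omega>') \<omega> = \<rho> \<sigma> \<tau> X \<omega> - Z \<omega>) \<and>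
      (\<forall>X \<in> Linf M (stopped_sigma M F \<tau>). \<forall>Y \<in> Linf M (stopped_sigma M F \<tau>). \<forall>c \<in> {0..1}.
         AE \<omega> in M. \<rho> \<sigma> \<tau> (\<lambda>\<omega>'. c * X \<omega>' + (1 - c) * Y \<omega>') \<omega>
           \<le> c * \<rho> \<sigma> \<tau> X \<omega> + (1 - c) * \<rho> \<sigma> \<tau> Y \<omega>))"

definition continuous_from_above ::
    "'a measure \<Rightarrow> (ennreal \<Rightarrow> 'a measure) \<Rightarrow>
      (('a \<Rightarrow> ennreal) \<Rightarrow> ('a \<Rightarrow> ennreal) \<Rightarrow> ('a \<Rightarrow> real) \<Rightarrow> ('a \<Rightarrow> real)) \<Rightarrow> bool"
  where "continuous_from_above M F \<rho> \<longleftrightarrow>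
    (\<forall>\<sigma> \<tau>. ordered_stopping_times M F \<sigma> \<tau> \<longrightarrow>
      (\<forall>(Xs :: nat \<Rightarrow> 'a \<Rightarrow> real) X.
         (\<forall>n. Xs n \<in> Linf M (stopped_sigma M F \<tau>)) \<and> X \<in> Linf M (stopped_sigma M F \<tau>) \<and>
         (AE \<omega> in M. decseq (\<lambda>n. Xs n \<omega>)) \<and>
         (AE \<omega> in M. (\<lambda>n. Xs n \<omega>) \<longlonglongrightarrow> X \<omega>) \<longrightarrow>
         (AE \<omega> in M. (\<lambda>n. \<rho> \<sigma> \<tau> (Xs n) \<omega>) \<longlonglongrightarrow> \<rho> \<sigma> \<tau> X \<omega>)))"

definition time_consistent ::
    "'a measure \<Rightarrow> (ennreal \<Rightarrow> 'a measure) \<Rightarrow>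
      (('a \<Rightarrow> ennreal) \<Rightarrow> ('a \<Rightarrow> ennreal) \<Rightarrow> ('a \<Rightarrow> real) \<Rightarrow> ('a \<Rightarrow> real)) \<Rightarrow> bool"
  where "time_consistent M F \<rho> \<longleftrightarrow>
    (\<forall>\<nu> \<sigma> \<tau>. ordered_stopping_times M F \<nu> \<sigma> \<and> ordered_stopping_times M F \<sigma> \<tau> \<longrightarrow>
      (\<forall>X \<in> Linf M (stopped_sigma M F \<tau>).
         AE \<omega> in M. \<rho> \<nu> \<sigma> (\<lambda>\<omega>'. - \<rho> \<sigma> \<tau> X \<omega>') \<omega> = \<rho> \<nu> \<tau> X \<omega>))"

text \<open>
  Expectation and conditional expectation with values in \<^typ>\<open>ereal\<close>, as the difference of those
  of the positive and the negative part (\<^const>\<open>e2ennreal\<close> sends negative arguments to \<open>0\<close>).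
  They are only meaningful if one of the two parts has finite expectation, in particular for
  functions that are almost surely bounded below. The second one parallels the definition of
  \<^const>\<open>real_cond_exp\<close>.
\<close>

definition ereal_expectation :: "'a measure \<Rightarrow> ('a \<Rightarrow> ereal) \<Rightarrow> ereal"
  where "ereal_expectation Q f =
    enn2ereal (\<integral>\<^sup>+ \<omega>. e2ennreal (f \<omega>) \<partial>Q) - enn2ereal (\<integral>\<^sup>+ \<omega>. e2ennreal (- f \<omega>) \<partial>Q)"

definition ereal_cond_exp :: "'a measure \<Rightarrow> 'a measure \<Rightarrow> ('a \<Rightarrow> ereal) \<Rightarrow> ('a \<Rightarrow> ereal)"
  where "ereal_cond_exp Q G f = (\<lambda>\<omega>.
    enn2ereal (nn_cond_exp Q G (\<lambda>\<omega>'. e2ennreal (f \<omega>')) \<omega>)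
      - enn2ereal (nn_cond_exp Q G (\<lambda>\<omega>'. e2ennreal (- f \<omega>')) \<omega>))"

text \<open>
  Essential supremum of a (possibly uncountable) family of measurable functions: the least
  measurable function, up to null sets, that dominates each member almost everywhere.
  On a finite measure space it exists and is unique up to null sets; \<open>ess_sup_family\<close> is some
  version of it.
\<close>

definition is_ess_sup :: "'a measure \<Rightarrow> ('a \<Rightarrow> ereal) set \<Rightarrow> ('a \<Rightarrow> ereal) \<Rightarrow> bool"
  where "is_ess_sup N S f \<longleftrightarrow>
    f \<in> borel_measurable N \<and>
    (\<forall>g\<in>S. AE \<omega> in N. g \<omega> \<le> f \<omega>) \<and>
    (\<forall>h\<in>borel_measurable N. (\<forall>g\<in>S. AE \<omega> in N. g \<omega> \<le> h \<omega>) \<longrightarrow> (AE \<omega> in N. f \<omega> \<le> h \<omega>))"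

definition ess_sup_family :: "'a measure \<Rightarrow> ('a \<Rightarrow> ereal) set \<Rightarrow> ('a \<Rightarrow> ereal)"
  where "ess_sup_family N S = (SOME f. is_ess_sup N S f)"

text \<open>
  The members of the family are measurable with respect to the \<open>\<sigma>\<close>-algebra at \<open>\<sigma>\<close>, so their
  essential supremum is taken with respect to the restriction of \<open>Q\<close> to that \<open>\<sigma>\<close>-algebra.
\<close>

definition min_penalty ::
    "'a measure \<Rightarrow> (ennreal \<Rightarrow> 'a measure) \<Rightarrow>
      (('a \<Rightarrow> ennreal) \<Rightarrow> ('a \<Rightarrow> ennreal) \<Rightarrow> ('a \<Rightarrow> real) \<Rightarrow> ('a \<Rightarrow> real)) \<Rightarrow>
      ('a \<Rightarrow> ennreal) \<Rightarrow> ('a \<Rightarrow> ennreal) \<Rightarrow> 'a measure \<Rightarrow> ('a \<Rightarrow> ereal)"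
  where "min_penalty M F \<rho> \<sigma> \<tau> Q =
    ess_sup_family (restr_to_subalg Q (stopped_sigma M F \<sigma>))
      {(\<lambda>\<omega>. ereal (real_cond_exp Q (stopped_sigma M F \<sigma>) (\<lambda>\<omega>'. - X \<omega>') \<omega> - \<rho> \<sigma> \<tau> X \<omega>)) | X.
         X \<in> Linf M (stopped_sigma M F \<tau>)}"

text \<open>
  Probability measures on the sub-\<open>\<sigma>\<close>-algebra \<open>G\<close> that are absolutely continuous with respect to
  the restriction of \<open>M\<close> to \<open>G\<close>.
\<close>

definition ac_prob_measure :: "'a measure \<Rightarrow> 'a measure \<Rightarrow> 'a measure \<Rightarrow> bool"
  where "ac_prob_measure M G Q \<longleftrightarrow>
    prob_space Q \<and> sets Q = sets G \<and> absolutely_continuous (restr_to_subalg M G) Q"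

end

(*
  For the direction from consistency to the supermartingale property, the penalty is the limit of an
  increasing sequence E_Q(-Y_n | F_sigma) - rho_{sigma,tau}(Y_n), and Y_n may be shifted so that
  rho_{sigma,tau}(Y_n) = rho_{sigma,tau}(X); consistency then gives rho_{nu,tau}(Y_n) = rho_{nu,tau}(X),
  and conditional monotone convergence concludes.

  For the converse, property 2 reduces consistency to the implication
  rho_{sigma,tau}(X) = rho_{sigma,tau}(Y) ==> rho_{nu,tau}(X) = rho_{nu,tau}(Y). For each eps > 0 the
  convex functional E_P(rho_{nu,tau}) has an eps-optimal measure Q << P at Y, and the inequality of
  property 1 for X under Q, compared with E_Q(-Y | F_sigma) <= rho_{sigma,tau}(Y) + alpha_{sigma,tau}(Q),
  gives E_P(rho_{nu,tau}(Y)) <= E_P(rho_{nu,tau}(X)) + eps. The countably additive Q replaces the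
  Krein-Smulian theorem: its density is an L^1-limit of approximate multipliers on balls of L^infinity
  of radius 2^k, each obtained from a first-order condition at the minimum of a penalised functional.
*)

theory Submission
  imports Defs
begin

section \<open>Bounded functions and Cantor intersection\<close>

text \<open>Plain separation on the space of bounded functions would give only finitely additive
  multipliers, and continuity from above controls just bounded sequences that converge almost
  everywhere. Midpoint-convex sets closed under such convergence still have the Cantor intersection
  property; this yields minimisers, hence multipliers in \<open>L^1\<close>. The measure Q found for
  \<epsilon> has two further properties. Translation invariance forces Q to agree with P on the
  sigma-algebra at \<nu>, so risks measured at \<nu> have the same expectation under both.
  Near-optimality bounds the Q-expectation of every member of the family defining the penalty, which
  gives the finite expected penalty that property 1 demands. All of this compares expectations only;
  the almost sure inequality comes from pasting X and Y along the set where it would fail.\<close>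

definition Linf_ball :: "'a measure \<Rightarrow> real \<Rightarrow> ('a \<Rightarrow> real) set"
  where "Linf_ball M R = {U \<in> borel_measurable M. AE x in M. \<bar>U x\<bar> \<le> R}"

lemma Linf_ballD:
  assumes "U \<in> Linf_ball M R"
  shows "U \<in> borel_measurable M" "AE x in M. \<bar>U x\<bar> \<le> R"
  using assms by (auto simp: Linf_ball_def)

lemma Linf_ball_convex:
  assumes "U \<in> Linf_ball M R" "V \<in> Linf_ball M R" "0 \<le> t" "t \<le> (1::real)"
  shows "(\<lambda>x. t * U x + (1 - t) * V x) \<in> Linf_ball M R"
proof -
  have "AE x in M. \<bar>t * U x + (1 - t) * V x\<bar> \<le> R"
    using Linf_ballD(2)[OF assms(1)] Linf_ballD(2)[OF assms(2)]
  proof eventually_elim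
    case (elim x)
    have "\<bar>t * U x + (1 - t) * V x\<bar> \<le> t * \<bar>U x\<bar> + (1 - t) * \<bar>V x\<bar>"
      using assms(3,4) by (metis abs_mult abs_of_nonneg abs_triangle_ineq diff_ge_0_iff_ge)
    also have "\<dots> \<le> t * R + (1 - t) * R"
      using elim assms(3,4) by (intro add_mono mult_left_mono) auto
    finally show ?case by (simp add: algebra_simps)
  qed
  moreover have [measurable]: "U \<in> borel_measurable M" "V \<in> borel_measurable M"
    using assms by (auto simp: Linf_ball_def)
  ultimately show ?thesis by (auto simp: Linf_ball_def)
qed

lemma Linf_ball_mono: "R \<le> S \<Longrightarrow> Linf_ball M R \<subseteq> Linf_ball M S"
  unfolding Linf_ball_def by (auto elim: eventually_mono)

lemma Linf_ball_AE_limit: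
  assumes "\<And>k. Us k \<in> Linf_ball M R" "U \<in> borel_measurable M"
    and "AE x in M. (\<lambda>k. Us k x) \<longlonglongrightarrow> U x"
  shows "U \<in> Linf_ball M R"
proof -
  have "AE x in M. \<forall>k. \<bar>Us k x\<bar> \<le> R"
    using Linf_ballD(2)[OF assms(1)] by (simp add: AE_all_countable)
  with assms(3) have "AE x in M. \<bar>U x\<bar> \<le> R"
  proof eventually_elim
    case (elim x)
    then show ?case using LIMSEQ_le_const2[OF tendsto_rabs[OF elim(1)]] by blast
  qed
  then show ?thesis using assms(2) by (simp add: Linf_ball_def)
qed

lemma (in finite_measure) integrable_Linf_ball:
  assumes "U \<in> Linf_ball M R" shows "integrable M U"
  using assms by (intro integrable_const_bound[where B=R]) (auto simp: Linf_ball_def)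

lemma integrable_mult_Linf_ball:
  fixes Z :: "'a \<Rightarrow> real"
  assumes "integrable M Z" "U \<in> Linf_ball M R"
  shows "integrable M (\<lambda>x. Z x * U x)"
proof (rule Bochner_Integration.integrable_bound)
  show "integrable M (\<lambda>x. \<bar>R\<bar> * Z x)" using assms(1) by simp
  show "(\<lambda>x. Z x * U x) \<in> borel_measurable M"
    using assms by (auto simp: Linf_ball_def)
  show "AE x in M. norm (Z x * U x) \<le> norm (\<bar>R\<bar> * Z x)"
    using Linf_ballD(2)[OF assms(2)]
  proof eventually_elim
    case (elim x)
    then have "\<bar>Z x\<bar> * \<bar>U x\<bar> \<le> \<bar>Z x\<bar> * \<bar>R\<bar>" by (intro mult_left_mono) auto
    then show ?case by (simp add: abs_mult mult.commute)
  qed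
qed

lemma integral_mult_Linf_ball_le:
  fixes Z :: "'a \<Rightarrow> real"
  assumes "integrable M Z" "U \<in> Linf_ball M R"
  shows "\<bar>\<integral>x. Z x * U x \<partial>M\<bar> \<le> R * (\<integral>x. \<bar>Z x\<bar> \<partial>M)"
proof -
  have "\<bar>\<integral>x. Z x * U x \<partial>M\<bar> \<le> (\<integral>x. \<bar>Z x * U x\<bar> \<partial>M)"
    by (rule integral_abs_bound)
  also have "\<dots> \<le> (\<integral>x. R * \<bar>Z x\<bar> \<partial>M)"
  proof (rule integral_mono_AE)
    show "integrable M (\<lambda>x. \<bar>Z x * U x\<bar>)"
      using integrable_mult_Linf_ball[OF assms] by simp
    show "integrable M (\<lambda>x. R * \<bar>Z x\<bar>)" using assms(1) by simp
    show "AE x in M. \<bar>Z x * U x\<bar> \<le> R * \<bar>Z x\<bar>"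
      using Linf_ballD(2)[OF assms(2)]
      by eventually_elim (simp add: abs_mult mult.commute[of "\<bar>Z _\<bar>"] mult_right_mono)
  qed
  finally show ?thesis by simp
qed

text \<open>The differences have summable \<open>L^1\<close>-norms, so the sum of their absolute
  values is integrable. That sum makes the telescoping series converge almost everywhere and also
  dominates \<open>\<bar>u n - f\<bar>\<close>, so one limit serves both modes of
  convergence.\<close>

lemma L1_fast_Cauchy_limit:
  fixes u :: "nat \<Rightarrow> 'a \<Rightarrow> real"
  assumes int: "\<And>n. integrable M (u n)"
    and fast: "\<And>n. (\<integral>x. \<bar>u (Suc n) x - u n x\<bar> \<partial>M) \<le> B * (1/2)^n"
  obtains f where "integrable M f" "AE x in M. (\<lambda>n. u n x) \<longlonglongrightarrow> f x"
    "(\<lambda>n. \<integral>x. \<bar>u n x - f x\<bar> \<partial>M) \<longlonglongrightarrow> 0"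
proof -
  define d where "d n x = u (Suc n) x - u n x" for n x
  have d_int: "integrable M (d n)" for n unfolding d_def using int by simp
  have sumB: "summable (\<lambda>n. B * (1/2)^n :: real)"
    by (intro summable_mult summable_geometric) simp
  have sum1: "summable (\<lambda>n. \<integral>x. \<bar>d n x\<bar> \<partial>M)"
    by (rule summable_comparison_test'[OF sumB, of 0]) (use fast in \<open>auto simp: d_def\<close>)
  have "(\<integral>\<^sup>+x. (\<Sum>n. ennreal \<bar>d n x\<bar>) \<partial>M) = (\<Sum>n. \<integral>\<^sup>+x. ennreal \<bar>d n x\<bar> \<partial>M)"
    using d_int by (intro nn_integral_suminf) auto
  also have "\<dots> = (\<Sum>n. ennreal (\<integral>x. \<bar>d n x\<bar> \<partial>M))"
    using d_int by (intro suminf_cong nn_integral_eq_integral) auto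
  also have "\<dots> < \<infinity>"
    using sum1 by (subst suminf_ennreal2) auto
  finally have "AE x in M. (\<Sum>n. ennreal \<bar>d n x\<bar>) \<noteq> \<infinity>"
    using d_int by (intro nn_integral_PInf_AE) auto
  then have sumx: "AE x in M. summable (\<lambda>n. \<bar>d n x\<bar>)"
    by eventually_elim (rule summable_suminf_not_top, auto)
  define f where "f x = u 0 x + (\<Sum>n. d n x)" for x
  have i_suminf: "integrable M (\<lambda>x. \<Sum>n. d n x)"
    using sumx sum1 d_int by (intro integrable_suminf) auto
  have f_int: "integrable M f" unfolding f_def using int i_suminf by simp
  have conv: "AE x in M. (\<lambda>n. u n x) \<longlonglongrightarrow> f x"
    using sumx
  proof eventually_elim
    case (elim x)
    then have "(\<lambda>n. \<Sum>i<n. d i x) \<longlonglongrightarrow> (\<Sum>n. d n x)"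
      by (intro summable_LIMSEQ) (rule summable_rabs_cancel)
    then have "(\<lambda>n. u 0 x + (\<Sum>i<n. d i x)) \<longlonglongrightarrow> f x"
      unfolding f_def by (intro tendsto_intros)
    moreover have "u 0 x + (\<Sum>i<n. d i x) = u n x" for n
      unfolding d_def by (subst sum_lessThan_telescope) simp
    ultimately show ?case by simp
  qed
  have "(\<lambda>n. \<integral>x. \<bar>u n x - f x\<bar> \<partial>M) \<longlonglongrightarrow> (\<integral>x. 0 \<partial>M)"
  proof (rule integral_dominated_convergence)
    show "integrable M (\<lambda>x. \<Sum>n. \<bar>d n x\<bar>)"
      using sumx sum1 d_int by (intro integrable_suminf) auto
    show "AE x in M. (\<lambda>n. \<bar>u n x - f x\<bar>) \<longlonglongrightarrow> 0"
      using conv by eventually_elim (auto simp: LIM_zero_iff intro: tendsto_rabs_zero)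
    show "AE x in M. norm \<bar>u n x - f x\<bar> \<le> (\<Sum>n. \<bar>d n x\<bar>)" for n
      using sumx
    proof eventually_elim
      case (elim x)
      have s: "summable (\<lambda>n. d n x)" using elim by (rule summable_rabs_cancel)
      have "u n x = u 0 x + (\<Sum>i<n. d i x)"
        unfolding d_def by (subst sum_lessThan_telescope) simp
      then have "u n x - f x = - (\<Sum>i. d (i + n) x)"
        unfolding f_def using suminf_minus_initial_segment[OF s, of n] by simp
      then have "\<bar>u n x - f x\<bar> = \<bar>\<Sum>i. d (i + n) x\<bar>" by simp
      also have "\<dots> \<le> (\<Sum>i. \<bar>d (i + n) x\<bar>)"
        using elim by (intro summable_rabs) (simp add: summable_iff_shift[of "\<lambda>i. \<bar>d i x\<bar>"])
      also have "\<dots> = (\<Sum>i. \<bar>d i x\<bar>) - (\<Sum>i<n. \<bar>d i x\<bar>)"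
        by (rule suminf_minus_initial_segment[OF elim])
      also have "\<dots> \<le> (\<Sum>i. \<bar>d i x\<bar>)" by (simp add: sum_nonneg)
      finally show ?case by simp
    qed
  qed (use int f_int in auto)
  then show ?thesis using that f_int conv by simp
qed

text \<open>Integrates \<open>2 * c * \<bar>U\<bar> \<le> U^2 + c^2\<close>. It converts the
  \<open>L^2\<close> estimate of the parallelogram law into the \<open>L^1\<close> estimate that
  \<open>L1_fast_Cauchy_limit\<close> asks for.\<close>

lemma (in prob_space) expectation_abs_le_of_square:
  assumes "U \<in> Linf_ball M R" "expectation (\<lambda>x. (U x)\<^sup>2) \<le> c\<^sup>2" "0 < c"
  shows "expectation (\<lambda>x. \<bar>U x\<bar>) \<le> c"
proof -
  have [measurable]: "U \<in> borel_measurable M" using assms by (auto simp: Linf_ball_def)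
  have i2: "integrable M (\<lambda>x. (U x)\<^sup>2)"
    using integrable_mult_Linf_ball[OF integrable_Linf_ball[OF assms(1)] assms(1)]
    by (simp add: power2_eq_square)
  have "2 * c * \<bar>U x\<bar> \<le> (U x)\<^sup>2 + c\<^sup>2" for x
    using zero_le_power2[of "\<bar>U x\<bar> - c"] by (simp add: power2_diff algebra_simps)
  then have "expectation (\<lambda>x. 2 * c * \<bar>U x\<bar>) \<le> expectation (\<lambda>x. (U x)\<^sup>2 + c\<^sup>2)"
    using i2 integrable_Linf_ball[OF assms(1)] by (intro integral_mono) auto
  also have "\<dots> = expectation (\<lambda>x. (U x)\<^sup>2) + c\<^sup>2"
    using i2 by (simp add: prob_space)
  finally have "2 * c * expectation (\<lambda>x. \<bar>U x\<bar>) \<le> 2 * c * c"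
    using assms(2) by (simp add: power2_eq_square)
  then show ?thesis using assms(3) by simp
qed

text \<open>
  Near-minimisers of the \<open>L\<^sup>2\<close>-norm form a Cauchy sequence by the parallelogram law; this replaces
  weak compactness.
\<close>

lemma (in prob_space) Cantor_intersection_Linf_ball:
  fixes C :: "nat \<Rightarrow> (('a \<Rightarrow> real) \<times> real) set"
  assumes sub: "\<And>n. C n \<subseteq> Linf_ball M R \<times> {0..S}"
    and ne: "\<And>n. C n \<noteq> {}"
    and dec: "decseq C"
    and mid: "\<And>n U V s t. (U, s) \<in> C n \<Longrightarrow> (V, t) \<in> C n
      \<Longrightarrow> (\<lambda>x. (1/2) * U x + (1 - 1/2) * V x, (s + t) / 2) \<in> C n"
    and closed: "\<And>n Us ss U s. (\<And>k. (Us k, ss k) \<in> C n) \<Longrightarrow> U \<in> borel_measurable M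
      \<Longrightarrow> AE x in M. (\<lambda>k. Us k x) \<longlonglongrightarrow> U x \<Longrightarrow> ss \<longlonglongrightarrow> s \<Longrightarrow> (U, s) \<in> C n"
  shows "\<exists>p. \<forall>n. p \<in> C n"
proof -
  \<comment> \<open>The squared norm of \<open>L^2\<close> times the real line: the scalar is a
    second coordinate and takes part in the same minimisation.\<close>
  define E where "E p = expectation (\<lambda>x. (fst p x)\<^sup>2) + (snd p)\<^sup>2" for p :: "('a \<Rightarrow> real) \<times> real"
  define d where "d n = Inf (E ` C n)" for n
  have E0: "0 \<le> E p" for p unfolding E_def by simp
  have bdd: "bdd_below (E ` C n)" for n using E0 by (intro bdd_belowI[of _ 0]) auto
  have ball: "U \<in> Linf_ball M R" "s \<in> {0..S}" if "(U, s) \<in> C n" for U s n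
    using sub[of n] that by auto
  have sqint: "integrable M (\<lambda>x. U x * V x)" if "U \<in> Linf_ball M R" "V \<in> Linf_ball M R" for U V
    using integrable_mult_Linf_ball[OF integrable_Linf_ball] that by auto
  have dE: "d n \<le> E p" if "p \<in> C n" for n p
    unfolding d_def using that bdd by (intro cInf_lower) auto
  have d_mono: "d m \<le> d n" if "m \<le> n" for m n
    unfolding d_def using ne bdd decseqD[OF dec that] by (intro cInf_superset_mono) auto
  have d_bdd: "d n \<le> R\<^sup>2 + S\<^sup>2" for n
  proof -
    obtain U s where p: "(U, s) \<in> C n" using ne[of n] by fastforce
    have "expectation (\<lambda>x. (U x)\<^sup>2) \<le> expectation (\<lambda>x. R\<^sup>2)"
    proof (rule integral_mono_AE)
      show "AE x in M. (U x)\<^sup>2 \<le> R\<^sup>2"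
        using Linf_ballD(2)[OF ball(1)[OF p]] by eventually_elim (metis abs_ge_zero power2_abs power_mono)
    qed (use sqint[OF ball(1)[OF p] ball(1)[OF p]] in \<open>auto simp: power2_eq_square\<close>)
    moreover have "s\<^sup>2 \<le> S\<^sup>2" using ball(2)[OF p] by (auto intro: power_mono)
    ultimately have "E (U, s) \<le> R\<^sup>2 + S\<^sup>2" unfolding E_def by (simp add: prob_space)
    then show ?thesis using dE[OF p] by simp
  qed
  have "Bseq d"
    using d_bdd d_mono[of 0] by (intro BseqI'[where K="\<bar>d 0\<bar> + (R\<^sup>2 + S\<^sup>2)"])
      (smt (verit) real_norm_def zero_le zero_le_power2)
  then have "convergent d"
    by (rule Bseq_monoseq_convergent) (use d_mono in \<open>auto intro: monoI1\<close>)
  then have dCauchy: "Cauchy d" by (rule convergent_Cauchy)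
  have "\<exists>p. p \<in> C n \<and> E p < d n + 1 / Suc n" for n
  proof -
    have "Inf (E ` C n) < d n + 1 / Suc n" unfolding d_def by simp
    from cInf_lessD[OF _ this] ne show ?thesis by auto
  qed
  then obtain p where p: "\<And>n. p n \<in> C n" "\<And>n. E (p n) < d n + 1 / Suc n" by metis
  define U where "U n = fst (p n)" for n
  define s where "s n = snd (p n)" for n
  have pU: "(U n, s n) \<in> C m" if "m \<le> n" for m n
    using p(1)[of n] decseqD[OF dec that] by (auto simp: U_def s_def)
  have Ub: "U n \<in> Linf_ball M R" for n using ball(1)[OF pU[OF order_refl]] .
  have diffb: "(\<lambda>x. U m x - U n x) \<in> Linf_ball M (2 * R)" for m n
  proof -
    have "AE x in M. \<bar>U m x - U n x\<bar> \<le> 2 * R"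
      using Linf_ballD(2)[OF Ub[of m]] Linf_ballD(2)[OF Ub[of n]]
      by eventually_elim linarith
    then show ?thesis using Linf_ballD(1)[OF Ub] by (simp add: Linf_ball_def)
  qed
  \<comment> \<open>The midpoint lies in \<open>C n\<close>, so its energy is at least
    \<open>d n\<close>. As \<open>E (p m) < d m + 1 / Suc m\<close> and
    \<open>1 / Suc m \<le> 1 / Suc n\<close>, the parallelogram identity leaves
    \<open>2 * (d m - d n) + 4 / Suc n\<close> for the squared distance.\<close>
  have para: "expectation (\<lambda>x. (U m x - U n x)\<^sup>2) + (s m - s n)\<^sup>2
      \<le> 2 * (d m - d n) + 4 / Suc n" if "n \<le> m" for m n
  proof -
    let ?V = "\<lambda>x. (1/2) * U m x + (1 - 1/2) * U n x" and ?t = "(s m + s n) / 2"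
    have "(?V, ?t) \<in> C n" using mid pU that by blast
    then have "d n \<le> E (?V, ?t)" by (rule dE)
    also have "4 * E (?V, ?t) = expectation (\<lambda>x. (U m x + U n x)\<^sup>2) + (s m + s n)\<^sup>2"
    proof -
      have "4 * expectation (\<lambda>x. (?V x)\<^sup>2) = expectation (\<lambda>x. 4 * (?V x)\<^sup>2)" by simp
      also have "\<dots> = expectation (\<lambda>x. (U m x + U n x)\<^sup>2)"
        by (intro Bochner_Integration.integral_cong) (auto simp: power2_eq_square field_simps)
      finally show ?thesis unfolding E_def by (simp add: power2_eq_square field_simps)
    qed
    also have "expectation (\<lambda>x. (U m x + U n x)\<^sup>2) + expectation (\<lambda>x. (U m x - U n x)\<^sup>2)
        = 2 * expectation (\<lambda>x. (U m x)\<^sup>2) + 2 * expectation (\<lambda>x. (U n x)\<^sup>2)"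
    proof -
      have "integrable M (\<lambda>x. (U m x + U n x)\<^sup>2)" "integrable M (\<lambda>x. (U m x - U n x)\<^sup>2)"
        "integrable M (\<lambda>x. (U m x)\<^sup>2)" "integrable M (\<lambda>x. (U n x)\<^sup>2)"
        using sqint[OF Ub Ub] by (auto simp: power2_eq_square algebra_simps)
      note i = this
      have "expectation (\<lambda>x. (U m x + U n x)\<^sup>2) + expectation (\<lambda>x. (U m x - U n x)\<^sup>2)
          = expectation (\<lambda>x. (U m x + U n x)\<^sup>2 + (U m x - U n x)\<^sup>2)"
        using i(1,2) by (rule Bochner_Integration.integral_add[symmetric])
      also have "\<dots> = expectation (\<lambda>x. 2 * (U m x)\<^sup>2 + 2 * (U n x)\<^sup>2)"
        by (intro Bochner_Integration.integral_cong) (auto simp: power2_eq_square algebra_simps)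
      finally show ?thesis using i(3,4) by simp
    qed
    hence "expectation (\<lambda>x. (U m x + U n x)\<^sup>2) = 2 * expectation (\<lambda>x. (U m x)\<^sup>2)
      + 2 * expectation (\<lambda>x. (U n x)\<^sup>2) - expectation (\<lambda>x. (U m x - U n x)\<^sup>2)" by simp
    finally have "4 * d n \<le> 2 * E (p m) + 2 * E (p n)
        - (expectation (\<lambda>x. (U m x - U n x)\<^sup>2) + (s m - s n)\<^sup>2)"
      unfolding E_def U_def s_def by (simp add: power2_eq_square algebra_simps)
    moreover have "1 / real (Suc m) \<le> 1 / real (Suc n)"
      using that by (simp add: frac_le)
    moreover have "4 / real (Suc n) = 4 * (1 / real (Suc n))" by simp
    ultimately show ?thesis using p(2)[of m] p(2)[of n] by argo
  qed
  \<comment> \<open>The target is the square of \<open>(1/2)^k\<close> because \<open>para\<close>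
    bounds squared distances.\<close>
  have "\<exists>N. \<forall>n\<ge>N. \<forall>m\<ge>n. 2 * (d m - d n) + 4 / Suc n \<le> ((1/2)^k)\<^sup>2" for k
  proof -
    define e :: real where "e = ((1/2)^k)\<^sup>2"
    have e: "e > 0" by (simp add: e_def)
    obtain N1 where N1: "\<And>m n. m \<ge> N1 \<Longrightarrow> n \<ge> N1 \<Longrightarrow> norm (d m - d n) < e / 4"
      using CauchyD[OF dCauchy, of "e/4"] e by auto
    obtain N2 where N2: "8 / e < real N2" using reals_Archimedean2 by blast
    have "2 * (d m - d n) + 4 / Suc n \<le> e" if "n \<ge> max N1 N2" "m \<ge> n" for m n
    proof -
      have "8 / e < Suc n" using N2 that by linarith
      then have "4 / Suc n < e / 2" using e by (simp add: field_simps)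
      moreover have "norm (d m - d n) < e / 4" using N1 that by auto
      ultimately show ?thesis by (simp add: abs_if split: if_splits)
    qed
    then show ?thesis unfolding e_def by blast
  qed
  then obtain N where N: "\<And>k n m. n \<ge> N k \<Longrightarrow> m \<ge> n
    \<Longrightarrow> 2 * (d m - d n) + 4 / Suc n \<le> ((1/2)^k)\<^sup>2" by metis
  \<comment> \<open>The sum makes \<open>r\<close> nondecreasing and at least \<open>N k\<close>;
    the summand \<open>k\<close> gives \<open>r k \<ge> k\<close>, which later puts the tail of the
    subsequence inside each \<open>C n\<close>.\<close>
  define r where "r k = (\<Sum>i\<le>k. N i) + k" for k
  have rN: "r k \<ge> N k" for k unfolding r_def by (simp add: member_le_sum trans_le_add1)
  have rk: "r k \<ge> k" for k unfolding r_def by simp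
  have rS: "r k \<le> r (Suc k)" for k unfolding r_def by simp
  have close: "expectation (\<lambda>x. (U (r (Suc k)) x - U (r k) x)\<^sup>2) + (s (r (Suc k)) - s (r k))\<^sup>2
      \<le> ((1/2)^k)\<^sup>2" for k
    using para[OF rS[of k]] N[OF rN[of k] rS[of k]] by linarith
  have "expectation (\<lambda>x. \<bar>U (r (Suc k)) x - U (r k) x\<bar>) \<le> 1 * (1/2)^k" for k
  proof -
    have "expectation (\<lambda>x. (U (r (Suc k)) x - U (r k) x)\<^sup>2) \<le> ((1/2)^k)\<^sup>2"
      using close[of k] zero_le_power2[of "s (r (Suc k)) - s (r k)"] by linarith
    then show ?thesis using expectation_abs_le_of_square[OF diffb] by simp
  qed
  from L1_fast_Cauchy_limit[OF integrable_Linf_ball[OF Ub] this]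
  obtain V where V: "integrable M V" "AE x in M. (\<lambda>k. U (r k) x) \<longlonglongrightarrow> V x" by metis
  \<comment> \<open>The scalars are treated as constant functions, so the same limit lemma applies;
    since a probability space is not null, convergence holds at some point \<open>x\<close>, and
    \<open>sl x\<close> is the limit.\<close>
  have "expectation (\<lambda>x. \<bar>s (r (Suc k)) - s (r k)\<bar>) \<le> 1 * (1/2)^k" for k
  proof -
    have "0 \<le> expectation (\<lambda>x. (U (r (Suc k)) x - U (r k) x)\<^sup>2)" by simp
    then have "(s (r (Suc k)) - s (r k))\<^sup>2 \<le> ((1/2)^k)\<^sup>2" using close[of k] by linarith
    then have "\<bar>s (r (Suc k)) - s (r k)\<bar> \<le> (1/2)^k" by (simp add: power2_le_iff_abs_le)
    then show ?thesis by (simp add: prob_space)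
  qed
  from L1_fast_Cauchy_limit[OF _ this]
  obtain sl where sl: "AE x in M. (\<lambda>k. s (r k)) \<longlonglongrightarrow> sl x" by auto
  have "\<exists>x. (\<lambda>k. s (r k)) \<longlonglongrightarrow> sl x"
  proof (rule ccontr)
    assume "\<not> ?thesis"
    with sl have "AE x in M. False" by auto
    then show False by simp
  qed
  then obtain x where x: "(\<lambda>k. s (r k)) \<longlonglongrightarrow> sl x" ..
  have "(V, sl x) \<in> C n" for n
  proof (rule closed[of "\<lambda>k. U (r (k + n))" "\<lambda>k. s (r (k + n))"])
    show "(U (r (k + n)), s (r (k + n))) \<in> C n" for k
      using rk[of "k + n"] by (intro pU) auto
    show "AE x in M. (\<lambda>k. U (r (k + n)) x) \<longlonglongrightarrow> V x"
      using V(2) by eventually_elim (rule LIMSEQ_ignore_initial_segment)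
  qed (use V(1) LIMSEQ_ignore_initial_segment[OF x, of n] in auto)
  then show ?thesis by blast
qed

section \<open>Lower semicontinuous convex functionals and their minimisers\<close>

text \<open>A convergent majorant \<open>c\<close> takes the place of a limit inferior: adding a
  functional that is continuous along the sequence then only shifts \<open>c\<close>. Semicontinuity
  is required only for sequences in one ball, the setting in which continuity from above and
  dominated convergence work.\<close>

definition lsc_convex :: "'a measure \<Rightarrow> (('a \<Rightarrow> real) \<Rightarrow> real) \<Rightarrow> bool"
  where "lsc_convex M g \<longleftrightarrow>
    (\<forall>R t. \<forall>U \<in> Linf_ball M R. \<forall>V \<in> Linf_ball M R. 0 \<le> t \<longrightarrow> t \<le> 1 \<longrightarrow>
       g (\<lambda>x. t * U x + (1 - t) * V x) \<le> t * g U + (1 - t) * g V) \<and>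
    (\<forall>R Us U c l. (\<forall>k. Us k \<in> Linf_ball M R) \<longrightarrow> U \<in> borel_measurable M \<longrightarrow>
       (AE x in M. (\<lambda>k. Us k x) \<longlonglongrightarrow> U x) \<longrightarrow> (\<forall>k. g (Us k) \<le> c k) \<longrightarrow> c \<longlonglongrightarrow> l \<longrightarrow> g U \<le> l)"

lemma lsc_convexD:
  assumes "lsc_convex M g"
  shows "U \<in> Linf_ball M R \<Longrightarrow> V \<in> Linf_ball M R \<Longrightarrow> 0 \<le> t \<Longrightarrow> t \<le> 1
      \<Longrightarrow> g (\<lambda>x. t * U x + (1 - t) * V x) \<le> t * g U + (1 - t) * g V"
    and "(\<And>k. Us k \<in> Linf_ball M R) \<Longrightarrow> U \<in> borel_measurable M \<Longrightarrow>
       AE x in M. (\<lambda>k. Us k x) \<longlonglongrightarrow> U x \<Longrightarrow> (\<And>k. g (Us k) \<le> c k) \<Longrightarrow> c \<longlonglongrightarrow> l \<Longrightarrow> g U \<le> l"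
  using assms unfolding lsc_convex_def by blast+

lemma tendsto_integral_mult_Linf_ball:
  fixes Z :: "'a \<Rightarrow> real"
  assumes "integrable M Z" "\<And>k. Us k \<in> Linf_ball M R" "U \<in> borel_measurable M"
    "AE x in M. (\<lambda>k. Us k x) \<longlonglongrightarrow> U x"
  shows "(\<lambda>k. \<integral>x. Z x * Us k x \<partial>M) \<longlonglongrightarrow> (\<integral>x. Z x * U x \<partial>M)"
proof (rule integral_dominated_convergence)
  show "integrable M (\<lambda>x. R * \<bar>Z x\<bar>)" using assms(1) by simp
  show "AE x in M. (\<lambda>k. Z x * Us k x) \<longlonglongrightarrow> Z x * U x"
    using assms(4) by eventually_elim (intro tendsto_intros)
  show "AE x in M. norm (Z x * Us k x) \<le> R * \<bar>Z x\<bar>" for k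
    using Linf_ballD(2)[OF assms(2)[of k]]
    by eventually_elim (simp add: abs_mult mult.commute[of "\<bar>Z _\<bar>"] mult_right_mono)
  have [measurable]: "Z \<in> borel_measurable M" "U \<in> borel_measurable M" "Us k \<in> borel_measurable M" for k
    using assms(1,2,3) by (auto simp: Linf_ball_def)
  show "(\<lambda>x. Z x * U x) \<in> borel_measurable M" "(\<lambda>x. Z x * Us k x) \<in> borel_measurable M" for k
    by measurable
qed

text \<open>Keeps the class stable under adding a multiplier, so that the separation step can be
  iterated on the corrected functional.\<close>

lemma (in prob_space) lsc_convex_add_linear:
  assumes g: "lsc_convex M g" and Z: "integrable M Z"
  shows "lsc_convex M (\<lambda>U. g U + expectation (\<lambda>x. Z x * U x))"
  unfolding lsc_convex_def
proof safe
  fix R t :: real and U V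
  assume UV: "U \<in> Linf_ball M R" "V \<in> Linf_ball M R" and t: "0 \<le> t" "t \<le> 1"
  have "expectation (\<lambda>x. Z x * (t * U x + (1 - t) * V x))
      = expectation (\<lambda>x. t * (Z x * U x) + (1 - t) * (Z x * V x))"
    by (intro Bochner_Integration.integral_cong) (auto simp: algebra_simps)
  also have "\<dots> = t * expectation (\<lambda>x. Z x * U x) + (1 - t) * expectation (\<lambda>x. Z x * V x)"
    using integrable_mult_Linf_ball[OF Z UV(1)] integrable_mult_Linf_ball[OF Z UV(2)] by simp
  finally show "g (\<lambda>x. t * U x + (1 - t) * V x) + expectation (\<lambda>x. Z x * (t * U x + (1 - t) * V x))
      \<le> t * (g U + expectation (\<lambda>x. Z x * U x)) + (1 - t) * (g V + expectation (\<lambda>x. Z x * V x))"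
    using lsc_convexD(1)[OF g UV t] by (simp add: algebra_simps)
next
  fix R Us U c l
  assume Us: "\<forall>k. Us k \<in> Linf_ball M R" and U: "U \<in> borel_measurable M"
    and ae: "AE x in M. (\<lambda>k. Us k x) \<longlonglongrightarrow> U x"
    and le: "\<forall>k. g (Us k) + expectation (\<lambda>x. Z x * Us k x) \<le> c k" and c: "c \<longlonglongrightarrow> l"
  have lim: "(\<lambda>k. c k - expectation (\<lambda>x. Z x * Us k x)) \<longlonglongrightarrow> l - expectation (\<lambda>x. Z x * U x)"
    using tendsto_integral_mult_Linf_ball[OF Z _ U ae, of R] Us by (intro tendsto_diff c) auto
  have "g U \<le> l - expectation (\<lambda>x. Z x * U x)"
    by (rule lsc_convexD(2)[OF g _ U ae _ lim, of R]) (use Us le in \<open>auto simp: algebra_simps\<close>)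
  then show "g U + expectation (\<lambda>x. Z x * U x) \<le> l" by simp
qed

text \<open>Midpoints are what \<open>Cantor_intersection_Linf_ball\<close> asks for. The
  coefficient is spelled \<open>1 - 1/2\<close> to match the instance \<open>t = 1/2\<close> of
  \<open>Linf_ball_convex\<close> and \<open>lsc_convexD\<close>.\<close>

definition lsc_midconvex :: "'a measure \<Rightarrow> real \<Rightarrow> real \<Rightarrow> (('a \<Rightarrow> real) \<Rightarrow> real \<Rightarrow> real) \<Rightarrow> bool"
  where "lsc_midconvex M R S J \<longleftrightarrow>
    (\<forall>U \<in> Linf_ball M R. \<forall>V \<in> Linf_ball M R. \<forall>s \<in> {0..S}. \<forall>t \<in> {0..S}.
       J (\<lambda>x. (1/2) * U x + (1 - 1/2) * V x) ((s + t) / 2) \<le> (J U s + J V t) / 2) \<and>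
    (\<forall>Us ss U s c l. (\<forall>k. Us k \<in> Linf_ball M R \<and> ss k \<in> {0..S}) \<longrightarrow> U \<in> borel_measurable M \<longrightarrow>
       (AE x in M. (\<lambda>k. Us k x) \<longlonglongrightarrow> U x) \<longrightarrow> ss \<longlonglongrightarrow> s \<longrightarrow> (\<forall>k. J (Us k) (ss k) \<le> c k) \<longrightarrow>
       c \<longlonglongrightarrow> l \<longrightarrow> J U s \<le> l)"

lemma lsc_midconvexD:
  assumes "lsc_midconvex M R S J"
  shows "U \<in> Linf_ball M R \<Longrightarrow> V \<in> Linf_ball M R \<Longrightarrow> s \<in> {0..S} \<Longrightarrow> t \<in> {0..S} \<Longrightarrow>
       J (\<lambda>x. (1/2) * U x + (1 - 1/2) * V x) ((s + t) / 2) \<le> (J U s + J V t) / 2"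
    and "(\<And>k. Us k \<in> Linf_ball M R) \<Longrightarrow> (\<And>k. ss k \<in> {0..S}) \<Longrightarrow> U \<in> borel_measurable M \<Longrightarrow>
       AE x in M. (\<lambda>k. Us k x) \<longlonglongrightarrow> U x \<Longrightarrow> ss \<longlonglongrightarrow> s \<Longrightarrow> (\<And>k. J (Us k) (ss k) \<le> c k) \<Longrightarrow>
       c \<longlonglongrightarrow> l \<Longrightarrow> J U s \<le> l"
  using assms unfolding lsc_midconvex_def by blast+

text \<open>The levels decrease while the functionals increase, so the sublevel sets are nested. A
  constant family \<open>J\<close> yields a minimiser; a family whose penalty term grows with
  \<open>n\<close> yields a point at which that term vanishes.\<close>

lemma (in prob_space) Cantor_intersection_sublevel:
  assumes J: "\<And>n. lsc_midconvex M R S (J n)"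
    and J_mono: "\<And>m n U s. m \<le> n \<Longrightarrow> U \<in> Linf_ball M R \<Longrightarrow> s \<in> {0..S} \<Longrightarrow> J m U s \<le> J n U s"
    and c: "decseq c"
    and ne: "\<And>n. \<exists>U\<in>Linf_ball M R. \<exists>s\<in>{0..S}. J n U s \<le> c n"
  obtains U s where "U \<in> Linf_ball M R" "s \<in> {0..S}" "\<And>n. J n U s \<le> c n"
proof -
  define C where "C n = {(U, s). U \<in> Linf_ball M R \<and> s \<in> {0..S} \<and> J n U s \<le> c n}" for n :: nat
  have "\<exists>p. \<forall>n. p \<in> C n"
  proof (rule Cantor_intersection_Linf_ball)
    show "C n \<subseteq> Linf_ball M R \<times> {0..S}" for n
      by (auto simp: C_def)
    show "C n \<noteq> {}" for n
      using ne[of n] unfolding C_def by blast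
    show "decseq C"
    proof (rule decseq_SucI)
      show "C (Suc n) \<subseteq> C n" for n
        using J_mono[of n "Suc n"] decseq_SucD[OF c, of n] by (fastforce simp: C_def)
    qed
  next
    fix n U V s t assume a: "(U, s) \<in> C n" "(V, t) \<in> C n"
    have "(\<lambda>x. (1/2) * U x + (1 - 1/2) * V x) \<in> Linf_ball M R"
      using a by (intro Linf_ball_convex) (auto simp: C_def)
    moreover have "J n (\<lambda>x. (1/2) * U x + (1 - 1/2) * V x) ((s + t) / 2) \<le> (J n U s + J n V t) / 2"
      using a by (intro lsc_midconvexD(1)[OF J[of n]]) (auto simp: C_def)
    ultimately show "(\<lambda>x. (1/2) * U x + (1 - 1/2) * V x, (s + t) / 2) \<in> C n"
      using a by (auto simp: C_def)
  next
    fix n Us ss U s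
    assume a: "\<And>k. (Us k, ss k) \<in> C n" "U \<in> borel_measurable M"
      "AE x in M. (\<lambda>k. Us k x) \<longlonglongrightarrow> U x" "ss \<longlonglongrightarrow> s"
    have Us: "Us k \<in> Linf_ball M R" "ss k \<in> {0..S}" "J n (Us k) (ss k) \<le> c n" for k
      using a(1)[of k] by (auto simp: C_def)
    have "s \<in> {0..S}"
      using LIMSEQ_le_const[OF a(4), of 0] LIMSEQ_le_const2[OF a(4), of S] Us(2) by auto
    moreover have "J n U s \<le> c n"
      by (rule lsc_midconvexD(2)[OF J[of n] Us(1,2) a(2-4) Us(3) tendsto_const])
    ultimately show "(U, s) \<in> C n"
      using Linf_ball_AE_limit[OF Us(1) a(2,3)] by (simp add: C_def)
  qed
  then show ?thesis using that by (auto simp: C_def)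
qed

lemma (in prob_space) lsc_midconvex_attains_min:
  assumes J: "lsc_midconvex M R S J" and "0 \<le> R" "0 \<le> S"
    and lower: "\<And>U s. U \<in> Linf_ball M R \<Longrightarrow> s \<in> {0..S} \<Longrightarrow> b \<le> J U s"
  obtains U s where "U \<in> Linf_ball M R" "s \<in> {0..S}"
    "\<And>V t. V \<in> Linf_ball M R \<Longrightarrow> t \<in> {0..S} \<Longrightarrow> J U s \<le> J V t"
proof -
  define A where "A = {J U s | U s. U \<in> Linf_ball M R \<and> s \<in> {0..S}}"
  have A: "A \<noteq> {}"
    using assms(2,3) by (auto simp: A_def Linf_ball_def intro!: exI[of _ "\<lambda>_. 0"] exI[of _ "0::real"])
  have bdd: "bdd_below A" using lower by (intro bdd_belowI[of _ b]) (auto simp: A_def)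
  have ex: "\<exists>U\<in>Linf_ball M R. \<exists>s\<in>{0..S}. J U s \<le> Inf A + 1 / Suc n" for n
  proof -
    have "Inf A < Inf A + 1 / Suc n" by simp
    from cInf_lessD[OF A this] show ?thesis by (force simp: A_def)
  qed
  have dec: "decseq (\<lambda>n. Inf A + 1 / Suc n)" by (auto simp: decseq_def frac_le)
  obtain U s where U: "U \<in> Linf_ball M R" "s \<in> {0..S}" "\<And>n. J U s \<le> Inf A + 1 / Suc n"
    using Cantor_intersection_sublevel[of R S "\<lambda>_. J" "\<lambda>n. Inf A + 1 / Suc n", OF J _ dec ex] by blast
  have "J U s \<le> Inf A"
  proof (rule LIMSEQ_le_const)
    show "(\<lambda>n. Inf A + 1 / Suc n) \<longlonglongrightarrow> Inf A"
      using tendsto_add[OF tendsto_const LIMSEQ_inverse_real_of_nat, of "Inf A"] by (simp add: inverse_eq_divide)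
  qed (use U(3) in blast)
  moreover have "Inf A \<le> J V t" if "V \<in> Linf_ball M R" "t \<in> {0..S}" for V t
    using that bdd by (intro cInf_lower) (auto simp: A_def)
  ultimately show ?thesis using that U(1,2) by (meson order_trans)
qed

text \<open>The square of \<open>max 0 (\<bar>u\<bar> - s)\<close> has a Lipschitz gradient, and
  this is its first-order expansion with quadratic remainder; the derivative is
  \<open>2 * a * sgn u\<close> in \<open>u\<close> and \<open>- 2 * a\<close> in \<open>s\<close>.
  The kink of \<open>\<bar>u\<bar>\<close> at \<open>0\<close> is harmless because
  \<open>a = 0\<close> there when \<open>s \<ge> 0\<close>. The constant \<open>3\<close> comes from
  the case where \<open>u + h\<close> has crossed \<open>0\<close>: the left side is at most the
  squared increment, and the linear term can be negative by up to twice that amount.\<close>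

lemma soft_threshold_square_le:
  fixes u s h k :: real
  assumes "0 \<le> s"
  defines "a \<equiv> max 0 (\<bar>u\<bar> - s)"
  shows "(max 0 (\<bar>u + h\<bar> - (s + k)))\<^sup>2 \<le> a\<^sup>2 + 2 * (a * (sgn u * h - k)) + 3 * (\<bar>h\<bar> + \<bar>k\<bar>)\<^sup>2"
proof (cases "\<bar>u\<bar> \<le> s")
  case True
  then have "max 0 (\<bar>u + h\<bar> - (s + k)) \<le> \<bar>h\<bar> + \<bar>k\<bar>" by (simp add: max_def) linarith
  then have "(max 0 (\<bar>u + h\<bar> - (s + k)))\<^sup>2 \<le> (\<bar>h\<bar> + \<bar>k\<bar>)\<^sup>2" by (intro power_mono) auto
  then have "(max 0 (\<bar>u + h\<bar> - (s + k)))\<^sup>2 \<le> 3 * (\<bar>h\<bar> + \<bar>k\<bar>)\<^sup>2"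
    using zero_le_power2[of "\<bar>h\<bar> + \<bar>k\<bar>"] by linarith
  moreover have "a = 0" using True by (simp add: a_def)
  ultimately show ?thesis by (simp only: zero_power2 mult_zero_left mult_zero_right add_0)
next
  case False
  define w where "w = sgn u * h"
  have a: "a = \<bar>u\<bar> - s" "a > 0" using False by (auto simp: a_def)
  have u0: "u \<noteq> 0" using False assms by auto
  have uw: "\<bar>u + h\<bar> = \<bar>\<bar>u\<bar> + w\<bar>" "\<bar>w\<bar> = \<bar>h\<bar>"
    using u0 by (auto simp: w_def sgn_if abs_if)
  show ?thesis
  proof (cases "0 \<le> \<bar>u\<bar> + w")
    case True
    then have e: "\<bar>u + h\<bar> - (s + k) = a + (w - k)" using uw a by simp
    have "(max 0 (a + (w - k)))\<^sup>2 \<le> (a + (w - k))\<^sup>2"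
      by (simp add: max_def)
    also have "\<dots> = a\<^sup>2 + 2 * (a * (w - k)) + (w - k)\<^sup>2" by (simp add: power2_eq_square algebra_simps)
    also have "(w - k)\<^sup>2 \<le> (\<bar>h\<bar> + \<bar>k\<bar>)\<^sup>2" using uw by (simp add: abs_le_square_iff[symmetric])
    finally show ?thesis unfolding e w_def[symmetric] using zero_le_power2[of "\<bar>h\<bar> + \<bar>k\<bar>"] by linarith
  next
    case False
    have h: "a \<le> \<bar>h\<bar>" using False uw a assms by linarith
    have "max 0 (\<bar>u + h\<bar> - (s + k)) \<le> \<bar>h\<bar> + \<bar>k\<bar>" using uw False a assms by (simp add: max_def) linarith
    then have 1: "(max 0 (\<bar>u + h\<bar> - (s + k)))\<^sup>2 \<le> (\<bar>h\<bar> + \<bar>k\<bar>)\<^sup>2" by (intro power_mono) auto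
    have "a * (k - w) \<le> a * (\<bar>h\<bar> + \<bar>k\<bar>)" using a uw by (intro mult_left_mono) linarith+
    also have "\<dots> \<le> (\<bar>h\<bar> + \<bar>k\<bar>) * (\<bar>h\<bar> + \<bar>k\<bar>)" using h by (intro mult_right_mono) auto
    finally have "- (a * (w - k)) \<le> (\<bar>h\<bar> + \<bar>k\<bar>)\<^sup>2" by (simp add: power2_eq_square algebra_simps)
    then show ?thesis using 1 unfolding w_def[symmetric] using zero_le_power2[of a] by linarith
  qed
qed

section \<open>Countably additive multipliers\<close>

text \<open>
  The functional \<open>J n U s\<close> smooths \<open>g U + \<delta> * ess sup \<bar>U\<bar>\<close>: as \<open>n\<close> grows, the quadratic term forces
  \<open>\<bar>U\<bar> \<le> s\<close>. The multiplier \<open>Z\<close> is the gradient of that term in \<open>U\<close> at the minimum, and the first-order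
  condition in \<open>s\<close> bounds its \<open>L\<^sup>1\<close>-norm by \<open>\<delta>\<close>.
\<close>

lemma (in prob_space) separation_step:
  assumes g: "lsc_convex M g" and "0 \<le> R" "0 \<le> \<delta>" "0 < \<eta>"
    and lower: "\<And>U t. 0 \<le> t \<Longrightarrow> t \<le> R \<Longrightarrow> U \<in> Linf_ball M t \<Longrightarrow> - \<epsilon> - \<delta> * t \<le> g U"
  obtains Z where "integrable M Z" "expectation (\<lambda>x. \<bar>Z x\<bar>) \<le> \<delta>"
    "\<And>U. U \<in> Linf_ball M R \<Longrightarrow> - \<epsilon> - \<eta> \<le> g U + expectation (\<lambda>x. Z x * U x)"
proof -
  \<comment> \<open>The extra unit above \<open>R\<close> leaves room to increase \<open>s0\<close>
    in the first-order condition whenever \<open>s0 < R\<close>.\<close>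
  define S where "S = R + 1"
  define A where "A U s x = max 0 (\<bar>U x\<bar> - s)" for U :: "'a \<Rightarrow> real" and s x
  define T where "T U s = expectation (\<lambda>x. (A U s x)\<^sup>2)" for U s
  \<comment> \<open>The factor \<open>1/2\<close> cancels the \<open>2\<close> in the derivative of
    the square; the factor \<delta> makes the penalty scale with the norm term.\<close>
  define J where "J n U s = g U + \<delta> * s + \<delta> * real n / 2 * T U s" for n U s
  have A_ball: "A U s \<in> Linf_ball M R" if "U \<in> Linf_ball M R" "s \<in> {0..S}" for U s
  proof -
    have [measurable]: "U \<in> borel_measurable M" using that by (auto simp: Linf_ball_def)
    have "AE x in M. \<bar>A U s x\<bar> \<le> R"
      using Linf_ballD(2)[OF that(1)] by eventually_elim (use that \<open>0 \<le> R\<close> in \<open>auto simp: A_def\<close>)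
    then show ?thesis unfolding Linf_ball_def A_def by simp
  qed
  have A_int: "integrable M (\<lambda>x. (A U s x)\<^sup>2)" if "U \<in> Linf_ball M R" "s \<in> {0..S}" for U s
    using integrable_mult_Linf_ball[OF integrable_Linf_ball A_ball[OF that], of "A U s" R] A_ball[OF that]
    by (simp add: power2_eq_square)
  have T0: "0 \<le> T U s" for U s by (simp add: T_def)
  have J_mid: "lsc_midconvex M R S (J n)" for n
    unfolding lsc_midconvex_def
  proof (intro conjI ballI allI impI)
    fix U V s t
    assume U: "U \<in> Linf_ball M R" and V: "V \<in> Linf_ball M R" and s: "s \<in> {0..S}" and t: "t \<in> {0..S}"
    let ?W = "\<lambda>x. (1/2) * U x + (1 - 1/2) * V x"
    have W: "?W \<in> Linf_ball M R" using U V by (rule Linf_ball_convex) auto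
    have st: "(s + t) / 2 \<in> {0..S}" using s t by auto
    have pt: "(A ?W ((s + t) / 2) x)\<^sup>2 \<le> ((A U s x)\<^sup>2 + (A V t x)\<^sup>2) / 2" for x
    proof -
      have "\<bar>?W x\<bar> \<le> (\<bar>U x\<bar> + \<bar>V x\<bar>) / 2" by (simp add: abs_if)
      moreover have "max 0 (w - (s + t) / 2) \<le> (max 0 (u - s) + max 0 (v - t)) / 2"
        if "w \<le> (u + v) / 2" for u v w :: real
      proof (rule max.boundedI)
        have p: "u - s \<le> max 0 (u - s)" "v - t \<le> max 0 (v - t)" by auto
        then show "w - (s + t) / 2 \<le> (max 0 (u - s) + max 0 (v - t)) / 2"
          using that by argo
      qed simp
      ultimately have "A ?W ((s + t) / 2) x \<le> (A U s x + A V t x) / 2"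
        unfolding A_def by blast
      then have "(A ?W ((s + t) / 2) x)\<^sup>2 \<le> ((A U s x + A V t x) / 2)\<^sup>2"
        by (intro power_mono) (auto simp: A_def)
      also have "\<dots> \<le> ((A U s x)\<^sup>2 + (A V t x)\<^sup>2) / 2"
        using zero_le_power2[of "A U s x - A V t x"] by (simp add: power2_eq_square field_simps)
      finally show ?thesis .
    qed
    have "T ?W ((s + t) / 2) \<le> expectation (\<lambda>x. ((A U s x)\<^sup>2 + (A V t x)\<^sup>2) / 2)"
      unfolding T_def using A_int[OF W st] A_int[OF U s] A_int[OF V t] pt by (intro integral_mono) auto
    also have "\<dots> = (T U s + T V t) / 2"
      unfolding T_def using A_int[OF U s] A_int[OF V t] by simp
    finally have "\<delta> * real n / 2 * T ?W ((s + t) / 2) \<le> \<delta> * real n / 2 * ((T U s + T V t) / 2)"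
      using \<open>0 \<le> \<delta>\<close> by (intro mult_left_mono) auto
    moreover have "g ?W \<le> (1/2) * g U + (1 - 1/2) * g V"
      by (rule lsc_convexD(1)[OF g U V]) auto
    ultimately show "J n ?W ((s + t) / 2) \<le> (J n U s + J n V t) / 2"
      unfolding J_def by (simp add: field_simps)
  next
    fix Us ss U s c l
    assume Us: "\<forall>k. Us k \<in> Linf_ball M R \<and> ss k \<in> {0..S}" and U: "U \<in> borel_measurable M"
      and ae: "AE x in M. (\<lambda>k. Us k x) \<longlonglongrightarrow> U x" and ss: "ss \<longlonglongrightarrow> s"
      and le: "\<forall>k. J n (Us k) (ss k) \<le> c k" and c: "c \<longlonglongrightarrow> l"
    have [measurable]: "U \<in> borel_measurable M" "Us k \<in> borel_measurable M" for k
      using Us U by (auto simp: Linf_ball_def)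
    have T: "(\<lambda>k. T (Us k) (ss k)) \<longlonglongrightarrow> T U s"
      unfolding T_def
    proof (rule integral_dominated_convergence)
      show "AE x in M. (\<lambda>k. (A (Us k) (ss k) x)\<^sup>2) \<longlonglongrightarrow> (A U s x)\<^sup>2"
        using ae unfolding A_def by eventually_elim (intro tendsto_intros ss)
      show "AE x in M. norm ((A (Us k) (ss k) x)\<^sup>2) \<le> R\<^sup>2" for k
      proof -
        have "AE x in M. \<bar>A (Us k) (ss k) x\<bar> \<le> R" using A_ball Us Linf_ballD(2) by blast
        then show ?thesis
          by eventually_elim (metis abs_ge_zero norm_power power_mono real_norm_def)
      qed
    qed (auto simp: A_def)
    have lim: "(\<lambda>k. c k - \<delta> * ss k - \<delta> * real n / 2 * T (Us k) (ss k))
        \<longlonglongrightarrow> l - \<delta> * s - \<delta> * real n / 2 * T U s"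
      by (intro tendsto_intros c ss T)
    have "g U \<le> l - \<delta> * s - \<delta> * real n / 2 * T U s"
      by (rule lsc_convexD(2)[OF g _ U ae _ lim, of R]) (use Us le in \<open>auto simp: J_def algebra_simps\<close>)
    then show "J n U s \<le> l" by (simp add: J_def)
  qed
  \<comment> \<open>If every \<open>n\<close> failed, the nested sublevel sets would have a common
    point, where the penalty has to vanish because its weight is unbounded; that point then violates
    \<open>lower\<close>.\<close>
  have "\<exists>n. \<forall>U\<in>Linf_ball M R. \<forall>s\<in>{0..S}. - \<epsilon> - \<eta> \<le> J n U s"
  proof (rule ccontr)
    assume "\<not> ?thesis"
    then have ne: "\<exists>U\<in>Linf_ball M R. \<exists>s\<in>{0..S}. J n U s \<le> - \<epsilon> - \<eta>" for n
      by (meson le_cases)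
    have J_mono: "J m U s \<le> J n U s" if "m \<le> n" for m n U s
    proof -
      have "\<delta> * real m / 2 * T U s \<le> \<delta> * real n / 2 * T U s"
        using that T0 \<open>0 \<le> \<delta>\<close> by (intro mult_right_mono divide_right_mono mult_left_mono) auto
      then show ?thesis by (simp add: J_def)
    qed
    obtain U s where U: "U \<in> Linf_ball M R" and s: "s \<in> {0..S}" and J: "\<And>n. J n U s \<le> - \<epsilon> - \<eta>"
      by (rule Cantor_intersection_sublevel[of R S J "\<lambda>_. - \<epsilon> - \<eta>"])
        (use J_mid J_mono ne in \<open>auto simp: decseq_def\<close>)
    have "\<delta> * T U s = 0"
    proof (rule ccontr)
      assume "\<delta> * T U s \<noteq> 0"
      moreover have "0 \<le> \<delta> * T U s" using \<open>0 \<le> \<delta>\<close> T0 by simp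
      ultimately have pos: "0 < \<delta> * T U s / 2" by linarith
      then obtain n where "- \<epsilon> - \<eta> - g U - \<delta> * s < real n * (\<delta> * T U s / 2)"
        using ex_less_of_nat_mult by blast
      then show False using J[of n] by (simp add: J_def field_simps)
    qed
    then have gU: "g U + \<delta> * s \<le> - \<epsilon> - \<eta>" using J[of 0] by (simp add: J_def)
    from \<open>\<delta> * T U s = 0\<close> consider "\<delta> = 0" | "T U s = 0" by auto
    then show False
    proof cases
      case 1
      then show False using lower[OF \<open>0 \<le> R\<close> order_refl U] gU \<open>0 < \<eta>\<close> by simp
    next
      case 2
      then have "AE x in M. (A U s x)\<^sup>2 = 0"
        unfolding T_def using A_int[OF U s] by (subst (asm) integral_nonneg_eq_0_iff_AE) auto
      \<comment> \<open>\<open>lower\<close> is available for radii up to \<open>R\<close>, while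
        \<open>s\<close> may exceed \<open>R\<close>; hence the minimum of the two.\<close>
      then have "AE x in M. \<bar>U x\<bar> \<le> min s R"
        using Linf_ballD(2)[OF U] by eventually_elim (auto simp: A_def max_def split: if_splits)
      then have "U \<in> Linf_ball M (min s R)" using U by (simp add: Linf_ball_def)
      then have "- \<epsilon> - \<delta> * min s R \<le> g U" using s \<open>0 \<le> R\<close> by (intro lower) auto
      moreover have "\<delta> * min s R \<le> \<delta> * s" using \<open>0 \<le> \<delta>\<close> by (intro mult_left_mono) auto
      ultimately show False using gU \<open>0 < \<eta>\<close> by linarith
    qed
  qed
  then obtain n where n: "\<And>U s. U \<in> Linf_ball M R \<Longrightarrow> s \<in> {0..S} \<Longrightarrow> - \<epsilon> - \<eta> \<le> J n U s" by blast
  obtain U0 s0 where U0: "U0 \<in> Linf_ball M R" and s0: "s0 \<in> {0..S}"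
    and min: "\<And>V t. V \<in> Linf_ball M R \<Longrightarrow> t \<in> {0..S} \<Longrightarrow> J n U0 s0 \<le> J n V t"
    by (rule lsc_midconvex_attains_min[OF J_mid[of n] _ _ n]) (use \<open>0 \<le> R\<close> in \<open>auto simp: S_def\<close>)
  define a where "a = A U0 s0"
  define Z where "Z x = \<delta> * real n * (a x * sgn (U0 x))" for x
  have a_ball: "a \<in> Linf_ball M R" unfolding a_def by (rule A_ball[OF U0 s0])
  have a_int: "integrable M a" by (rule integrable_Linf_ball[OF a_ball])
  have a0: "0 \<le> a x" for x by (simp add: a_def A_def)
  have absZ: "\<bar>Z x\<bar> = \<delta> * real n * a x" for x
    using \<open>0 \<le> \<delta>\<close> s0 a0[of x] by (auto simp: Z_def abs_mult sgn_if a_def A_def)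
  have [measurable]: "a \<in> borel_measurable M" "U0 \<in> borel_measurable M"
    using a_ball U0 by (auto simp: Linf_ball_def)
  have Z_meas [measurable]: "Z \<in> borel_measurable M" unfolding Z_def by measurable
  have Z_int: "integrable M Z"
    by (rule Bochner_Integration.integrable_bound[of M "\<lambda>x. \<delta> * real n * a x"])
      (use a_int absZ in auto)
  have asgn_int: "integrable M (\<lambda>x. a x * sgn (U0 x))"
    by (rule Bochner_Integration.integrable_bound[OF a_int]) (auto simp: abs_mult sgn_if)
  \<comment> \<open>Directional derivative at the minimiser towards \<open>(V, r)\<close>: the
    smooth part is expanded to first order, while for \<open>g\<close>, which need not be
    differentiable, convexity supplies the difference \<open>g V - g U0\<close>.\<close>
  have foc: "0 \<le> g V - g U0 + \<delta> * (r - s0) + expectation (\<lambda>x. Z x * (V x - U0 x))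
      - \<delta> * real n * expectation a * (r - s0)" (is "0 \<le> ?B")
    if V: "V \<in> Linf_ball M R" and r: "r \<in> {0..S}" for V r
  proof -
    \<comment> \<open>Bounds the quadratic remainder: \<open>\<bar>V - U0\<bar> \<le> 2 * R\<close>
      almost everywhere, \<open>\<bar>r - s0\<bar> \<le> S\<close>, and \<open>3\<close> is the
      constant of \<open>soft_threshold_square_le\<close>.\<close>
    define c where "c = \<delta> * real n / 2 * (3 * (2 * R + S)\<^sup>2)"
    define D where "D x = V x - U0 x" for x
    define e where "e = expectation (\<lambda>x. a x * sgn (U0 x) * D x) - expectation a * (r - s0)"
    have D_ball: "D \<in> Linf_ball M (2 * R)"
    proof -
      have "AE x in M. \<bar>D x\<bar> \<le> 2 * R"
        using Linf_ballD(2)[OF V] Linf_ballD(2)[OF U0] by eventually_elim (simp add: D_def)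
      moreover have "D \<in> borel_measurable M"
        unfolding D_def using Linf_ballD(1)[OF V] by measurable
      ultimately show ?thesis by (simp add: Linf_ball_def)
    qed
    have aD_int: "integrable M (\<lambda>x. a x * sgn (U0 x) * D x)"
      by (rule integrable_mult_Linf_ball[OF asgn_int D_ball])
    have "expectation (\<lambda>x. Z x * (V x - U0 x)) = \<delta> * real n * expectation (\<lambda>x. a x * sgn (U0 x) * D x)"
      by (simp add: Z_def D_def mult.assoc)
    then have B: "?B = g V - g U0 + \<delta> * (r - s0) + \<delta> * real n * e"
      unfolding e_def by (simp add: algebra_simps)
    have key: "- ?B \<le> t * c" if t: "0 < t" "t \<le> 1" for t
    proof -
      let ?W = "\<lambda>x. t * V x + (1 - t) * U0 x" and ?r = "t * r + (1 - t) * s0"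
      have W: "?W \<in> Linf_ball M R" using V U0 t by (intro Linf_ball_convex) auto
      have rS: "?r \<in> {0..S}"
        using r s0 t convex_bound_le[of r S s0 t "1 - t"] by auto
      have "AE x in M. (A ?W ?r x)\<^sup>2 \<le> (a x)\<^sup>2 + 2 * t * (a x * sgn (U0 x) * D x - a x * (r - s0))
          + 3 * t\<^sup>2 * (2 * R + S)\<^sup>2"
        using Linf_ballD(2)[OF D_ball]
      proof eventually_elim
        case (elim x)
        have eq: "?W x = U0 x + t * D x" "?r = s0 + t * (r - s0)"
          by (auto simp: D_def algebra_simps)
        have "(A ?W ?r x)\<^sup>2 \<le> (a x)\<^sup>2 + 2 * (a x * (sgn (U0 x) * (t * D x) - t * (r - s0)))
            + 3 * (\<bar>t * D x\<bar> + \<bar>t * (r - s0)\<bar>)\<^sup>2"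
          unfolding A_def a_def eq using s0 by (intro soft_threshold_square_le) auto
        also have "\<bar>t * D x\<bar> + \<bar>t * (r - s0)\<bar> = t * (\<bar>D x\<bar> + \<bar>r - s0\<bar>)"
          using t by (simp add: abs_mult distrib_left)
        also have "(t * (\<bar>D x\<bar> + \<bar>r - s0\<bar>))\<^sup>2 \<le> (t * (2 * R + S))\<^sup>2"
          using elim r s0 t by (intro power_mono mult_left_mono add_mono) auto
        also have "(t * (2 * R + S))\<^sup>2 = t\<^sup>2 * (2 * R + S)\<^sup>2" by (rule power_mult_distrib)
        also have "2 * (a x * (sgn (U0 x) * (t * D x) - t * (r - s0)))
            = 2 * t * (a x * sgn (U0 x) * D x - a x * (r - s0))" by (simp add: algebra_simps)
        finally show ?case by (simp add: mult.assoc)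
      qed
      then have "T ?W ?r \<le> expectation (\<lambda>x. (a x)\<^sup>2
          + 2 * t * (a x * sgn (U0 x) * D x - a x * (r - s0)) + 3 * t\<^sup>2 * (2 * R + S)\<^sup>2)"
        unfolding T_def using A_int[OF W rS] A_int[OF U0 s0] aD_int a_int
        by (intro integral_mono_AE) (auto simp: a_def[symmetric])
      also have "\<dots> = T U0 s0 + 2 * t * e + 3 * t\<^sup>2 * (2 * R + S)\<^sup>2"
        unfolding T_def e_def using A_int[OF U0 s0] aD_int a_int
        by (simp add: a_def[symmetric] prob_space)
      finally have "\<delta> * real n / 2 * T ?W ?r
          \<le> \<delta> * real n / 2 * (T U0 s0 + 2 * t * e + 3 * t\<^sup>2 * (2 * R + S)\<^sup>2)"
        using \<open>0 \<le> \<delta>\<close> by (intro mult_left_mono) auto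
      moreover have "g ?W \<le> t * g V + (1 - t) * g U0"
        using lsc_convexD(1)[OF g V U0] t by simp
      moreover have "J n U0 s0 \<le> J n ?W ?r" by (rule min[OF W rS])
      ultimately have "g U0 + \<delta> * s0 + \<delta> * real n / 2 * T U0 s0 \<le> t * g V + (1 - t) * g U0
          + \<delta> * ?r + \<delta> * real n / 2 * (T U0 s0 + 2 * t * e + 3 * t\<^sup>2 * (2 * R + S)\<^sup>2)"
        unfolding J_def by linarith
      then have "0 \<le> t * (?B + t * c)"
        unfolding B c_def by (simp add: algebra_simps power2_eq_square)
      then show ?thesis using t by (simp add: zero_le_mult_iff)
    qed
    have "- ?B \<le> 0"
    proof (rule LIMSEQ_le_const)
      show "(\<lambda>m. 1 / Suc m * c) \<longlonglongrightarrow> 0"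
        using tendsto_mult[OF LIMSEQ_inverse_real_of_nat tendsto_const, of c] by (simp add: inverse_eq_divide)
      show "\<exists>N. \<forall>m\<ge>N. - ?B \<le> 1 / Suc m * c" by (intro exI allI impI key) auto
    qed
    then show ?thesis by simp
  qed
  have EZ: "expectation (\<lambda>x. \<bar>Z x\<bar>) = \<delta> * real n * expectation a"
    unfolding absZ by simp
  show ?thesis
  proof
    show "integrable M Z" by fact
    \<comment> \<open>Raising \<open>s0\<close> to \<open>S\<close> with \<open>U0\<close> kept
      fixed gives the bound. If \<open>s0 \<ge> R\<close>, nothing of \<open>U0\<close> exceeds the
      threshold, so \<open>Z\<close> vanishes almost everywhere.\<close>
    show "expectation (\<lambda>x. \<bar>Z x\<bar>) \<le> \<delta>"
    proof (cases "s0 < R")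
      case True
      have "0 \<le> (\<delta> - \<delta> * real n * expectation a) * (S - s0)"
        using foc[OF U0, of S] \<open>0 \<le> R\<close> by (simp add: S_def algebra_simps)
      then show ?thesis using True unfolding EZ by (simp add: zero_le_mult_iff S_def)
    next
      case False
      have "AE x in M. a x = 0"
        using Linf_ballD(2)[OF U0] by eventually_elim (use False in \<open>auto simp: a_def A_def max_def\<close>)
      then have "expectation a = 0" using a_int a0 by (subst integral_nonneg_eq_0_iff_AE) auto
      then show ?thesis unfolding EZ using \<open>0 \<le> \<delta>\<close> by simp
    qed
    fix U assume U: "U \<in> Linf_ball M R"
    have ZU: "expectation (\<lambda>x. Z x * (U x - U0 x))
        = expectation (\<lambda>x. Z x * U x) - expectation (\<lambda>x. Z x * U0 x)"
      using integrable_mult_Linf_ball[OF Z_int U] integrable_mult_Linf_ball[OF Z_int U0]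
      by (simp add: right_diff_distrib)
    have "Z x * U0 x = \<delta> * real n * ((a x)\<^sup>2 + s0 * a x)" for x
    proof -
      have "a x * \<bar>U0 x\<bar> = (a x)\<^sup>2 + s0 * a x"
        by (auto simp: a_def A_def max_def power2_eq_square algebra_simps)
      moreover have "Z x * U0 x = \<delta> * real n * (a x * \<bar>U0 x\<bar>)"
        by (simp add: Z_def abs_sgn mult.commute mult.left_commute)
      ultimately show ?thesis by simp
    qed
    then have ZU0: "expectation (\<lambda>x. Z x * U0 x) = \<delta> * real n * (T U0 s0 + s0 * expectation a)"
      using A_int[OF U0 s0] a_int by (simp add: T_def a_def[symmetric])
    \<comment> \<open>With \<open>r = 0\<close> the terms in \<open>s0 * expectation a\<close> from
      the scalar direction and from \<open>Z * U0\<close> cancel. The penalty then occurs with twice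
      its weight in \<open>J\<close>, and the surplus is nonnegative.\<close>
    have "0 \<le> g U - g U0 - \<delta> * s0 + expectation (\<lambda>x. Z x * U x) - \<delta> * real n * T U0 s0"
      using foc[OF U, of 0] \<open>0 \<le> R\<close> unfolding ZU ZU0 by (simp add: S_def algebra_simps)
    moreover have "- \<epsilon> - \<eta> \<le> g U0 + \<delta> * s0 + \<delta> * real n * T U0 s0 / 2"
      using n[OF U0 s0] by (simp add: J_def)
    moreover have "0 \<le> \<delta> * real n * T U0 s0" using \<open>0 \<le> \<delta>\<close> T0 by simp
    ultimately show "- \<epsilon> - \<eta> \<le> g U + expectation (\<lambda>x. Z x * U x)" by linarith
  qed
qed


text \<open>
  The dual representation on \<open>L\<^sup>\<infinity>\<close> with countably additive measures, without weak-star compactness: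
  a multiplier that is good up to radius \<open>2^k\<close> is corrected to one that is good up to radius
  \<open>2^(k+1)\<close>. By convexity the defect grows at most linearly beyond radius \<open>2^k\<close>, so a correction of
  \<open>L\<^sup>1\<close>-norm \<open>O(2^-k)\<close> suffices and the corrections are summable.
\<close>

lemma (in prob_space) ex_L1_multiplier:
  assumes g: "lsc_convex M g" and g0: "g (\<lambda>_. 0) = 0" and "0 < \<epsilon>"
    and lower: "\<And>U t. 0 \<le> t \<Longrightarrow> U \<in> Linf_ball M t \<Longrightarrow> - t \<le> g U"
  obtains Z where "integrable M Z"
    "\<And>U R. U \<in> Linf_ball M R \<Longrightarrow> - \<epsilon> \<le> g U + expectation (\<lambda>x. Z x * U x)"
proof -
  \<comment> \<open>Starts at \<open>\<epsilon> / 2\<close> and stays below \<epsilon>; passing from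
    \<open>k\<close> to \<open>k + 1\<close> costs \<open>\<epsilon> * (1/2)^(k+2)\<close>, the
    slack granted to the separation step.\<close>
  define e where "e k = \<epsilon> * (1 - (1/2)^(Suc k))" for k :: nat
  define P where "P k Z \<longleftrightarrow> integrable M Z \<and>
    (\<forall>U\<in>Linf_ball M (2^k). - e k \<le> g U + expectation (\<lambda>x. Z x * U x))" for k Z
  have e0: "0 \<le> e k" and e_le: "e k \<le> \<epsilon>" for k
  proof -
    have "(1/2::real)^(Suc k) \<le> 1" by (rule power_le_one) auto
    then show "0 \<le> e k" using \<open>0 < \<epsilon>\<close> by (simp add: e_def)
    show "e k \<le> \<epsilon>" using \<open>0 < \<epsilon>\<close> by (simp add: e_def)
  qed
  have "\<exists>Z. \<forall>k. P k (Z k) \<and> expectation (\<lambda>x. \<bar>Z (Suc k) x - Z k x\<bar>) \<le> \<epsilon> * (1/2)^k"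
  proof (rule dependent_nat_choice)
    \<comment> \<open>The bound \<open>- t \<le> g U\<close> is the hypothesis of the separation
      step with defect \<open>0\<close> and slope \<open>1\<close>.\<close>
    obtain Z where "integrable M Z"
      "\<And>U. U \<in> Linf_ball M 1 \<Longrightarrow> - 0 - \<epsilon> / 2 \<le> g U + expectation (\<lambda>x. Z x * U x)"
      by (rule separation_step[OF g, of 1 1 "\<epsilon> / 2" 0]) (use lower \<open>0 < \<epsilon>\<close> in auto)
    then show "\<exists>Z. P 0 Z" by (auto simp: P_def e_def)
  next
    fix Z k assume "P k Z"
    then have Z: "integrable M Z"
      and Zk: "\<And>U. U \<in> Linf_ball M (2^k) \<Longrightarrow> - e k \<le> g U + expectation (\<lambda>x. Z x * U x)"
      by (auto simp: P_def)
    let ?h = "\<lambda>U. g U + expectation (\<lambda>x. Z x * U x)"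
    have h: "lsc_convex M ?h" by (rule lsc_convex_add_linear[OF g Z])
    have low: "- e k - e k / 2^k * t \<le> ?h U" if t: "0 \<le> t" and U: "U \<in> Linf_ball M t" for U t
    proof (cases "t \<le> 2^k")
      case True
      have "0 \<le> e k / 2^k * t" using e0 t by simp
      then show ?thesis using Zk[of U] U Linf_ball_mono[OF True] by fastforce
    next
      case False
      \<comment> \<open>Shrinks \<open>U\<close> to radius \<open>2^k\<close>; as the corrected
        functional is \<open>0\<close> at \<open>0\<close>, convexity multiplies the defect by
        \<open>1 / c\<close>, which gives the slope \<open>e k / 2^k\<close>.\<close>
      define c where "c = 2^k / t"
      have tpos: "t > 0" using False by (smt (verit) zero_less_power)
      then have c: "0 < c" "c \<le> 1" using False by (auto simp: c_def)
      have W: "(\<lambda>x. c * U x + (1 - c) * 0) \<in> Linf_ball M (2^k)"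
      proof -
        have "AE x in M. \<bar>c * U x\<bar> \<le> 2^k"
          using Linf_ballD(2)[OF U]
        proof eventually_elim
          case (elim x)
          then have "c * \<bar>U x\<bar> \<le> c * t" using c by (intro mult_left_mono) auto
          then show ?case using c tpos by (simp add: c_def abs_mult)
        qed
        then show ?thesis using Linf_ballD(1)[OF U] by (simp add: Linf_ball_def)
      qed
      have z: "(\<lambda>_. 0) \<in> Linf_ball M t" using t by (simp add: Linf_ball_def)
      have "- e k \<le> ?h (\<lambda>x. c * U x + (1 - c) * 0)" using Zk[OF W] .
      also have "\<dots> \<le> c * ?h U + (1 - c) * ?h (\<lambda>_. 0)"
        using lsc_convexD(1)[OF h U z] c by simp
      also have "?h (\<lambda>_. 0) = 0" using g0 by simp
      finally have "- e k \<le> c * ?h U" by simp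
      then have "- e k * (1 / c) \<le> c * ?h U * (1 / c)" using c by (intro mult_right_mono) auto
      also have "c * ?h U * (1 / c) = ?h U" using c by simp
      finally have "- (e k / 2^k * t) \<le> ?h U" by (simp add: c_def)
      then show ?thesis using e0[of k] by linarith
    qed
    have \<eta>: "e k + \<epsilon> * (1/2)^(k+2) = e (Suc k)" by (simp add: e_def algebra_simps)
    obtain Z' where Z': "integrable M Z'" "expectation (\<lambda>x. \<bar>Z' x\<bar>) \<le> e k / 2^k"
      "\<And>U. U \<in> Linf_ball M (2^Suc k) \<Longrightarrow> - e k - \<epsilon> * (1/2)^(k+2) \<le> ?h U + expectation (\<lambda>x. Z' x * U x)"
      by (rule separation_step[OF h, of "2^Suc k" "e k / 2^k" "\<epsilon> * (1/2)^(k+2)" "e k"])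
        (use low e0[of k] \<open>0 < \<epsilon>\<close> in auto)
    show "\<exists>Y. P (Suc k) Y \<and> expectation (\<lambda>x. \<bar>Y x - Z x\<bar>) \<le> \<epsilon> * (1/2)^k"
    proof (intro exI conjI)
      show "P (Suc k) (\<lambda>x. Z x + Z' x)"
        unfolding P_def
      proof (intro conjI ballI)
        fix U assume U: "U \<in> Linf_ball M (2^Suc k)"
        have "expectation (\<lambda>x. (Z x + Z' x) * U x) = expectation (\<lambda>x. Z x * U x) + expectation (\<lambda>x. Z' x * U x)"
          using integrable_mult_Linf_ball[OF Z U] integrable_mult_Linf_ball[OF Z'(1) U]
          by (simp add: distrib_right)
        then show "- e (Suc k) \<le> g U + expectation (\<lambda>x. (Z x + Z' x) * U x)"
          using Z'(3)[OF U] \<eta> by linarith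
      qed (use Z Z'(1) in auto)
      have "e k / 2^k \<le> \<epsilon> / 2^k" using e_le by (intro divide_right_mono) auto
      then show "expectation (\<lambda>x. \<bar>Z x + Z' x - Z x\<bar>) \<le> \<epsilon> * (1/2)^k"
        using Z'(2) by (simp add: power_divide)
    qed
  qed
  then obtain Z where Z: "\<And>k. P k (Z k)"
    and fast: "\<And>k. expectation (\<lambda>x. \<bar>Z (Suc k) x - Z k x\<bar>) \<le> \<epsilon> * (1/2)^k" by blast
  have Z_int: "integrable M (Z k)" for k using Z by (simp add: P_def)
  obtain Y where Y: "integrable M Y" "(\<lambda>k. expectation (\<lambda>x. \<bar>Z k x - Y x\<bar>)) \<longlonglongrightarrow> 0"
    using L1_fast_Cauchy_limit[OF Z_int fast] by metis
  show ?thesis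
  proof
    show "integrable M Y" by fact
    fix U R assume U: "U \<in> Linf_ball M R"
    have lim: "(\<lambda>k. expectation (\<lambda>x. Z k x * U x)) \<longlonglongrightarrow> expectation (\<lambda>x. Y x * U x)"
    proof (rule Lim_null[THEN iffD2], rule Lim_null_comparison)
      show "(\<lambda>k. R * expectation (\<lambda>x. \<bar>Z k x - Y x\<bar>)) \<longlonglongrightarrow> 0"
        using tendsto_mult[OF tendsto_const Y(2), of R] by simp
      show "\<forall>\<^sub>F k in sequentially. norm (expectation (\<lambda>x. Z k x * U x) - expectation (\<lambda>x. Y x * U x))
          \<le> R * expectation (\<lambda>x. \<bar>Z k x - Y x\<bar>)"
      proof (rule always_eventually, rule allI)
        fix k
        have "expectation (\<lambda>x. Z k x * U x) - expectation (\<lambda>x. Y x * U x)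
            = expectation (\<lambda>x. (Z k x - Y x) * U x)"
          using integrable_mult_Linf_ball[OF Z_int U] integrable_mult_Linf_ball[OF Y(1) U]
          by (simp add: left_diff_distrib)
        then show "norm (expectation (\<lambda>x. Z k x * U x) - expectation (\<lambda>x. Y x * U x))
            \<le> R * expectation (\<lambda>x. \<bar>Z k x - Y x\<bar>)"
          using integral_mult_Linf_ball_le[of M "\<lambda>x. Z k x - Y x" U R] Z_int Y(1) U by simp
      qed
    qed
    \<comment> \<open>A fixed \<open>U\<close> belongs to \<open>Linf_ball M (2^k)\<close> for all
      large \<open>k\<close>, so bounds that hold only on balls survive in the limit for every
      radius.\<close>
    obtain K :: nat where K: "R \<le> 2^K"
      using real_arch_pow[of 2 R] by (auto intro: less_imp_le)
    show "- \<epsilon> \<le> g U + expectation (\<lambda>x. Y x * U x)"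
    proof (rule LIMSEQ_le_const)
      show "(\<lambda>k. g U + expectation (\<lambda>x. Z k x * U x)) \<longlonglongrightarrow> g U + expectation (\<lambda>x. Y x * U x)"
        by (intro tendsto_intros lim)
      have "- \<epsilon> \<le> g U + expectation (\<lambda>x. Z k x * U x)" if "k \<ge> K" for k
      proof -
        have "(2::real)^K \<le> 2^k" using that by (intro power_increasing) auto
        then have "U \<in> Linf_ball M (2^k)" using Linf_ball_mono[OF order_trans[OF K], of "2^k" M] U by blast
        then show ?thesis using Z[of k] e_le[of k] unfolding P_def by fastforce
      qed
      then show "\<exists>N. \<forall>k\<ge>N. - \<epsilon> \<le> g U + expectation (\<lambda>x. Z k x * U x)" by blast
    qed
  qed
qed

section \<open>Essential suprema and extended conditional expectations\<close>

lemma is_ess_sup_ess_sup_family: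
  "is_ess_sup N S f \<Longrightarrow> is_ess_sup N S (ess_sup_family N S)"
  unfolding ess_sup_family_def by (rule someI[of "is_ess_sup N S"])

lemma is_ess_sup_AE_unique:
  assumes "is_ess_sup N S f" "is_ess_sup N S g"
  shows "AE x in N. f x = g x"
proof -
  have "AE x in N. f x \<le> g x" "AE x in N. g x \<le> f x"
    using assms unfolding is_ess_sup_def by blast+
  then show ?thesis by eventually_elim simp
qed

text \<open>Composing with \<open>arctan\<close> makes all integrals finite and preserves strict
  order, so an increasing sequence can be chosen whose integrals approach the supremum over the
  family. A member exceeding its limit on a set of positive measure could be joined with a late term
  and would push the integral above that supremum.\<close>

lemma (in finite_measure) is_ess_sup_directed:
  assumes meas: "\<And>f. f \<in> S \<Longrightarrow> f \<in> borel_measurable M" and ne: "S \<noteq> {}"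
    and dir: "\<And>f g. f \<in> S \<Longrightarrow> g \<in> S \<Longrightarrow> \<exists>h\<in>S. AE x in M. f x \<le> h x \<and> g x \<le> (h x :: real)"
  obtains s where "\<And>n. s n \<in> S" "AE x in M. incseq (\<lambda>n. s n x)"
    "is_ess_sup M ((\<lambda>f x. ereal (f x)) ` S) (\<lambda>x. SUP n. ereal (s n x))"
proof -
  define I where "I f = (\<integral>x. arctan (f x) \<partial>M)" for f
  have arc_le: "\<bar>arctan y\<bar> \<le> 2" for y
    using arctan_lbound[of y] arctan_ubound[of y] pi_half_less_two by (simp add: abs_if)
  have arc_meas: "(\<lambda>x. arctan (f x)) \<in> borel_measurable M" if "f \<in> S" for f
    using borel_measurable_continuous_on[OF continuous_on_arctan[OF continuous_on_id] meas[OF that]] by simp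
  have int: "integrable M (\<lambda>x. arctan (f x))" if "f \<in> S" for f
    using arc_meas[OF that] arc_le by (intro integrable_const_bound[where B=2]) auto
  have bdd: "bdd_above (I ` S)"
  proof (rule bdd_aboveI2)
    fix f assume "f \<in> S"
    then show "I f \<le> (\<integral>x. 2 \<partial>M)"
      unfolding I_def using int arc_le by (intro integral_mono) (auto simp: abs_le_iff)
  qed
  define a where "a = Sup (I ` S)"
  have Ia: "I f \<le> a" if "f \<in> S" for f unfolding a_def using that bdd by (intro cSup_upper) auto
  have "\<exists>t\<in>S. a - 1 / Suc n < I t" for n
  proof -
    have "a - 1 / Suc n < Sup (I ` S)" by (simp add: a_def)
    from less_cSupD[OF _ this] ne show ?thesis by auto
  qed
  then obtain t where t: "\<And>n. t n \<in> S" "\<And>n. a - 1 / Suc n < I (t n)" by metis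
  have "\<exists>s. \<forall>n. (s n \<in> S \<and> (AE x in M. t n x \<le> s n x)) \<and> (AE x in M. s n x \<le> s (Suc n) x)"
  proof (rule dependent_nat_choice)
    show "\<exists>f. f \<in> S \<and> (AE x in M. t 0 x \<le> f x)" using t(1)[of 0] by (intro exI[of _ "t 0"]) auto
    fix f n assume "f \<in> S \<and> (AE x in M. t n x \<le> f x)"
    then obtain h where "h \<in> S" "AE x in M. f x \<le> h x \<and> t (Suc n) x \<le> h x"
      using dir t(1) by blast
    then show "\<exists>g. (g \<in> S \<and> (AE x in M. t (Suc n) x \<le> g x)) \<and> (AE x in M. f x \<le> g x)"
      by (intro exI[of _ h]) auto
  qed
  then obtain s where s: "\<And>n. s n \<in> S" and ts: "\<And>n. AE x in M. t n x \<le> s n x"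
    and inc: "\<And>n. AE x in M. s n x \<le> s (Suc n) x" by blast
  have incs: "AE x in M. incseq (\<lambda>n. s n x)"
    using inc by (simp add: incseq_Suc_iff AE_all_countable)
  have Is: "a - 1 / Suc n < I (s n)" for n
  proof -
    have "I (t n) \<le> I (s n)"
      unfolding I_def using int t(1) s ts[of n] by (intro integral_mono_AE) (auto intro: arctan_monotone' elim: eventually_mono)
    then show ?thesis using t(2)[of n] by linarith
  qed
  define f where "f x = (SUP n. ereal (s n x))" for x
  have [measurable]: "s n \<in> borel_measurable M" for n using meas s by blast
  have f_meas [measurable]: "f \<in> borel_measurable M" unfolding f_def by measurable
  have dom: "AE x in M. ereal (g x) \<le> f x" if g: "g \<in> S" for g
  proof -
    have [measurable]: "g \<in> borel_measurable M" using meas g by blast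
    \<comment> \<open>\<open>real_of_ereal\<close> loses nothing here: where
      \<open>f x < ereal (g x)\<close>, the value \<open>f x\<close> is finite, being at least
      \<open>s 0 x\<close> and below \<open>g x\<close>.\<close>
    define w where "w x = (if f x < ereal (g x) then arctan (g x) - arctan (real_of_ereal (f x)) else 0)" for x
    have f_real: "\<exists>r. f x = ereal r \<and> s n x \<le> r \<and> r < g x" if "f x < ereal (g x)" for x n
    proof -
      have "ereal (s n x) \<le> f x" unfolding f_def by (rule SUP_upper) simp
      with that show ?thesis by (cases "f x") auto
    qed
    have w0: "0 \<le> w x" for x
      using f_real[of x 0] by (auto simp: w_def arctan_le_iff)
    have [measurable]: "(\<lambda>y. arctan y) \<in> borel_measurable borel"
      by (intro borel_measurable_continuous_onI continuous_intros)
    have w_meas [measurable]: "w \<in> borel_measurable M" unfolding w_def by measurable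
    have w_le: "\<bar>w x\<bar> \<le> 4" for x
      using arc_le[of "g x"] arc_le[of "real_of_ereal (f x)"] by (auto simp: w_def)
    have w_int: "integrable M w"
      using w_le by (intro integrable_const_bound[where B=4]) auto
    have "(\<integral>x. w x \<partial>M) \<le> 1 / Suc n" for n
    proof -
      obtain h where h: "h \<in> S" "AE x in M. s n x \<le> h x \<and> g x \<le> h x" using dir s g by blast
      have "AE x in M. w x \<le> arctan (h x) - arctan (s n x)"
        using h(2)
      proof eventually_elim
        case (elim x)
        show ?case
        proof (cases "f x < ereal (g x)")
          case True
          then obtain r where "f x = ereal r" "s n x \<le> r" "r < g x" using f_real by blast
          then show ?thesis using True elim
            by (auto simp: w_def arctan_le_iff intro!: diff_mono)
        next
          case False
          then show ?thesis using elim by (auto simp: w_def arctan_le_iff)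
        qed
      qed
      then have "(\<integral>x. w x \<partial>M) \<le> (\<integral>x. arctan (h x) - arctan (s n x) \<partial>M)"
        using w_int int h(1) s by (intro integral_mono_AE) auto
      also have "\<dots> = I h - I (s n)" unfolding I_def using int h(1) s by simp
      finally show ?thesis using Ia[OF h(1)] Is[of n] by linarith
    qed
    then have "(\<integral>x. w x \<partial>M) \<le> 0"
      by (intro LIMSEQ_le_const[OF LIMSEQ_inverse_real_of_nat]) (auto simp: inverse_eq_divide)
    moreover have "0 \<le> (\<integral>x. w x \<partial>M)" using w0 by (intro integral_nonneg_AE) auto
    ultimately have "(\<integral>x. w x \<partial>M) = 0" by simp
    then have "AE x in M. w x = 0" using integral_nonneg_eq_0_iff_AE[OF w_int] w0 by auto
    then show ?thesis
    proof eventually_elim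
      case (elim x)
      show ?case
      proof (rule ccontr)
        assume "\<not> ?thesis"
        then have "f x < ereal (g x)" by simp
        moreover from f_real[OF this, of 0] obtain r where "f x = ereal r" "r < g x" by blast
        ultimately show False using elim arctan_monotone[of r "g x"] by (simp add: w_def)
      qed
    qed
  qed
  have "is_ess_sup M ((\<lambda>f x. ereal (f x)) ` S) f"
    unfolding is_ess_sup_def
  proof (intro conjI ballI impI)
    fix h :: "'a \<Rightarrow> ereal" assume "\<forall>g\<in>(\<lambda>f x. ereal (f x)) ` S. AE x in M. g x \<le> h x"
    then have "AE x in M. \<forall>n. ereal (s n x) \<le> h x" using s by (auto simp: AE_all_countable)
    then show "AE x in M. f x \<le> h x" unfolding f_def by eventually_elim (simp add: SUP_le_iff)
  qed (use f_meas dom in auto)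
  then show ?thesis using that s incs unfolding f_def by blast
qed

section \<open>Monotone limits of extended conditional expectations\<close>

text \<open>\<open>ennreal\<close> and \<open>e2ennreal\<close> both send negative values to
  \<open>0\<close>, so the two sides are limits of one and the same sequence, whatever the
  signs.\<close>

lemma SUP_e2ennreal_shift:
  fixes u :: "nat \<Rightarrow> real"
  assumes "incseq u"
  shows "e2ennreal ((SUP n. ereal (u n)) + ereal C) = (SUP n. ennreal (u n + C))"
proof -
  have "(\<lambda>n. ereal (u n) + ereal C) \<longlonglongrightarrow> (SUP n. ereal (u n) + ereal C)"
    by (rule LIMSEQ_SUP) (use assms in \<open>auto simp: incseq_def\<close>)
  also have "(SUP n. ereal (u n) + ereal C) = (SUP n. ereal (u n)) + ereal C"
    by (rule SUP_ereal_add_left) auto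
  finally have "(\<lambda>n. e2ennreal (ereal (u n) + ereal C)) \<longlonglongrightarrow> e2ennreal ((SUP n. ereal (u n)) + ereal C)"
    by (rule tendsto_e2ennrealI)
  moreover have "(\<lambda>n. ennreal (u n + C)) \<longlonglongrightarrow> (SUP n. ennreal (u n + C))"
    by (rule LIMSEQ_SUP) (use assms in \<open>auto simp: incseq_def intro: ennreal_leI\<close>)
  ultimately show ?thesis by (auto intro: LIMSEQ_unique simp: ennreal.abs_eq)
qed

text \<open>The supremum of the conditional expectations has the right integral over every set of
  \<open>F\<close>, by monotone convergence applied once to the \<open>f n\<close> and once to their
  conditional expectations; this characterises it.\<close>

lemma (in sigma_finite_subalgebra) nn_cond_exp_monotone_convergence:
  assumes [measurable]: "\<And>n. f n \<in> borel_measurable M" and inc: "AE x in M. incseq (\<lambda>n. f n x)"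
  shows "AE x in M. nn_cond_exp M F (\<lambda>x. SUP n. f n x) x = (SUP n. nn_cond_exp M F (f n) x)"
proof -
  have inc': "AE x in M. f n x \<le> f (Suc n) x" for n
    using inc by eventually_elim (auto simp: incseq_def)
  then have inc_ce: "AE x in M. nn_cond_exp M F (f n) x \<le> nn_cond_exp M F (f (Suc n)) x" for n
    by (intro nn_cond_exp_mono) auto
  have "AE x in M. (SUP n. nn_cond_exp M F (f n) x) = nn_cond_exp M F (\<lambda>x. SUP n. f n x) x"
  proof (rule nn_cond_exp_charact)
    fix A assume A: "A \<in> sets F"
    then have [measurable]: "A \<in> sets M" using subalg by (auto simp: subalgebra_def)
    have "(\<integral>\<^sup>+x\<in>A. (SUP n. f n x) \<partial>M) = (\<integral>\<^sup>+x. (SUP n. f n x * indicator A x) \<partial>M)"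
      by (simp add: SUP_mult_right_ennreal)
    also have "\<dots> = (SUP n. \<integral>\<^sup>+x. f n x * indicator A x \<partial>M)"
    proof (rule nn_integral_monotone_convergence_SUP_AE)
      show "AE x in M. f n x * indicator A x \<le> f (Suc n) x * indicator A x" for n
        using inc'[of n] by eventually_elim (auto simp: indicator_def)
    qed measurable
    also have "\<dots> = (SUP n. \<integral>\<^sup>+x. nn_cond_exp M F (f n) x * indicator A x \<partial>M)"
    proof (rule SUP_cong[OF refl])
      fix n
      show "(\<integral>\<^sup>+x. f n x * indicator A x \<partial>M) = (\<integral>\<^sup>+x. nn_cond_exp M F (f n) x * indicator A x \<partial>M)"
        using nn_cond_exp_intg[of "indicator A" "f n"] A by (simp add: mult.commute)
    qed
    also have "\<dots> = (\<integral>\<^sup>+x. (SUP n. nn_cond_exp M F (f n) x * indicator A x) \<partial>M)"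
    proof (rule nn_integral_monotone_convergence_SUP_AE[symmetric])
      show "AE x in M. nn_cond_exp M F (f n) x * indicator A x \<le> nn_cond_exp M F (f (Suc n)) x * indicator A x" for n
        using inc_ce[of n] by eventually_elim (auto simp: indicator_def)
    qed measurable
    also have "\<dots> = (\<integral>\<^sup>+x\<in>A. (SUP n. nn_cond_exp M F (f n) x) \<partial>M)"
      by (simp add: SUP_mult_right_ennreal)
    finally show "(\<integral>\<^sup>+x\<in>A. (SUP n. f n x) \<partial>M) = (\<integral>\<^sup>+x\<in>A. (SUP n. nn_cond_exp M F (f n) x) \<partial>M)" .
  qed measurable
  then show ?thesis by eventually_elim simp
qed

text \<open>
  The shift turns the difference of two \<open>[0, \<infinity>]\<close>-valued conditional expectations into a single one,
  to which monotone convergence applies.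
\<close>

lemma (in sigma_finite_subalgebra) ereal_cond_exp_shift:
  assumes [measurable]: "f \<in> borel_measurable M" and lower: "AE x in M. - ereal C \<le> f x" and "0 \<le> C"
  shows "AE x in M. ereal_cond_exp M F f x
    = enn2ereal (nn_cond_exp M F (\<lambda>x. e2ennreal (f x + ereal C)) x) - ereal C"
proof -
  let ?n = "nn_cond_exp M F"
  define p m q where "p x = e2ennreal (f x)" and "m x = e2ennreal (- f x)"
    and "q x = e2ennreal (f x + ereal C)" for x
  have [measurable]: "p \<in> borel_measurable M" "m \<in> borel_measurable M" "q \<in> borel_measurable M"
    unfolding p_def m_def q_def by measurable
  \<comment> \<open>This is \<open>(f + C)^+ + f^- = f^+ + C\<close>. It involves sums only, so it
    makes sense in \<open>[0, \<infinity>]\<close> and can be conditioned termwise; since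
    \<open>f^-\<close> is at most \<open>C\<close>, its conditional expectation can be subtracted
    afterwards.\<close>
  have eq: "AE x in M. q x + m x = p x + ennreal C"
    using lower
  proof eventually_elim
    case (elim x)
    then show ?case
    proof (cases "f x")
      case (real r)
      then show ?thesis using elim \<open>0 \<le> C\<close>
        by (cases "0 \<le> r") (auto simp: p_def m_def q_def ennreal.abs_eq[symmetric] ennreal_neg
            simp flip: ennreal_plus)
    qed (auto simp: p_def m_def q_def)
  qed
  have "AE x in M. m x \<le> ennreal C"
    using lower
  proof eventually_elim
    case (elim x)
    then have "- f x \<le> ereal C" by (cases "f x") auto
    then show ?case unfolding m_def by (metis e2ennreal_mono e2ennreal_ereal)
  qed
  then have m_le: "AE x in M. ?n m x \<le> ?n (\<lambda>_. ennreal C) x" by (intro nn_cond_exp_mono) auto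
  have cC: "AE x in M. ennreal C = ?n (\<lambda>_. ennreal C) x" by (rule nn_cond_exp_F_meas) simp
  have "AE x in M. ?n (\<lambda>x. q x + m x) x = ?n (\<lambda>x. p x + ennreal C) x"
    by (rule nn_cond_exp_cong[OF eq]) measurable
  moreover have "AE x in M. ?n q x + ?n m x = ?n (\<lambda>x. q x + m x) x" by (rule nn_cond_exp_sum) measurable
  moreover have "AE x in M. ?n p x + ?n (\<lambda>_. ennreal C) x = ?n (\<lambda>x. p x + ennreal C) x"
    by (rule nn_cond_exp_sum) measurable
  ultimately have "AE x in M. enn2ereal (?n p x) - enn2ereal (?n m x) = enn2ereal (?n q x) - ereal C"
    using m_le cC
  proof eventually_elim
    case (elim x)
    then have e: "?n q x + ?n m x = ?n p x + ennreal C" and mC: "?n m x \<le> ennreal C" by auto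
    obtain d where d: "?n m x = ennreal d" "0 \<le> d" using mC by (cases "?n m x") (auto simp: top_unique)
    show ?case
    proof (cases "?n p x")
      case (real a)
      then obtain b where b: "?n q x = ennreal b" "0 \<le> b"
        using e d \<open>0 \<le> C\<close> by (cases "?n q x") (auto simp flip: ennreal_plus)
      then have "b + d = a + C" using e d real \<open>0 \<le> C\<close> by (simp flip: ennreal_plus)
      then show ?thesis using real b d by (simp add: enn2ereal_ennreal)
    next
      case top
      then have "?n q x = top" using e d by (cases "?n q x") (auto simp flip: ennreal_plus)
      then show ?thesis using top d by (simp add: enn2ereal_ennreal)
    qed
  qed
  then show ?thesis unfolding ereal_cond_exp_def p_def m_def q_def .
qed

lemma (in sigma_finite_subalgebra) ereal_cond_exp_ereal:
  assumes "integrable M u"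
  shows "AE x in M. ereal_cond_exp M F (\<lambda>x. ereal (u x)) x = ereal (real_cond_exp M F u x)"
proof -
  have fin: "AE x in M. nn_cond_exp M F (\<lambda>x. ennreal (v x)) x \<noteq> \<infinity>" if "integrable M v" for v :: "'a \<Rightarrow> real"
  proof (rule nn_integral_PInf_AE)
    have "(\<integral>\<^sup>+x. 1 * nn_cond_exp M F (\<lambda>x. ennreal (v x)) x \<partial>M) = (\<integral>\<^sup>+x. 1 * ennreal (v x) \<partial>M)"
      by (rule nn_cond_exp_intg) (use that in auto)
    also have "\<dots> \<le> (\<integral>\<^sup>+x. ennreal (norm (v x)) \<partial>M)" by (auto intro!: nn_integral_mono ennreal_leI)
    also have "\<dots> < \<infinity>" using that by (simp add: integrable_iff_bounded)
    finally show "(\<integral>\<^sup>+x. nn_cond_exp M F (\<lambda>x. ennreal (v x)) x \<partial>M) \<noteq> \<infinity>" by simp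
  qed simp
  have "AE x in M. nn_cond_exp M F (\<lambda>x. ennreal (- u x)) x \<noteq> \<infinity>" using fin[of "\<lambda>x. - u x"] assms by simp
  with fin[OF assms] show ?thesis
  proof eventually_elim
    case (elim x)
    then show ?case
      unfolding ereal_cond_exp_def real_cond_exp_def
      by (cases "nn_cond_exp M F (\<lambda>x. ennreal (u x)) x"; cases "nn_cond_exp M F (\<lambda>x. ennreal (- u x)) x")
        (auto simp: enn2ereal_ennreal)
  qed
qed

lemma (in sigma_finite_subalgebra) ereal_cond_exp_mono:
  assumes [measurable]: "f \<in> borel_measurable M" "g \<in> borel_measurable M"
    and "AE x in M. f x \<le> g x" "AE x in M. - ereal C \<le> f x"
  shows "AE x in M. ereal_cond_exp M F f x \<le> ereal_cond_exp M F g x"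
proof -
  have "AE x in M. e2ennreal (f x) \<le> e2ennreal (g x)"
    using assms(3) by eventually_elim (rule e2ennreal_mono)
  then have 1: "AE x in M. nn_cond_exp M F (\<lambda>x. e2ennreal (f x)) x \<le> nn_cond_exp M F (\<lambda>x. e2ennreal (g x)) x"
    by (intro nn_cond_exp_mono) measurable
  have "AE x in M. e2ennreal (- g x) \<le> e2ennreal (- f x)"
    using assms(3) by eventually_elim (rule e2ennreal_mono, simp)
  then have 2: "AE x in M. nn_cond_exp M F (\<lambda>x. e2ennreal (- g x)) x \<le> nn_cond_exp M F (\<lambda>x. e2ennreal (- f x)) x"
    by (intro nn_cond_exp_mono) measurable
  show ?thesis
    using 1 2 unfolding ereal_cond_exp_def
    by eventually_elim (intro ereal_minus_mono, auto simp: less_eq_ennreal.rep_eq)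
qed

text \<open>After adding \<open>C\<close> all terms are nonnegative, so monotone convergence carries
  bounds on the real conditional expectations over to a limit that may be infinite.\<close>

lemma (in sigma_finite_subalgebra) ereal_cond_exp_SUP_le:
  assumes u: "\<And>n. integrable M (u n)" and inc: "AE x in M. incseq (\<lambda>n. u n x)"
    and lower: "AE x in M. - C \<le> u 0 x" and "0 \<le> C"
    and [measurable]: "f \<in> borel_measurable M" and f: "AE x in M. f x = (SUP n. ereal (u n x))"
    and B: "\<And>n. AE x in M. ereal (real_cond_exp M F (u n) x) \<le> B x"
  shows "AE x in M. ereal_cond_exp M F f x \<le> B x"
proof -
  have [measurable]: "u n \<in> borel_measurable M" for n using u by auto
  have lower_n: "AE x in M. - ereal C \<le> ereal (u n x)" for n
    using lower inc by eventually_elim (auto simp: incseq_def intro: order_trans[of _ "u 0 _"])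
  have lower_f: "AE x in M. - ereal C \<le> f x"
    using f lower by eventually_elim (auto intro: order_trans[OF _ SUP_upper[of 0]])
  have "AE x in M. e2ennreal (f x + ereal C) = (SUP n. ennreal (u n x + C))"
    using f inc by eventually_elim (simp add: SUP_e2ennreal_shift)
  then have 1: "AE x in M. nn_cond_exp M F (\<lambda>x. e2ennreal (f x + ereal C)) x
      = nn_cond_exp M F (\<lambda>x. SUP n. ennreal (u n x + C)) x"
    by (rule nn_cond_exp_cong) measurable
  have 2: "AE x in M. nn_cond_exp M F (\<lambda>x. SUP n. ennreal (u n x + C)) x
      = (SUP n. nn_cond_exp M F (\<lambda>x. ennreal (u n x + C)) x)"
    by (rule nn_cond_exp_monotone_convergence, measurable)
      (use inc in \<open>eventually_elim, auto simp: incseq_def intro!: ennreal_leI\<close>)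
  have "AE x in M. \<forall>n. enn2ereal (nn_cond_exp M F (\<lambda>x. ennreal (u n x + C)) x) \<le> B x + ereal C"
    unfolding AE_all_countable
  proof
    fix n
    show "AE x in M. enn2ereal (nn_cond_exp M F (\<lambda>x. ennreal (u n x + C)) x) \<le> B x + ereal C"
      using ereal_cond_exp_shift[OF borel_measurable_ereal[OF \<open>u n \<in> borel_measurable M\<close>] lower_n[of n] \<open>0 \<le> C\<close>] ereal_cond_exp_ereal[OF u[of n]]
        B[of n]
    proof eventually_elim
      case (elim x)
      then have "enn2ereal (nn_cond_exp M F (\<lambda>x. ennreal (u n x + C)) x) - ereal C \<le> B x" by simp
      then show ?case by (simp add: ereal_minus_le)
    qed
  qed
  with 1 2 ereal_cond_exp_shift[OF \<open>f \<in> borel_measurable M\<close> lower_f \<open>0 \<le> C\<close>]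
  show ?thesis
  proof eventually_elim
    case (elim x)
    let ?a = "\<lambda>n. nn_cond_exp M F (\<lambda>x. ennreal (u n x + C)) x"
    have "0 \<le> enn2ereal (?a 0)" by simp
    then have pos: "0 \<le> B x + ereal C" using elim(4) order_trans by blast
    have "?a n \<le> e2ennreal (B x + ereal C)" for n
      using elim(4) e2ennreal_mono[of "enn2ereal (?a n)"] by fastforce
    then have "(SUP n. ?a n) \<le> e2ennreal (B x + ereal C)" by (rule SUP_least)
    then have "enn2ereal (SUP n. ?a n) \<le> B x + ereal C"
      using pos by (simp add: less_eq_ennreal.rep_eq enn2ereal_e2ennreal)
    then show ?case using elim by (simp add: ereal_minus_le)
  qed
qed

text \<open>Used with an increasing sequence from the family that defines the penalty: a uniform
  bound on its expectations makes the expected penalty finite.\<close>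

lemma nn_integral_SUP_shift_le:
  fixes u :: "nat \<Rightarrow> 'a \<Rightarrow> real"
  assumes "prob_space M"
    and u: "\<And>n. integrable M (u n)" and inc: "AE x in M. incseq (\<lambda>n. u n x)"
    and lower: "AE x in M. - C \<le> u 0 x"
    and f: "AE x in M. f x = (SUP n. ereal (u n x))"
    and K: "\<And>n. (\<integral>x. u n x \<partial>M) \<le> K"
  shows "(\<integral>\<^sup>+x. e2ennreal (f x + ereal C) \<partial>M) \<le> ennreal (K + C)"
proof -
  interpret prob_space M by fact
  have [measurable]: "u n \<in> borel_measurable M" for n using u by auto
  have "(\<integral>\<^sup>+x. e2ennreal (f x + ereal C) \<partial>M) = (\<integral>\<^sup>+x. (SUP n. ennreal (u n x + C)) \<partial>M)"
    by (rule nn_integral_cong_AE) (use f inc in \<open>eventually_elim, simp add: SUP_e2ennreal_shift\<close>)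
  also have "\<dots> = (SUP n. \<integral>\<^sup>+x. ennreal (u n x + C) \<partial>M)"
  proof (rule nn_integral_monotone_convergence_SUP_AE)
    show "AE x in M. ennreal (u n x + C) \<le> ennreal (u (Suc n) x + C)" for n
      using inc by eventually_elim (auto simp: incseq_def intro: ennreal_leI)
  qed measurable
  also have "\<dots> \<le> ennreal (K + C)"
  proof (rule SUP_least)
    fix n
    have "AE x in M. 0 \<le> u n x + C"
      using lower inc
    proof eventually_elim
      case (elim x)
      then have "u 0 x \<le> u n x" by (simp add: incseq_def)
      then show ?case using elim by linarith
    qed
    then have "(\<integral>\<^sup>+x. ennreal (u n x + C) \<partial>M) = ennreal (\<integral>x. u n x + C \<partial>M)"
      using u by (intro nn_integral_eq_integral) auto
    also have "(\<integral>x. u n x + C \<partial>M) = (\<integral>x. u n x \<partial>M) + C" using u by (simp add: prob_space)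
    finally show "(\<integral>\<^sup>+x. ennreal (u n x + C) \<partial>M) \<le> ennreal (K + C)"
      using K[of n] by (simp add: ennreal_leI)
  qed
  finally show ?thesis .
qed

lemma ereal_expectation_finite:
  assumes "prob_space M" and [measurable]: "f \<in> borel_measurable M"
    and lower: "AE x in M. - ereal C \<le> f x" and "0 \<le> C"
    and fin: "(\<integral>\<^sup>+x. e2ennreal (f x + ereal C) \<partial>M) < \<infinity>"
  shows "\<bar>ereal_expectation M f\<bar> \<noteq> \<infinity>"
proof -
  interpret prob_space M by fact
  have "(\<integral>\<^sup>+x. e2ennreal (f x) \<partial>M) \<le> (\<integral>\<^sup>+x. e2ennreal (f x + ereal C) \<partial>M)"
    using \<open>0 \<le> C\<close> by (intro nn_integral_mono e2ennreal_mono) (simp add: ereal_le_add_self)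
  then have p: "(\<integral>\<^sup>+x. e2ennreal (f x) \<partial>M) < \<infinity>" using fin by (rule le_less_trans)
  have "AE x in M. e2ennreal (- f x) \<le> ennreal C"
    using lower
  proof eventually_elim
    case (elim x)
    then have "- f x \<le> ereal C" by (cases "f x") auto
    then show ?case by (metis e2ennreal_mono e2ennreal_ereal)
  qed
  then have "(\<integral>\<^sup>+x. e2ennreal (- f x) \<partial>M) \<le> (\<integral>\<^sup>+x. ennreal C \<partial>M)" by (rule nn_integral_mono_AE)
  also have "\<dots> < \<infinity>" by (simp add: emeasure_space_1)
  finally have m: "(\<integral>\<^sup>+x. e2ennreal (- f x) \<partial>M) < \<infinity>" .
  show ?thesis
    using p m unfolding ereal_expectation_def
    by (cases "\<integral>\<^sup>+x. e2ennreal (f x) \<partial>M"; cases "\<integral>\<^sup>+x. e2ennreal (- f x) \<partial>M")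
      (auto simp: enn2ereal_ennreal)
qed

section \<open>Conditional risk measures\<close>

lemma LinfI: "X \<in> borel_measurable G \<Longrightarrow> AE x in M. \<bar>X x\<bar> \<le> C \<Longrightarrow> X \<in> Linf M G"
  by (auto simp: Linf_def)

lemma Linf_measurable: "X \<in> Linf M G \<Longrightarrow> X \<in> borel_measurable G"
  by (simp add: Linf_def)

lemma Linf_bound:
  assumes "X \<in> Linf M G"
  obtains C where "0 \<le> C" "AE x in M. \<bar>X x\<bar> \<le> C"
proof -
  obtain C where C: "AE x in M. \<bar>X x\<bar> \<le> C" using assms by (auto simp: Linf_def)
  then have "AE x in M. \<bar>X x\<bar> \<le> \<bar>C\<bar>" by eventually_elim linarith
  then show ?thesis using that[of "\<bar>C\<bar>"] by simp
qed

lemma Linf_const: "(\<lambda>_. c) \<in> Linf M G"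
  by (rule LinfI[where C="\<bar>c\<bar>"]) auto

lemma Linf_mult_const:
  assumes "X \<in> Linf M G" shows "(\<lambda>x. c * X x) \<in> Linf M G"
proof -
  obtain C where "AE x in M. \<bar>X x\<bar> \<le> C" using Linf_bound[OF assms] .
  then have "AE x in M. \<bar>c * X x\<bar> \<le> \<bar>c\<bar> * C"
    by eventually_elim (simp add: abs_mult mult_left_mono)
  then show ?thesis using Linf_measurable[OF assms] by (auto intro!: LinfI)
qed

lemma Linf_add:
  assumes "X \<in> Linf M G" "Y \<in> Linf M G" shows "(\<lambda>x. X x + Y x) \<in> Linf M G"
proof -
  obtain C where C: "AE x in M. \<bar>X x\<bar> \<le> C" using Linf_bound[OF assms(1)] .
  obtain D where D: "AE x in M. \<bar>Y x\<bar> \<le> D" using Linf_bound[OF assms(2)] .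
  have "AE x in M. \<bar>X x + Y x\<bar> \<le> C + D" using C D by eventually_elim linarith
  then show ?thesis using assms[THEN Linf_measurable] by (auto intro!: LinfI)
qed

lemma Linf_uminus: "X \<in> Linf M G \<Longrightarrow> (\<lambda>x. - X x) \<in> Linf M G"
  using Linf_mult_const[of X M G "-1"] by simp

lemma Linf_diff: "X \<in> Linf M G \<Longrightarrow> Y \<in> Linf M G \<Longrightarrow> (\<lambda>x. X x - Y x) \<in> Linf M G"
  using Linf_add[OF _ Linf_uminus] by simp

lemma Linf_if:
  assumes "X \<in> Linf M G" "Y \<in> Linf M G" "A \<in> sets G"
  shows "(\<lambda>x. if x \<in> A then X x else Y x) \<in> Linf M G"
proof -
  obtain C where C: "0 \<le> C" "AE x in M. \<bar>X x\<bar> \<le> C" using Linf_bound[OF assms(1)] .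
  obtain D where D: "0 \<le> D" "AE x in M. \<bar>Y x\<bar> \<le> D" using Linf_bound[OF assms(2)] .
  have "AE x in M. \<bar>if x \<in> A then X x else Y x\<bar> \<le> C + D"
    using C(2) D(2) by eventually_elim (use C(1) D(1) in auto)
  then show ?thesis using assms(1,2)[THEN Linf_measurable] assms(3) by (auto intro!: LinfI measurable_If_set)
qed

lemma Linf_mono: "subalgebra G H \<Longrightarrow> X \<in> Linf M H \<Longrightarrow> X \<in> Linf M G"
  unfolding Linf_def using measurable_from_subalg by blast

lemma (in finite_measure) integrable_Linf: "subalgebra M G \<Longrightarrow> X \<in> Linf M G \<Longrightarrow> integrable M X"
  by (rule Linf_bound, assumption)
    (auto intro!: integrable_const_bound intro: measurable_from_subalg Linf_measurable)

text \<open>Tail suprema replace a bounded convergent sequence by a decreasing one with the same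
  limit, the form that continuity from above accepts.\<close>

lemma tendsto_SUP_tail:
  fixes u :: "nat \<Rightarrow> real"
  assumes u: "u \<longlonglongrightarrow> l" and bdd: "bdd_above (range u)"
  shows "(\<lambda>k. SUP j. u (j + k)) \<longlonglongrightarrow> l"
proof (rule LIMSEQ_I)
  fix e :: real assume "0 < e"
  then obtain N where N: "\<And>n. n \<ge> N \<Longrightarrow> norm (u n - l) < e / 2" using LIMSEQ_D[OF u, of "e/2"] by auto
  have "norm ((SUP j. u (j + k)) - l) < e" if "k \<ge> N" for k
  proof -
    have "bdd_above (range (\<lambda>j. u (j + k)))" using bdd by (rule bdd_above_mono) auto
    then have "u (0 + k) \<le> (SUP j. u (j + k))" by (rule cSUP_upper2[of _ _ 0]) auto
    moreover have "(SUP j. u (j + k)) \<le> l + e / 2"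
    proof (rule cSUP_least)
      show "u (j + k) \<le> l + e / 2" for j using N[of "j + k"] that by (simp add: abs_if split: if_splits)
    qed simp
    moreover have "l - e / 2 < u k" using N[OF that] by (simp add: abs_if split: if_splits)
    ultimately show ?thesis using \<open>0 < e\<close> by (simp add: abs_if)
  qed
  then show "\<exists>N. \<forall>k\<ge>N. norm ((SUP j. u (j + k)) - l) < e" by blast
qed

text \<open>A single map of the family, with \<open>G\<close> and \<open>H\<close> for the stopped
  sigma-algebras at \<tau> and \<sigma>, so that filtrations drop out of the argument. That
  \<open>G\<close> contains the null sets of \<open>M\<close> lets almost sure statements pass to
  measures defined on \<open>G\<close> only.\<close>

locale cond_risk_measure = prob_space M for M :: "'a measure" +
  fixes G H :: "'a measure" and r :: "('a \<Rightarrow> real) \<Rightarrow> 'a \<Rightarrow> real"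
  assumes sub_G: "subalgebra M G" and sub_H: "subalgebra G H"
    and null_sets_sub: "null_sets M \<subseteq> sets G"
    and r_Linf: "\<And>X. X \<in> Linf M G \<Longrightarrow> r X \<in> Linf M H"
    and r_mono: "\<And>X Y. X \<in> Linf M G \<Longrightarrow> Y \<in> Linf M G \<Longrightarrow> AE x in M. X x \<le> Y x
      \<Longrightarrow> AE x in M. r Y x \<le> r X x"
    and r_trans: "\<And>X Z. X \<in> Linf M G \<Longrightarrow> Z \<in> Linf M H
      \<Longrightarrow> AE x in M. r (\<lambda>y. X y + Z y) x = r X x - Z x"
    and r_convex: "\<And>X Y c. X \<in> Linf M G \<Longrightarrow> Y \<in> Linf M G \<Longrightarrow> 0 \<le> c \<Longrightarrow> c \<le> 1
      \<Longrightarrow> AE x in M. r (\<lambda>y. c * X y + (1 - c) * Y y) x \<le> c * r X x + (1 - c) * r Y x"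
    and r_cont: "\<And>Xs X. (\<And>n. Xs n \<in> Linf M G) \<Longrightarrow> X \<in> Linf M G \<Longrightarrow> AE x in M. decseq (\<lambda>n. Xs n x)
      \<Longrightarrow> AE x in M. (\<lambda>n. Xs n x) \<longlonglongrightarrow> X x \<Longrightarrow> AE x in M. (\<lambda>n. r (Xs n) x) \<longlonglongrightarrow> r X x"
begin

lemma sub_MH: "subalgebra M H"
  using sub_G sub_H by (auto simp: subalgebra_def)

lemma Linf_HG: "X \<in> Linf M H \<Longrightarrow> X \<in> Linf M G"
  by (rule Linf_mono[OF sub_H])

lemma r_LinfG: "X \<in> Linf M G \<Longrightarrow> r X \<in> Linf M G"
  by (rule Linf_HG[OF r_Linf])

lemma r_integrable: "X \<in> Linf M G \<Longrightarrow> integrable M (r X)"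
  by (intro integrable_Linf[OF sub_MH] r_Linf)

lemma r_cong:
  assumes "X \<in> Linf M G" "Y \<in> Linf M G" "AE x in M. X x = Y x"
  shows "AE x in M. r X x = r Y x"
proof -
  have "AE x in M. X x \<le> Y x" "AE x in M. Y x \<le> X x" using assms(3) by auto
  from r_mono[OF assms(1,2) this(1)] r_mono[OF assms(2,1) this(2)]
  show ?thesis by eventually_elim simp
qed

text \<open>Locality follows from translating \<open>X\<close> by a large constant off \<open>A\<close>.\<close>

lemma r_local_le:
  assumes X: "X \<in> Linf M G" and Y: "Y \<in> Linf M G" and A: "A \<in> sets H"
    and eq: "AE x in M. x \<in> A \<longrightarrow> X x = Y x"
  shows "AE x in M. x \<in> A \<longrightarrow> r X x \<le> r Y x"
proof -
  obtain C where C: "0 \<le> C" "AE x in M. \<bar>X x\<bar> \<le> C" using Linf_bound[OF X] .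
  obtain D where D: "0 \<le> D" "AE x in M. \<bar>Y x\<bar> \<le> D" using Linf_bound[OF Y] .
  define Z where "Z x = (if x \<in> A then 0 else C + D)" for x
  have Z: "Z \<in> Linf M H" unfolding Z_def by (intro Linf_if Linf_const A)
  have "AE x in M. Y x \<le> X x + Z x"
    using eq C(2) D(2) by eventually_elim (use C(1) D(1) in \<open>auto simp: Z_def\<close>)
  from r_mono[OF Y Linf_add[OF X Linf_HG[OF Z]] this] r_trans[OF X Z]
  show ?thesis by eventually_elim (auto simp: Z_def)
qed

lemma r_paste:
  assumes X: "X \<in> Linf M G" and Y: "Y \<in> Linf M G" and A: "A \<in> sets H"
  shows "AE x in M. r (\<lambda>x. if x \<in> A then X x else Y x) x = (if x \<in> A then r X x else r Y x)"
proof -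
  have AG: "A \<in> sets G" using A sub_H by (auto simp: subalgebra_def)
  have cA: "space M - A \<in> sets H" using A sub_MH by (metis sets.compl_sets subalgebra_def)
  let ?P = "\<lambda>x. if x \<in> A then X x else Y x"
  have P: "?P \<in> Linf M G" by (rule Linf_if[OF X Y AG])
  have "AE x in M. x \<in> A \<longrightarrow> r ?P x \<le> r X x" "AE x in M. x \<in> A \<longrightarrow> r X x \<le> r ?P x"
    by (rule r_local_le; (fact P X A | simp))+
  moreover have "AE x in M. x \<in> space M - A \<longrightarrow> r ?P x \<le> r Y x"
    "AE x in M. x \<in> space M - A \<longrightarrow> r Y x \<le> r ?P x"
    by (rule r_local_le; (fact P Y cA | simp))+
  ultimately show ?thesis
    using AE_space by eventually_elim auto
qed

lemma r_normalise:
  assumes X: "X \<in> Linf M G" and Z: "Z \<in> Linf M H"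
  shows "AE x in M. r (\<lambda>x. X x + (r X x - Z x)) x = Z x"
  using r_trans[OF X Linf_diff[OF r_Linf[OF X] Z]] by eventually_elim simp

lemma expectation_r_mono:
  assumes "X \<in> Linf M G" "Y \<in> Linf M G" "AE x in M. X x \<le> Y x"
  shows "expectation (r Y) \<le> expectation (r X)"
  by (intro integral_mono_AE r_integrable assms r_mono)

lemma expectation_r_trans:
  assumes "X \<in> Linf M G" "Z \<in> Linf M H"
  shows "expectation (r (\<lambda>x. X x + Z x)) = expectation (r X) - expectation Z"
proof -
  have XZ: "(\<lambda>x. X x + Z x) \<in> Linf M G" by (intro Linf_add assms Linf_HG)
  have "expectation (r (\<lambda>x. X x + Z x)) = expectation (\<lambda>x. r X x - Z x)"
    by (rule integral_cong_AE)
      (use r_integrable[OF XZ] r_integrable[OF assms(1)] integrable_Linf[OF sub_MH assms(2)]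
        r_trans[OF assms] in auto)
  also have "\<dots> = expectation (r X) - expectation Z"
    using r_integrable[OF assms(1)] integrable_Linf[OF sub_MH assms(2)] by simp
  finally show ?thesis .
qed

text \<open>The Fatou property for expectations: the tail suprema \<open>V k\<close> decrease to
  \<open>U\<close> and dominate \<open>Us k\<close>, so \<open>r (V k) \<le> r (Us k)\<close> almost
  surely, while continuity from above gives \<open>r (V k)\<close> the limit
  \<open>r U\<close>.\<close>

lemma lsc_expectation_r:
  assumes Us: "\<And>k. Us k \<in> Linf M G" "\<And>k. AE x in M. \<bar>Us k x\<bar> \<le> R" and U: "U \<in> Linf M G"
    and lim: "AE x in M. (\<lambda>k. Us k x) \<longlonglongrightarrow> U x"
    and le: "\<And>k. expectation (r (Us k)) \<le> c k" and c: "c \<longlonglongrightarrow> l"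
  shows "expectation (r U) \<le> l"
proof -
  \<comment> \<open>Truncation makes the bound hold everywhere instead of almost everywhere, so the
    suprema in \<open>V\<close> are over bounded sets at every point.\<close>
  define u where "u k x = max (- \<bar>R\<bar>) (min \<bar>R\<bar> (Us k x))" for k x
  define V where "V k x = (SUP j. u (j + k) x)" for k x
  have u_bound: "\<bar>u k x\<bar> \<le> \<bar>R\<bar>" for k x by (auto simp: u_def)
  have bdd: "bdd_above (range (\<lambda>j. u (j + k) x))" for k x
    using u_bound by (intro bdd_aboveI[of _ "\<bar>R\<bar>"]) (auto simp: abs_le_iff)
  have uV: "u (j + k) x \<le> V k x" for j k x unfolding V_def by (rule cSUP_upper[OF _ bdd]) simp
  have V_bound: "\<bar>V k x\<bar> \<le> \<bar>R\<bar>" for k x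
  proof -
    have "V k x \<le> \<bar>R\<bar>" unfolding V_def using u_bound by (intro cSUP_least) (auto simp: abs_le_iff)
    moreover have "- \<bar>R\<bar> \<le> V k x" using uV[of 0 k x] u_bound[of k x] by (simp add: abs_le_iff)
    ultimately show ?thesis by linarith
  qed
  have [measurable]: "u k \<in> borel_measurable G" for k
    using Linf_measurable[OF Us(1), of k] unfolding u_def by measurable
  have "V k \<in> borel_measurable G" for k unfolding V_def
    by (rule borel_measurable_cSUP) (use bdd in auto)
  then have V: "V k \<in> Linf M G" for k using V_bound by (intro LinfI[where C="\<bar>R\<bar>"]) auto
  have "AE x in M. \<forall>k. \<bar>Us k x\<bar> \<le> R" using Us(2) by (simp add: AE_all_countable)
  then have u_eq: "AE x in M. \<forall>k. u k x = Us k x" 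
  proof eventually_elim
    case (elim x)
    show ?case
    proof
      fix k
      have "- \<bar>R\<bar> \<le> Us k x" "Us k x \<le> \<bar>R\<bar>" using elim[rule_format, of k] by linarith+
      then show "u k x = Us k x" by (simp add: u_def)
    qed
  qed
  have Vlim: "AE x in M. (\<lambda>k. V k x) \<longlonglongrightarrow> U x"
    using u_eq lim
  proof eventually_elim
    case (elim x)
    then have "(\<lambda>k. u k x) \<longlonglongrightarrow> U x" by simp
    then show ?case unfolding V_def using bdd[of 0 x] by (intro tendsto_SUP_tail) auto
  qed
  have Vdec: "decseq (\<lambda>k. V k x)" for x
  proof (rule decseq_SucI)
    fix k show "V (Suc k) x \<le> V k x"
      unfolding V_def[of "Suc k"] using uV[of "Suc _" k x] by (intro cSUP_least) auto
  qed
  have rlim: "AE x in M. (\<lambda>k. r (V k) x) \<longlonglongrightarrow> r U x"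
    by (rule r_cont[OF V U _ Vlim]) (use Vdec in simp)
  have "(\<lambda>k. expectation (r (V k))) \<longlonglongrightarrow> expectation (r U)"
  proof (rule integral_dominated_convergence)
    show "integrable M (\<lambda>x. \<bar>r (\<lambda>_. \<bar>R\<bar>) x\<bar> + \<bar>r (\<lambda>_. - \<bar>R\<bar>) x\<bar>)"
      using r_integrable[OF Linf_const] by auto
    show "AE x in M. norm (r (V k) x) \<le> \<bar>r (\<lambda>_. \<bar>R\<bar>) x\<bar> + \<bar>r (\<lambda>_. - \<bar>R\<bar>) x\<bar>" for k
    proof -
      have "AE x in M. r (\<lambda>_. \<bar>R\<bar>) x \<le> r (V k) x" "AE x in M. r (V k) x \<le> r (\<lambda>_. - \<bar>R\<bar>) x"
        using V_bound[of k] by (auto intro!: r_mono V Linf_const simp: abs_le_iff minus_le_iff)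
      then show ?thesis by eventually_elim auto
    qed
  qed (use r_integrable[OF U] r_integrable[OF V] rlim in auto)
  then show ?thesis
  proof (rule LIMSEQ_le[OF _ c])
    have "expectation (r (V k)) \<le> c k" for k
    proof -
      have "AE x in M. Us k x \<le> V k x" using u_eq by eventually_elim (metis uV[of 0 k] add_0)
      then show ?thesis using expectation_r_mono[OF Us(1) V] le[of k] by (meson order_trans)
    qed
    then show "\<exists>N. \<forall>k\<ge>N. expectation (r (V k)) \<le> c k" by blast
  qed
qed

text \<open>A multiplier with a fixed error \<epsilon> is automatically a probability density: its
  inequality holds along whole rays, and letting the scale grow removes \<epsilon>. Nonnegativity
  comes from monotonicity, agreement with \<open>M\<close> on \<open>H\<close> from translation
  invariance. The last conclusion is \<epsilon>-optimality of \<open>Q\<close> at \<open>Y\<close>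
  in Fenchel form.\<close>

lemma ex_near_optimal_measure:
  assumes Y: "Y \<in> Linf M G" and "0 < \<epsilon>"
  obtains Q where "ac_prob_measure M G Q"
    "\<And>X. X \<in> Linf M H \<Longrightarrow> (\<integral>x. X x \<partial>Q) = expectation X"
    "\<And>W. W \<in> Linf M G \<Longrightarrow> (\<integral>x. Y x \<partial>Q) + expectation (r Y) - \<epsilon> \<le> (\<integral>x. W x \<partial>Q) + expectation (r W)"
proof -
  \<comment> \<open>\<open>Q\<close> lives on \<open>G\<close>, so its density must be
    \<open>G\<close>-measurable; working on the restriction of the measure to \<open>G\<close>
    ensures this.\<close>
  define N where "N = restr_to_subalg M G"
  interpret N: prob_space N
    unfolding N_def by (rule prob_space_restr_to_subalg[OF sub_G]) unfold_locales
  have setsN: "sets N = sets G" and spaceN: "space N = space M"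
    unfolding N_def using sub_G by (simp_all add: sets_restr_to_subalg space_restr_to_subalg)
  have measN: "borel_measurable N = (borel_measurable G :: ('a \<Rightarrow> real) set)"
    using setsN by (simp cong: measurable_cong_sets)
  have AE_N: "AE x in M. P x" if "AE x in N. P x" for P
    using AE_restr_to_subalg[OF sub_G, of P] that unfolding N_def .
  have int_N: "(\<integral>x. f x \<partial>N) = expectation f" if "f \<in> borel_measurable G" for f :: "'a \<Rightarrow> real"
    unfolding N_def by (rule integral_subalgebra2[OF sub_G that])
  have ballI: "U \<in> Linf M G" "AE x in M. \<bar>U x\<bar> \<le> R" if "U \<in> Linf_ball N R" for U R
    using Linf_ballD[OF that] AE_N by (auto intro: LinfI simp: measN)
  have to_ball: "\<exists>R. U \<in> Linf_ball N R" if U: "U \<in> Linf M G" for U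
  proof -
    obtain R where "AE x in M. \<bar>U x\<bar> \<le> R" using Linf_bound[OF U] .
    then have "AE x in N. \<bar>U x\<bar> \<le> R"
      unfolding N_def using Linf_measurable[OF U] by (intro AE_restr_to_subalg2[OF sub_G]) auto
    then show ?thesis using Linf_measurable[OF U] by (auto simp: Linf_ball_def measN)
  qed
  define g where "g U = expectation (r (\<lambda>x. Y x + U x)) - expectation (r Y)" for U
  have g: "lsc_convex N g"
    unfolding lsc_convex_def
  proof safe
    fix R t :: real and U V
    assume U: "U \<in> Linf_ball N R" and V: "V \<in> Linf_ball N R" and t: "0 \<le> t" "t \<le> 1"
    let ?A = "\<lambda>x. Y x + U x" and ?B = "\<lambda>x. Y x + V x"
    have AB: "?A \<in> Linf M G" "?B \<in> Linf M G"
      using ballI(1)[OF U] ballI(1)[OF V] Y by (auto intro: Linf_add)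
    have C: "(\<lambda>x. t * ?A x + (1 - t) * ?B x) \<in> Linf M G"
      by (intro Linf_add Linf_mult_const AB)
    have "(\<lambda>x. Y x + (t * U x + (1 - t) * V x)) = (\<lambda>x. t * ?A x + (1 - t) * ?B x)"
      by (auto simp: algebra_simps)
    moreover have "expectation (r (\<lambda>x. t * ?A x + (1 - t) * ?B x))
        \<le> expectation (\<lambda>x. t * r ?A x + (1 - t) * r ?B x)"
      using r_integrable[OF C] r_integrable[OF AB(1)] r_integrable[OF AB(2)] r_convex[OF AB t]
      by (intro integral_mono_AE) auto
    moreover have "\<dots> = t * expectation (r ?A) + (1 - t) * expectation (r ?B)"
      using r_integrable[OF AB(1)] r_integrable[OF AB(2)] by simp
    ultimately show "g (\<lambda>x. t * U x + (1 - t) * V x) \<le> t * g U + (1 - t) * g V"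
      unfolding g_def by (simp add: algebra_simps)
  next
    fix R Us U c l
    assume Us: "\<forall>k. Us k \<in> Linf_ball N R" and U: "U \<in> borel_measurable N"
      and lim: "AE x in N. (\<lambda>k. Us k x) \<longlonglongrightarrow> U x" and le: "\<forall>k. g (Us k) \<le> c k" and c: "c \<longlonglongrightarrow> l"
    have U': "U \<in> Linf M G"
      using Linf_ball_AE_limit[OF _ U lim, of R] Us ballI(1) by blast
    obtain D where D: "0 \<le> D" "AE x in M. \<bar>Y x\<bar> \<le> D" using Linf_bound[OF Y] .
    have "expectation (r (\<lambda>x. Y x + U x)) \<le> l + expectation (r Y)"
    proof (rule lsc_expectation_r[where Us="\<lambda>k x. Y x + Us k x" and R="D + R"])
      show "(\<lambda>x. Y x + Us k x) \<in> Linf M G" for k using Y Us ballI(1) by (blast intro: Linf_add)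
      show "AE x in M. \<bar>Y x + Us k x\<bar> \<le> D + R" for k
        using D(2) ballI(2)[OF Us[rule_format, of k]] by eventually_elim linarith
      show "(\<lambda>x. Y x + U x) \<in> Linf M G" by (rule Linf_add[OF Y U'])
      show "AE x in M. (\<lambda>k. Y x + Us k x) \<longlonglongrightarrow> Y x + U x"
        using AE_N[OF lim] by eventually_elim (intro tendsto_intros)
      show "expectation (r (\<lambda>x. Y x + Us k x)) \<le> c k + expectation (r Y)" for k
        using le[rule_format, of k] by (simp add: g_def)
      show "(\<lambda>k. c k + expectation (r Y)) \<longlonglongrightarrow> l + expectation (r Y)" by (intro tendsto_intros c)
    qed
    then show "g U \<le> l" by (simp add: g_def)
  qed
  have g_H: "g V = - expectation V" if "V \<in> Linf M H" for V
    using expectation_r_trans[OF Y that] by (simp add: g_def)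
  \<comment> \<open>Monotonicity compares \<open>U\<close> with the constant \<open>t\<close>, and
    translation invariance evaluates \<open>g\<close> there.\<close>
  have lower: "- t \<le> g U" if t: "0 \<le> t" and U: "U \<in> Linf_ball N t" for U t
  proof -
    have "AE x in M. Y x + U x \<le> Y x + t" using ballI(2)[OF U] by eventually_elim (simp add: abs_le_iff)
    then have "expectation (r (\<lambda>x. Y x + t)) \<le> expectation (r (\<lambda>x. Y x + U x))"
      using ballI(1)[OF U] Y by (intro expectation_r_mono Linf_add Linf_const) auto
    then show ?thesis using g_H[OF Linf_const, of t] by (simp add: g_def prob_space)
  qed
  obtain Z where Z: "integrable N Z"
    and ZU: "\<And>U R. U \<in> Linf_ball N R \<Longrightarrow> - \<epsilon> \<le> g U + N.expectation (\<lambda>x. Z x * U x)"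
    by (rule N.ex_L1_multiplier[OF g _ \<open>0 < \<epsilon>\<close> lower]) (simp_all add: g_def)
  have Zm [measurable]: "Z \<in> borel_measurable N" using Z by simp
  \<comment> \<open>Turns a bound with the same error \<epsilon> for all multiples of
    \<open>d\<close> into the exact sign of \<open>d\<close>.\<close>
  have nonneg_of_scaling: "0 \<le> d" if "\<And>n :: nat. - \<epsilon> \<le> real n * d" for d :: real
  proof (rule ccontr)
    assume "\<not> 0 \<le> d"
    then obtain n :: nat where "\<epsilon> < real n * (- d)" using ex_less_of_nat_mult[of "- d" \<epsilon>] by auto
    then show False using that[of n] by simp
  qed
  have Z0: "AE x in N. 0 \<le> Z x"
  proof -
    \<comment> \<open>Adding multiples of the indicator of \<open>Z < 0\<close> can only lower the
      risk, so \<open>g\<close> is at most \<open>0\<close> on them and the integral of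
      \<open>Z\<close> over this set cannot be negative.\<close>
    define v where "v x = (if Z x < 0 then 1 else 0 :: real)" for x
    have [measurable]: "v \<in> borel_measurable N" unfolding v_def by measurable
    have v: "v \<in> Linf_ball N 1" by (auto simp: Linf_ball_def v_def)
    have "0 \<le> N.expectation (\<lambda>x. Z x * v x)"
    proof (rule nonneg_of_scaling)
      fix n :: nat
      have b: "(\<lambda>x. real n * v x) \<in> Linf_ball N (real n)" by (auto simp: Linf_ball_def v_def)
      have "AE x in M. Y x \<le> Y x + real n * v x" by (simp add: v_def)
      then have "g (\<lambda>x. real n * v x) \<le> 0"
        using expectation_r_mono[OF Y Linf_add[OF Y ballI(1)[OF b]]] by (simp add: g_def)
      moreover have "N.expectation (\<lambda>x. Z x * (real n * v x)) = real n * N.expectation (\<lambda>x. Z x * v x)"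
        by (simp add: mult.left_commute[of _ "real n"])
      ultimately show "- \<epsilon> \<le> real n * N.expectation (\<lambda>x. Z x * v x)" using ZU[OF b] by simp
    qed
    moreover have "N.expectation (\<lambda>x. - (Z x * v x)) = - N.expectation (\<lambda>x. Z x * v x)" by simp
    moreover have "0 \<le> N.expectation (\<lambda>x. - (Z x * v x))"
      by (intro integral_nonneg_AE) (auto simp: v_def)
    ultimately have "N.expectation (\<lambda>x. - (Z x * v x)) = 0" by linarith
    then have "AE x in N. - (Z x * v x) = 0"
      using integrable_mult_Linf_ball[OF Z v]
      by (subst (asm) integral_nonneg_eq_0_iff_AE) (auto simp: v_def)
    then show ?thesis by eventually_elim (auto simp: v_def split: if_splits)
  qed
  have ZH: "N.expectation (\<lambda>x. Z x * V x) = expectation V" if V: "V \<in> Linf M H" for V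
  proof -
    \<comment> \<open>By translation invariance \<open>g\<close> is linear on
      \<open>H\<close>-measurable directions, so testing with both signs of \<open>c\<close> gives
      an equality.\<close>
    have key: "- \<epsilon> \<le> c * (N.expectation (\<lambda>x. Z x * V x) - expectation V)" for c :: real
    proof -
      have cV: "(\<lambda>x. c * V x) \<in> Linf M H" by (rule Linf_mult_const[OF V])
      obtain R where "(\<lambda>x. c * V x) \<in> Linf_ball N R" using to_ball[OF Linf_HG[OF cV]] by blast
      from ZU[OF this] g_H[OF cV] show ?thesis
        by (simp add: mult.left_commute[of _ c] right_diff_distrib)
    qed
    have "0 \<le> N.expectation (\<lambda>x. Z x * V x) - expectation V"
      by (rule nonneg_of_scaling) (rule key)
    moreover have "0 \<le> - (N.expectation (\<lambda>x. Z x * V x) - expectation V)"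
    proof (rule nonneg_of_scaling)
      show "- \<epsilon> \<le> real n * - (N.expectation (\<lambda>x. Z x * V x) - expectation V)" for n
        using key[of "- real n"] by (simp only: mult_minus_left mult_minus_right)
    qed
    ultimately show ?thesis by simp
  qed
  define Q where "Q = density N (\<lambda>x. ennreal (Z x))"
  have intQ: "(\<integral>x. f x \<partial>Q) = N.expectation (\<lambda>x. Z x * f x)" if "f \<in> borel_measurable G" for f :: "'a \<Rightarrow> real"
  proof -
    have "f \<in> borel_measurable N" using that measN by simp
    from integral_density[OF this Zm Z0] show ?thesis by (simp add: Q_def)
  qed
  show ?thesis
  proof
    show "ac_prob_measure M G Q"
      unfolding ac_prob_measure_def
    proof (intro conjI)
      show "prob_space Q"
      proof (rule prob_spaceI)
        have "emeasure Q (space Q) = (\<integral>\<^sup>+x. ennreal (Z x) \<partial>N)"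
          unfolding Q_def by (simp add: emeasure_density cong: nn_integral_cong)
        also have "\<dots> = ennreal (N.expectation Z)" using Z Z0 by (rule nn_integral_eq_integral)
        also have "N.expectation Z = 1" using ZH[OF Linf_const, of 1] by (simp add: prob_space)
        finally show "emeasure Q (space Q) = 1" by simp
      qed
      show "sets Q = sets G" by (simp add: Q_def setsN)
      show "absolutely_continuous (restr_to_subalg M G) Q"
        unfolding Q_def N_def[symmetric] by (rule absolutely_continuousI_density) measurable
    qed
    show "(\<integral>x. X x \<partial>Q) = expectation X" if "X \<in> Linf M H" for X
      using intQ[OF Linf_measurable[OF Linf_HG[OF that]]] ZH[OF that] by simp
    show "(\<integral>x. Y x \<partial>Q) + expectation (r Y) - \<epsilon> \<le> (\<integral>x. W x \<partial>Q) + expectation (r W)"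
      if W: "W \<in> Linf M G" for W
    proof -
      obtain R where b: "(\<lambda>x. W x - Y x) \<in> Linf_ball N R" using to_ball[OF Linf_diff[OF W Y]] by blast
      obtain R1 where b1: "W \<in> Linf_ball N R1" using to_ball[OF W] by blast
      obtain R2 where b2: "Y \<in> Linf_ball N R2" using to_ball[OF Y] by blast
      have "N.expectation (\<lambda>x. Z x * (W x - Y x)) = (\<integral>x. W x \<partial>Q) - (\<integral>x. Y x \<partial>Q)"
        using integrable_mult_Linf_ball[OF Z b1] integrable_mult_Linf_ball[OF Z b2]
          intQ[OF Linf_measurable[OF W]] intQ[OF Linf_measurable[OF Y]]
        by (simp add: right_diff_distrib)
      moreover have "g (\<lambda>x. W x - Y x) = expectation (r W) - expectation (r Y)" by (simp add: g_def)
      ultimately show ?thesis using ZU[OF b] by simp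
    qed
  qed
qed

end

section \<open>The penalty under an absolutely continuous measure\<close>

definition penalty :: "'a measure \<Rightarrow> 'a measure \<Rightarrow> 'a measure \<Rightarrow> (('a \<Rightarrow> real) \<Rightarrow> 'a \<Rightarrow> real) \<Rightarrow>
    'a measure \<Rightarrow> 'a \<Rightarrow> ereal"
  where "penalty M G H r Q = ess_sup_family (restr_to_subalg Q H)
    {(\<lambda>\<omega>. ereal (real_cond_exp Q H (\<lambda>\<omega>'. - X \<omega>') \<omega> - r X \<omega>)) | X. X \<in> Linf M G}"

locale cond_risk_measure_ac = cond_risk_measure M G H r
  for M G H :: "'a measure" and r +
  fixes Q :: "'a measure"
  assumes ac: "ac_prob_measure M G Q"
begin

sublocale Q: prob_space Q
  using ac by (simp add: ac_prob_measure_def)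

lemma sets_Q: "sets Q = sets G"
  using ac by (simp add: ac_prob_measure_def)

lemma space_Q: "space Q = space M"
  using sets_eq_imp_space_eq[OF sets_Q] sub_G by (simp add: subalgebra_def)

lemma measurable_Q: "X \<in> borel_measurable G \<Longrightarrow> X \<in> borel_measurable Q"
  using sets_Q by (simp cong: measurable_cong_sets)

sublocale QH: finite_measure_subalgebra Q H
proof unfold_locales
  show "subalgebra Q H"
    using sub_H sets_Q sets_eq_imp_space_eq[OF sets_Q] by (simp add: subalgebra_def)
qed

text \<open>By \<open>null_sets_sub\<close> the exceptional null set of \<open>M\<close> belongs to
  \<open>G\<close>, hence it is null for the restriction that dominates \<open>Q\<close>.\<close>

lemma AE_Q:
  assumes "AE x in M. P x" shows "AE x in Q. P x"
proof -
  obtain A where A: "{x \<in> space M. \<not> P x} \<subseteq> A" "A \<in> null_sets M"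
    using assms by (auto simp: eventually_ae_filter)
  then have "A \<in> null_sets (restr_to_subalg M G)"
    using null_sets_sub null_sets_restr_to_subalg[OF sub_G] by auto
  then have "A \<in> null_sets Q"
    using ac unfolding ac_prob_measure_def absolutely_continuous_def by auto
  then show ?thesis using A(1) space_Q by (auto simp: eventually_ae_filter)
qed

lemma integrable_Q:
  assumes "X \<in> Linf M G" shows "integrable Q X"
proof -
  obtain C where "AE x in M. \<bar>X x\<bar> \<le> C" using Linf_bound[OF assms] .
  from AE_Q[OF this] show ?thesis
    using measurable_Q[OF Linf_measurable[OF assms]] by (intro Q.integrable_const_bound[where B=C]) auto
qed

lemma cond_exp_bound:
  assumes "X \<in> Linf M G"
  obtains C where "0 \<le> C" "AE x in Q. \<bar>real_cond_exp Q H X x\<bar> \<le> C"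
proof -
  obtain C where C: "0 \<le> C" "AE x in M. \<bar>X x\<bar> \<le> C" using Linf_bound[OF assms] .
  have "AE x in Q. - C \<le> X x" "AE x in Q. X x \<le> C"
    using AE_Q[OF C(2)] by (auto simp: abs_le_iff)
  from QH.real_cond_exp_ge_c[OF integrable_Q[OF assms] this(1)]
    QH.real_cond_exp_le_c[OF integrable_Q[OF assms] this(2)]
  have "AE x in Q. \<bar>real_cond_exp Q H X x\<bar> \<le> C" by eventually_elim (simp add: abs_le_iff)
  then show ?thesis using that C(1) by blast
qed

text \<open>The functions whose essential supremum over \<open>X\<close> is the penalty.\<close>

definition excess :: "('a \<Rightarrow> real) \<Rightarrow> 'a \<Rightarrow> real"
  where "excess X x = real_cond_exp Q H (\<lambda>y. - X y) x - r X x"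

lemma excess_measurable: "X \<in> Linf M G \<Longrightarrow> excess X \<in> borel_measurable H"
  using Linf_measurable[OF r_Linf] unfolding excess_def by measurable

lemma measurable_HQ: "f \<in> borel_measurable H \<Longrightarrow> f \<in> borel_measurable Q"
  by (rule measurable_from_subalg[OF QH.subalg])

lemma excess_bound:
  assumes "X \<in> Linf M G"
  obtains C where "0 \<le> C" "AE x in Q. \<bar>excess X x\<bar> \<le> C"
proof -
  obtain C where C: "0 \<le> C" "AE x in Q. \<bar>real_cond_exp Q H (\<lambda>y. - X y) x\<bar> \<le> C"
    using cond_exp_bound[OF Linf_uminus[OF assms]] .
  obtain D where D: "0 \<le> D" "AE x in M. \<bar>r X x\<bar> \<le> D" using Linf_bound[OF r_Linf[OF assms]] .
  have "AE x in Q. \<bar>excess X x\<bar> \<le> C + D"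
    using C(2) AE_Q[OF D(2)] by eventually_elim (simp add: excess_def)
  then show ?thesis using that[of "C + D"] C(1) D(1) by simp
qed

lemma excess_integrable:
  assumes "X \<in> Linf M G" shows "integrable Q (excess X)"
  unfolding excess_def[abs_def]
  by (rule Bochner_Integration.integrable_diff[OF QH.real_cond_exp_int(1)[OF integrable_Q[OF Linf_uminus[OF assms]]]
        integrable_Q[OF r_LinfG[OF assms]]])

lemma integral_excess:
  assumes "X \<in> Linf M G"
  shows "(\<integral>x. excess X x \<partial>Q) = - (\<integral>x. X x \<partial>Q) - (\<integral>x. r X x \<partial>Q)"
proof -
  have i: "integrable Q (\<lambda>x. - X x)" by (intro integrable_Q Linf_uminus assms)
  have "(\<integral>x. excess X x \<partial>Q) = (\<integral>x. real_cond_exp Q H (\<lambda>y. - X y) x \<partial>Q) - (\<integral>x. r X x \<partial>Q)"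
    unfolding excess_def
    by (intro Bochner_Integration.integral_diff QH.real_cond_exp_int(1)[OF i] integrable_Q r_LinfG assms)
  also have "(\<integral>x. real_cond_exp Q H (\<lambda>y. - X y) x \<partial>Q) = - (\<integral>x. X x \<partial>Q)"
    by (subst QH.real_cond_exp_int(2)[OF i]) (rule Bochner_Integration.integral_minus)
  finally show ?thesis .
qed

text \<open>Pasting \<open>X\<close> and \<open>Y\<close> along the \<open>H\<close>-set where the
  excess of \<open>X\<close> is the larger one attains the pointwise maximum, since conditional
  expectation and \<open>r\<close> are both local on \<open>H\<close>.\<close>

lemma excess_directed:
  assumes X: "X \<in> Linf M G" and Y: "Y \<in> Linf M G"
  obtains V where "V \<in> Linf M G" "AE x in Q. excess X x \<le> excess V x \<and> excess Y x \<le> excess V x"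
proof
  define A where "A = {x \<in> space H. excess Y x \<le> excess X x}"
  have A: "A \<in> sets H" unfolding A_def
    using excess_measurable[OF X] excess_measurable[OF Y] by measurable
  then have AG: "A \<in> sets G" using sub_H by (auto simp: subalgebra_def)
  let ?V = "\<lambda>x. if x \<in> A then X x else Y x"
  show V: "?V \<in> Linf M G" by (rule Linf_if[OF X Y AG])
  define a b where "a x = (indicator A x :: real)" and "b x = (1 - indicator A x :: real)" for x
  have ab: "a \<in> borel_measurable H" "b \<in> borel_measurable H"
    unfolding a_def b_def using A by measurable
  have split: "(\<lambda>x. - ?V x) = (\<lambda>x. a x * - X x + b x * - Y x)"
    by (auto simp: a_def b_def)
  have aX: "(\<lambda>x. a x * - X x) \<in> Linf M G" and bY: "(\<lambda>x. b x * - Y x) \<in> Linf M G"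
  proof -
    have "(\<lambda>x. if x \<in> A then - X x else 0) \<in> Linf M G" "(\<lambda>x. if x \<in> A then 0 else - Y x) \<in> Linf M G"
      by (intro Linf_if Linf_uminus X Y AG Linf_const)+
    moreover have "(\<lambda>x. a x * - X x) = (\<lambda>x. if x \<in> A then - X x else 0)"
      "(\<lambda>x. b x * - Y x) = (\<lambda>x. if x \<in> A then 0 else - Y x)"
      by (auto simp: a_def b_def)
    ultimately show "(\<lambda>x. a x * - X x) \<in> Linf M G" "(\<lambda>x. b x * - Y x) \<in> Linf M G" by simp_all
  qed
  have "AE x in Q. real_cond_exp Q H (\<lambda>x. a x * - X x) x = a x * real_cond_exp Q H (\<lambda>x. - X x) x"
    by (rule QH.real_cond_exp_mult[OF ab(1) _ integrable_Q[OF aX]])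
      (rule measurable_Q[OF Linf_measurable[OF Linf_uminus[OF X]]])
  moreover have "AE x in Q. real_cond_exp Q H (\<lambda>x. b x * - Y x) x = b x * real_cond_exp Q H (\<lambda>x. - Y x) x"
    by (rule QH.real_cond_exp_mult[OF ab(2) _ integrable_Q[OF bY]])
      (rule measurable_Q[OF Linf_measurable[OF Linf_uminus[OF Y]]])
  moreover have "AE x in Q. real_cond_exp Q H (\<lambda>x. - ?V x) x
      = real_cond_exp Q H (\<lambda>x. a x * - X x) x + real_cond_exp Q H (\<lambda>x. b x * - Y x) x"
    unfolding split by (rule QH.real_cond_exp_add[OF integrable_Q[OF aX] integrable_Q[OF bY]])
  moreover have "AE x in Q. r ?V x = (if x \<in> A then r X x else r Y x)"
    by (rule AE_Q[OF r_paste[OF X Y A]])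
  ultimately have "AE x in Q. excess ?V x = (if x \<in> A then excess X x else excess Y x)"
    by eventually_elim (auto simp: excess_def a_def b_def)
  then show "AE x in Q. excess X x \<le> excess ?V x \<and> excess Y x \<le> excess ?V x"
    using AE_space
  proof eventually_elim
    case (elim x)
    have "space H = space Q" using QH.subalg by (simp add: subalgebra_def)
    then show ?case using elim by (auto simp: A_def)
  qed
qed

text \<open>Directedness makes the penalty the limit of a countable increasing sequence, to which
  monotone convergence applies. It also shows that an essential supremum exists, so that the choice
  made by \<open>ess_sup_family\<close> is meaningful.\<close>

lemma penalty_seq:
  obtains W where "\<And>n. W n \<in> Linf M G" "AE x in Q. incseq (\<lambda>n. excess (W n) x)"
    "AE x in Q. penalty M G H r Q x = (SUP n. ereal (excess (W n) x))"
    "penalty M G H r Q \<in> borel_measurable H"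
    "\<And>X. X \<in> Linf M G \<Longrightarrow> AE x in Q. ereal (excess X x) \<le> penalty M G H r Q x"
proof -
  let ?N = "restr_to_subalg Q H"
  interpret N: finite_measure ?N
    by (rule finite_measure_restr_to_subalg[OF QH.subalg]) unfold_locales
  let ?S = "excess ` Linf M G"
  let ?E = "(\<lambda>f x. ereal (f x)) ` ?S"
  obtain s where s: "\<And>n. s n \<in> ?S" "AE x in ?N. incseq (\<lambda>n. s n x)"
    "is_ess_sup ?N ?E (\<lambda>x. SUP n. ereal (s n x))"
  proof (rule N.is_ess_sup_directed[of ?S])
    show "f \<in> borel_measurable ?N" if "f \<in> ?S" for f
      using that excess_measurable measurable_in_subalg[OF QH.subalg] by blast
    show "?S \<noteq> {}" using Linf_const by blast
    fix f g assume "f \<in> ?S" "g \<in> ?S"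
    then obtain X Y where X: "X \<in> Linf M G" "f = excess X" and Y: "Y \<in> Linf M G" "g = excess Y" by blast
    obtain V where V: "V \<in> Linf M G" "AE x in Q. excess X x \<le> excess V x \<and> excess Y x \<le> excess V x"
      using excess_directed[OF X(1) Y(1)] .
    have [measurable]: "excess X \<in> borel_measurable H" "excess Y \<in> borel_measurable H"
      "excess V \<in> borel_measurable H"
      by (intro excess_measurable X Y V)+
    \<comment> \<open>The inequality passes from \<open>Q\<close> to its restriction because the set
      on which it holds is \<open>H\<close>-measurable.\<close>
    have "Measurable.pred H (\<lambda>x. excess X x \<le> excess V x \<and> excess Y x \<le> excess V x)" by measurable
    then have "AE x in ?N. excess X x \<le> excess V x \<and> excess Y x \<le> excess V x"
      by (rule AE_restr_to_subalg2[OF QH.subalg V(2)])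
    then show "\<exists>h\<in>?S. AE x in ?N. f x \<le> h x \<and> g x \<le> h x" using X(2) Y(2) V(1) by blast
  qed blast
  have E: "?E = {(\<lambda>\<omega>. ereal (real_cond_exp Q H (\<lambda>\<omega>'. - X \<omega>') \<omega> - r X \<omega>)) | X. X \<in> Linf M G}"
    by (auto simp: excess_def image_iff)
  have pen: "is_ess_sup ?N ?E (penalty M G H r Q)"
    unfolding penalty_def E[symmetric] by (rule is_ess_sup_ess_sup_family[OF s(3)])
  have "\<forall>n. \<exists>W. W \<in> Linf M G \<and> s n = excess W" using s(1) by blast
  then obtain W where W: "\<And>n. W n \<in> Linf M G" "\<And>n. s n = excess (W n)" by metis
  show ?thesis
  proof
    show "W n \<in> Linf M G" for n by (rule W(1))
    show "AE x in Q. incseq (\<lambda>n. excess (W n) x)"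
      using AE_restr_to_subalg[OF QH.subalg s(2)] W(2) by simp
    show "AE x in Q. penalty M G H r Q x = (SUP n. ereal (excess (W n) x))"
      using AE_restr_to_subalg[OF QH.subalg is_ess_sup_AE_unique[OF pen s(3)]] W(2) by simp
    show "penalty M G H r Q \<in> borel_measurable H"
      using pen measurable_in_subalg'[OF QH.subalg] unfolding is_ess_sup_def by blast
    show "AE x in Q. ereal (excess X x) \<le> penalty M G H r Q x" if "X \<in> Linf M G" for X
    proof -
      have "\<forall>g\<in>?E. AE x in ?N. g x \<le> penalty M G H r Q x"
        using pen[unfolded is_ess_sup_def, THEN conjunct2, THEN conjunct1] .
      moreover have "(\<lambda>x. ereal (excess X x)) \<in> ?E" using that by (rule imageI[OF imageI])
      ultimately have "AE x in ?N. ereal (excess X x) \<le> penalty M G H r Q x" by (rule bspec)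
      then show ?thesis by (rule AE_restr_to_subalg[OF QH.subalg])
    qed
  qed
qed

lemma penalty_measurable: "penalty M G H r Q \<in> borel_measurable H"
  by (rule penalty_seq) blast

lemma penalty_upper:
  "X \<in> Linf M G \<Longrightarrow> AE x in Q. ereal (excess X x) \<le> penalty M G H r Q x"
  by (rule penalty_seq) blast

end

section \<open>Nested pairs of conditional risk measures\<close>

text \<open>Since \<open>r (Y n) = r X\<close>, the function \<open>u n\<close> is the conditional
  expectation of \<open>- Y n\<close> given \<open>H\<close>. The tower property turns its
  conditional expectation given \<open>K\<close> into \<open>s X\<close> plus the excess of
  \<open>Y n\<close> for \<open>s\<close>, which the penalty of \<open>s\<close> bounds.\<close>

lemma cond_risk_supermartingale:
  assumes r: "cond_risk_measure_ac M G H r Q" and s: "cond_risk_measure_ac M G K s Q"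
    and sub: "subalgebra H K"
    and consistent: "\<And>X Y. X \<in> Linf M G \<Longrightarrow> Y \<in> Linf M G \<Longrightarrow> AE x in M. r X x = r Y x
      \<Longrightarrow> AE x in M. s X x = s Y x"
    and X: "X \<in> Linf M G"
  shows "AE x in Q. ereal_cond_exp Q K (\<lambda>x. ereal (r X x) + penalty M G H r Q x) x
    \<le> ereal (s X x) + penalty M G K s Q x"
proof -
  interpret r: cond_risk_measure_ac M G H r Q by fact
  interpret s: cond_risk_measure_ac M G K s Q by fact
  obtain W where W: "\<And>n. W n \<in> Linf M G" "AE x in Q. incseq (\<lambda>n. r.excess (W n) x)"
    "AE x in Q. penalty M G H r Q x = (SUP n. ereal (r.excess (W n) x))"
    by (rule r.penalty_seq) blast
  define u where "u n x = r X x + r.excess (W n) x" for n x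
  \<comment> \<open>The correction is \<open>H\<close>-measurable, so it leaves the excess for
    \<open>r\<close> unchanged while setting the risk to \<open>r X\<close>.\<close>
  define Y where "Y n x = W n x + (r (W n) x - r X x)" for n x
  have Y: "Y n \<in> Linf M G" for n
    unfolding Y_def by (intro Linf_add Linf_diff W(1) r.r_LinfG X)
  have u_int: "integrable Q (u n)" for n
    unfolding u_def using r.integrable_Q[OF r.r_LinfG[OF X]] r.excess_integrable[OF W(1)] by simp
  have u_Y: "AE x in Q. real_cond_exp Q H (\<lambda>x. - Y n x) x = u n x" for n
  proof -
    have 1: "(\<lambda>x. - Y n x) = (\<lambda>x. - W n x + (r X x - r (W n) x))" by (auto simp: Y_def)
    have i1: "integrable Q (\<lambda>x. - W n x)" by (intro r.integrable_Q Linf_uminus W(1))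
    have d: "(\<lambda>x. r X x - r (W n) x) \<in> Linf M H" by (intro Linf_diff r.r_Linf W(1) X)
    have i2: "integrable Q (\<lambda>x. r X x - r (W n) x)" by (rule r.integrable_Q[OF r.Linf_HG[OF d]])
    show ?thesis
      unfolding 1 using r.QH.real_cond_exp_add[OF i1 i2] r.QH.real_cond_exp_F_meas[OF i2 Linf_measurable[OF d]]
      by eventually_elim (simp add: u_def r.excess_def)
  qed
  have s_Y: "AE x in M. s (Y n) x = s X x" for n
  proof (rule consistent[OF Y X])
    show "AE x in M. r (Y n) x = r X x"
      unfolding Y_def by (rule r.r_normalise[OF W(1) r.r_Linf[OF X]])
  qed
  obtain C where C: "0 \<le> C" "AE x in Q. \<bar>r.excess (W 0) x\<bar> \<le> C" by (rule r.excess_bound[OF W(1)])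
  obtain D where D: "0 \<le> D" "AE x in M. \<bar>r X x\<bar> \<le> D" by (rule Linf_bound[OF r.r_Linf[OF X]])
  show ?thesis
  proof (rule s.QH.ereal_cond_exp_SUP_le[where u=u and C="C + D"])
    show "integrable Q (u n)" for n by (rule u_int)
    show "AE x in Q. incseq (\<lambda>n. u n x)"
      using W(2) by eventually_elim (simp add: u_def incseq_def)
    show "AE x in Q. - (C + D) \<le> u 0 x"
      using C(2) r.AE_Q[OF D(2)] by eventually_elim (simp add: u_def abs_le_iff)
    show "0 \<le> C + D" using C(1) D(1) by simp
    have [measurable]: "r X \<in> borel_measurable Q" "penalty M G H r Q \<in> borel_measurable Q"
      by (intro r.measurable_HQ Linf_measurable[OF r.r_Linf[OF X]] r.penalty_measurable)+
    show "(\<lambda>x. ereal (r X x) + penalty M G H r Q x) \<in> borel_measurable Q" by measurable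
    show "AE x in Q. ereal (r X x) + penalty M G H r Q x = (SUP n. ereal (u n x))"
      using W(3)
    proof eventually_elim
      case (elim x)
      have "(SUP n. ereal (r X x) + ereal (r.excess (W n) x)) = ereal (r X x) + penalty M G H r Q x"
        unfolding elim by (rule SUP_ereal_add_right) auto
      then show ?case by (simp add: u_def)
    qed
    show "AE x in Q. ereal (real_cond_exp Q K (u n) x) \<le> ereal (s X x) + penalty M G K s Q x" for n
    proof -
      have mY: "integrable Q (\<lambda>x. - Y n x)" by (intro r.integrable_Q Linf_uminus Y)
      have "AE x in Q. real_cond_exp Q K (real_cond_exp Q H (\<lambda>x. - Y n x)) x = real_cond_exp Q K (\<lambda>x. - Y n x) x"
        by (rule s.QH.real_cond_exp_nested_subalg[OF r.QH.subalg sub mY])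
      moreover have "AE x in Q. real_cond_exp Q K (real_cond_exp Q H (\<lambda>x. - Y n x)) x = real_cond_exp Q K (u n) x"
        using u_int by (intro s.QH.real_cond_exp_cong u_Y) auto
      ultimately show ?thesis
        using s.penalty_upper[OF Y[of n]] r.AE_Q[OF s_Y[of n]]
      proof eventually_elim
        case (elim x)
        then have "ereal (real_cond_exp Q K (u n) x) = ereal (s X x) + ereal (s.excess (Y n) x)"
          by (simp add: s.excess_def)
        also have "\<dots> \<le> ereal (s X x) + penalty M G K s Q x" using elim by (intro add_left_mono) simp
        finally show ?case .
      qed
    qed
  qed
qed

text \<open>As \<open>r X = r Y\<close>, the excess of \<open>Y\<close> for \<open>r\<close> may be
  inserted in the supermartingale inequality for \<open>X\<close>; integration gives
  \<open>- E_Q(Y) - E(s X)\<close> as a lower bound for the expected penalty of \<open>s\<close>.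
  Near-optimality at \<open>Y\<close> bounds the latter by
  \<open>\<epsilon> - E_Q(Y) - E(s Y)\<close>, and \<open>E_Q(Y)\<close> cancels.\<close>

lemma cond_risk_expectation_le:
  assumes r: "cond_risk_measure M G H r" and s: "cond_risk_measure M G K s"
    and sub: "subalgebra H K"
    and supermartingale: "\<And>Q X. ac_prob_measure M G Q
      \<Longrightarrow> \<bar>ereal_expectation Q (penalty M G K s Q)\<bar> \<noteq> \<infinity> \<Longrightarrow> X \<in> Linf M G
      \<Longrightarrow> AE x in Q. ereal_cond_exp Q K (\<lambda>x. ereal (r X x) + penalty M G H r Q x) x
        \<le> ereal (s X x) + penalty M G K s Q x"
    and X: "X \<in> Linf M G" and Y: "Y \<in> Linf M G" and eq: "AE x in M. r X x = r Y x"
  shows "(\<integral>x. s Y x \<partial>M) \<le> (\<integral>x. s X x \<partial>M)"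
proof (rule field_le_epsilon)
  fix \<epsilon> :: real assume "0 < \<epsilon>"
  interpret s: cond_risk_measure M G K s by fact
  obtain Q where ac: "ac_prob_measure M G Q"
    and QK: "\<And>X. X \<in> Linf M K \<Longrightarrow> (\<integral>x. X x \<partial>Q) = (\<integral>x. X x \<partial>M)"
    and near: "\<And>W. W \<in> Linf M G \<Longrightarrow> (\<integral>x. Y x \<partial>Q) + (\<integral>x. s Y x \<partial>M) - \<epsilon> \<le> (\<integral>x. W x \<partial>Q) + (\<integral>x. s W x \<partial>M)"
    using s.ex_near_optimal_measure[OF Y \<open>0 < \<epsilon>\<close>] by blast
  interpret s: cond_risk_measure_ac M G K s Q
    by (intro cond_risk_measure_ac.intro s cond_risk_measure_ac_axioms.intro ac)
  interpret r: cond_risk_measure_ac M G H r Q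
    by (intro cond_risk_measure_ac.intro r cond_risk_measure_ac_axioms.intro ac)
  let ?a = "penalty M G K s Q"
  \<comment> \<open>By near-optimality and the agreement of \<open>Q\<close> with \<open>M\<close>
    on \<open>K\<close>, this bounds the \<open>Q\<close>-expectation of the excess of every
    position for \<open>s\<close>.\<close>
  define B where "B = \<epsilon> - (\<integral>x. Y x \<partial>Q) - (\<integral>x. s Y x \<partial>M)"
  obtain W where W: "\<And>n. W n \<in> Linf M G" "AE x in Q. incseq (\<lambda>n. s.excess (W n) x)"
    "AE x in Q. ?a x = (SUP n. ereal (s.excess (W n) x))"
    by (rule s.penalty_seq) blast
  obtain D where D: "0 \<le> D" "AE x in Q. \<bar>s.excess (W 0) x\<bar> \<le> D" by (rule s.excess_bound[OF W(1)])
  \<comment> \<open>\<open>D\<close> bounds the first excess from below; adding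
    \<open>\<bar>B\<bar>\<close> makes \<open>B + C\<close> nonnegative, so that the bound can be
    read back from \<open>ennreal\<close>.\<close>
  define C where "C = D + \<bar>B\<bar>"
  have C: "0 \<le> C" "0 \<le> B + C" using D(1) by (auto simp: C_def)
  have low: "AE x in Q. - C \<le> s.excess (W 0) x" using D(2) unfolding C_def by eventually_elim linarith
  have bound: "(\<integral>\<^sup>+x. e2ennreal (?a x + ereal C) \<partial>Q) \<le> ennreal (B + C)"
  proof (rule nn_integral_SUP_shift_le[OF s.Q.prob_space_axioms s.excess_integrable[OF W(1)] W(2) low W(3)])
    show "(\<integral>x. s.excess (W n) x \<partial>Q) \<le> B" for n
      using near[OF W(1)[of n]] by (simp add: s.integral_excess[OF W(1)] QK[OF s.r_Linf[OF W(1)]] B_def)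
  qed
  have a_low: "AE x in Q. - ereal C \<le> ?a x"
    using W(3) low
  proof eventually_elim
    case (elim x)
    have "ereal (s.excess (W 0) x) \<le> ?a x" unfolding elim(1) by (rule SUP_upper) simp
    moreover have "- ereal C \<le> ereal (s.excess (W 0) x)" using elim(2) by simp
    ultimately show ?case by (rule order_trans[rotated])
  qed
  have "\<bar>ereal_expectation Q ?a\<bar> \<noteq> \<infinity>"
    by (rule ereal_expectation_finite[OF s.Q.prob_space_axioms s.measurable_HQ[OF s.penalty_measurable] a_low C(1)])
      (use bound in \<open>auto intro: le_less_trans\<close>)
  from supermartingale[OF ac this X]
  have sup: "AE x in Q. ereal_cond_exp Q K (\<lambda>x. ereal (r X x) + penalty M G H r Q x) x \<le> ereal (s X x) + ?a x" .
  define u where "u = real_cond_exp Q H (\<lambda>x. - Y x)"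
  have mY: "integrable Q (\<lambda>x. - Y x)" by (intro r.integrable_Q Linf_uminus Y)
  have u_int: "integrable Q u" unfolding u_def by (rule r.QH.real_cond_exp_int(1)[OF mY])
  obtain c where c: "AE x in Q. \<bar>u x\<bar> \<le> c"
    unfolding u_def using r.cond_exp_bound[OF Linf_uminus[OF Y]] by blast
  have [measurable]: "r X \<in> borel_measurable Q" "penalty M G H r Q \<in> borel_measurable Q"
    by (rule r.measurable_HQ, rule Linf_measurable[OF r.r_Linf[OF X]])
      (rule r.measurable_HQ, rule r.penalty_measurable)
  have [measurable]: "u \<in> borel_measurable Q" using u_int by simp
  have "AE x in Q. ereal_cond_exp Q K (\<lambda>x. ereal (u x)) x
      \<le> ereal_cond_exp Q K (\<lambda>x. ereal (r X x) + penalty M G H r Q x) x"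
  proof (rule s.QH.ereal_cond_exp_mono)
    show "AE x in Q. ereal (u x) \<le> ereal (r X x) + penalty M G H r Q x"
      using r.penalty_upper[OF Y] r.AE_Q[OF eq]
    proof eventually_elim
      case (elim x)
      have "ereal (u x) = ereal (r X x) + ereal (r.excess Y x)" using elim by (simp add: u_def r.excess_def)
      also have "\<dots> \<le> ereal (r X x) + penalty M G H r Q x" using elim by (intro add_left_mono) simp
      finally show ?case .
    qed
    show "AE x in Q. - ereal c \<le> ereal (u x)" using c by eventually_elim (simp add: abs_le_iff)
  qed measurable
  moreover have "AE x in Q. ereal_cond_exp Q K (\<lambda>x. ereal (u x)) x = ereal (real_cond_exp Q K u x)"
    by (rule s.QH.ereal_cond_exp_ereal[OF u_int])
  moreover have "AE x in Q. real_cond_exp Q K u x = real_cond_exp Q K (\<lambda>x. - Y x) x"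
    unfolding u_def by (rule s.QH.real_cond_exp_nested_subalg[OF r.QH.subalg sub mY])
  ultimately have v_le: "AE x in Q. ereal (real_cond_exp Q K (\<lambda>x. - Y x) x - s X x) \<le> ?a x"
    using sup
  proof eventually_elim
    case (elim x)
    then have "ereal (real_cond_exp Q K (\<lambda>x. - Y x) x) \<le> ereal (s X x) + ?a x" by simp
    then show ?case by (cases "?a x") auto
  qed
  define v where "v x = real_cond_exp Q K (\<lambda>x. - Y x) x - s X x" for x
  have sX: "integrable Q (s X)" by (intro s.integrable_Q s.r_LinfG X)
  have v_int: "integrable Q v" unfolding v_def using s.QH.real_cond_exp_int(1)[OF mY] sX by simp
  have "(\<integral>x. v x \<partial>Q) = - (\<integral>x. Y x \<partial>Q) - (\<integral>x. s X x \<partial>M)"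
    unfolding v_def using s.QH.real_cond_exp_int[OF mY] sX QK[OF s.r_Linf[OF X]] by simp
  \<comment> \<open>The penalty is extended real, so the comparison is made in
    \<open>[0, \<infinity>]\<close>: both sides are shifted by \<open>C\<close>, and
    \<open>v + C\<close> is replaced by its positive part.\<close>
  moreover have "(\<integral>x. v x \<partial>Q) \<le> B"
  proof -
    have "(\<integral>x. v x \<partial>Q) + C = (\<integral>x. v x + C \<partial>Q)" using v_int by (simp add: s.Q.prob_space)
    also have "\<dots> \<le> (\<integral>x. max 0 (v x + C) \<partial>Q)" using v_int by (intro integral_mono) auto
    finally have 1: "(\<integral>x. v x \<partial>Q) + C \<le> (\<integral>x. max 0 (v x + C) \<partial>Q)" .
    have "ennreal (\<integral>x. max 0 (v x + C) \<partial>Q) = (\<integral>\<^sup>+x. ennreal (max 0 (v x + C)) \<partial>Q)"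
      using v_int by (intro nn_integral_eq_integral[symmetric]) auto
    also have "\<dots> \<le> (\<integral>\<^sup>+x. e2ennreal (?a x + ereal C) \<partial>Q)"
    proof (rule nn_integral_mono_AE)
      show "AE x in Q. ennreal (max 0 (v x + C)) \<le> e2ennreal (?a x + ereal C)"
        using v_le
      proof eventually_elim
        case (elim x)
        then have "ereal (v x) + ereal C \<le> ?a x + ereal C" unfolding v_def by (rule add_right_mono)
        then have "e2ennreal (ereal (v x + C)) \<le> e2ennreal (?a x + ereal C)" by (intro e2ennreal_mono) simp
        then show ?case by (cases "0 \<le> v x + C") (auto simp: max_def)
      qed
    qed
    also note bound
    finally have "(\<integral>x. max 0 (v x + C) \<partial>Q) \<le> B + C" using C(2) by (simp add: ennreal_le_iff)
    then show ?thesis using 1 by linarith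
  qed
  ultimately show "(\<integral>x. s Y x \<partial>M) \<le> (\<integral>x. s X x \<partial>M) + \<epsilon>" unfolding B_def by linarith
qed

text \<open>The expectation inequality is applied to \<open>X\<close> and to the position that is
  \<open>Y\<close> on \<open>{s X < s Y}\<close> and \<open>X\<close> elsewhere. This set lies in
  \<open>K\<close>, hence in \<open>H\<close>, so the pasted position still has risk
  \<open>r X\<close>; its \<open>s\<close>-risk exceeds \<open>s X\<close> by a nonnegative function
  with integral at most \<open>0\<close>, so the set is null.\<close>

lemma cond_risk_AE_le:
  assumes r: "cond_risk_measure M G H r" and s: "cond_risk_measure M G K s"
    and sub: "subalgebra H K"
    and supermartingale: "\<And>Q X. ac_prob_measure M G Q
      \<Longrightarrow> \<bar>ereal_expectation Q (penalty M G K s Q)\<bar> \<noteq> \<infinity> \<Longrightarrow> X \<in> Linf M G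
      \<Longrightarrow> AE x in Q. ereal_cond_exp Q K (\<lambda>x. ereal (r X x) + penalty M G H r Q x) x
        \<le> ereal (s X x) + penalty M G K s Q x"
    and X: "X \<in> Linf M G" and Y: "Y \<in> Linf M G" and eq: "AE x in M. r X x = r Y x"
  shows "AE x in M. s Y x \<le> s X x"
proof -
  interpret r: cond_risk_measure M G H r by fact
  interpret s: cond_risk_measure M G K s by fact
  define A where "A = {x \<in> space K. s X x < s Y x}"
  have A: "A \<in> sets K" unfolding A_def
    using Linf_measurable[OF s.r_Linf[OF X]] Linf_measurable[OF s.r_Linf[OF Y]] by measurable
  have AH: "A \<in> sets H" using A sub by (auto simp: subalgebra_def)
  have AG: "A \<in> sets G" using AH r.sub_H by (auto simp: subalgebra_def)
  let ?V = "\<lambda>x. if x \<in> A then Y x else X x"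
  have V: "?V \<in> Linf M G" by (rule Linf_if[OF Y X AG])
  have eq': "AE x in M. r X x = r ?V x"
    using r.r_paste[OF Y X AH] eq by eventually_elim simp
  have "(\<integral>x. s ?V x \<partial>M) \<le> (\<integral>x. s X x \<partial>M)"
    by (rule cond_risk_expectation_le[OF r s sub _ X V eq']) (rule supermartingale)
  then have "(\<integral>x. s ?V x - s X x \<partial>M) \<le> 0"
    using s.r_integrable[OF V] s.r_integrable[OF X] by simp
  moreover have paste: "AE x in M. s ?V x = (if x \<in> A then s Y x else s X x)"
    by (rule s.r_paste[OF Y X A])
  moreover have nn: "AE x in M. 0 \<le> s ?V x - s X x"
    using paste by eventually_elim (auto simp: A_def)
  moreover have "0 \<le> (\<integral>x. s ?V x - s X x \<partial>M)" using nn by (rule integral_nonneg_AE)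
  ultimately have "(\<integral>x. s ?V x - s X x \<partial>M) = 0" by linarith
  then have "AE x in M. s ?V x - s X x = 0"
    using s.r_integrable[OF V] s.r_integrable[OF X] nn integral_nonneg_eq_0_iff_AE[of M "\<lambda>x. s ?V x - s X x"]
    by auto
  with paste show ?thesis
    using AE_space
  proof eventually_elim
    case (elim x)
    have "space K = space M" using s.sub_MH by (simp add: subalgebra_def)
    then show ?case using elim by (cases "x \<in> A") (auto simp: A_def)
  qed
qed

section \<open>Sigma-algebras of stopping times\<close>

lemma (in filtered_prob_space) subalgebra_pre_sigma:
  assumes "stopping_time F \<tau>" shows "subalgebra M (pre_sigma \<tau>)"
  unfolding subalgebra_def
proof (intro conjI subsetI)
  show "space (pre_sigma \<tau>) = space M" by (rule space_pre_sigma)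
  fix A assume "A \<in> sets (pre_sigma \<tau>)"
  \<comment> \<open>At index \<open>\<infinity>\<close> the condition on \<tau> is void, so the set
    obtained is \<open>A\<close> itself.\<close>
  then have "{\<omega>\<in>A. \<tau> \<omega> \<le> \<infinity>} \<in> sets (F \<infinity>)" by (rule sets_pre_sigmaD[OF assms])
  then show "A \<in> sets M" using sets_F_infinity by simp
qed

lemma (in filtered_prob_space) subalgebra_pre_sigma_mono:
  assumes "ordered_stopping_times M F \<sigma> \<tau>" shows "subalgebra (pre_sigma \<tau>) (pre_sigma \<sigma>)"
  unfolding subalgebra_def
  using assms mono_pre_sigma[of \<sigma> \<tau>] by (simp add: ordered_stopping_times_def space_pre_sigma)

lemma (in filtered_prob_space) null_sets_pre_sigma:
  assumes \<tau>: "stopping_time F \<tau>" shows "null_sets M \<subseteq> sets (pre_sigma \<tau>)"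
proof
  fix A assume A: "A \<in> null_sets M"
  show "A \<in> sets (pre_sigma \<tau>)"
  proof (rule sets_pre_sigmaI[OF \<tau>])
    fix t
    have "A \<in> sets (F 0)" unfolding sets_F_0 using A by (rule sigma_sets.Basic)
    then have "A \<in> sets (F t)" using sets_F_mono[of 0 t] by auto
    moreover have "{\<omega> \<in> space (F t). \<tau> \<omega> \<le> t} \<in> sets (F t)"
      using stopping_timeD[OF \<tau>] by (simp add: pred_def)
    ultimately have "A \<inter> {\<omega> \<in> space (F t). \<tau> \<omega> \<le> t} \<in> sets (F t)" by (rule sets.Int)
    moreover have "A \<inter> {\<omega> \<in> space (F t). \<tau> \<omega> \<le> t} = {\<omega> \<in> A. \<tau> \<omega> \<le> t}"
      using sets.sets_into_space[OF \<open>A \<in> sets (F t)\<close>] by auto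
    ultimately show "{\<omega> \<in> A. \<tau> \<omega> \<le> t} \<in> sets (F t)" by simp
  qed
qed

lemma cond_risk_measure_dynamic:
  assumes fps: "filtered_prob_space M F" and drm: "dynamic_risk_measure M F \<rho>"
    and cfa: "continuous_from_above M F \<rho>" and ord: "ordered_stopping_times M F \<sigma> \<tau>"
  shows "cond_risk_measure M (stopped_sigma M F \<tau>) (stopped_sigma M F \<sigma>) (\<rho> \<sigma> \<tau>)"
proof -
  interpret filtered_prob_space M F by fact
  have \<tau>: "stopping_time F \<tau>" using ord by (simp add: ordered_stopping_times_def)
  note D = drm[unfolded dynamic_risk_measure_def, rule_format, OF ord]
  note C = cfa[unfolded continuous_from_above_def, rule_format, OF ord]
  show ?thesis
  proof unfold_locales
    show "subalgebra M (pre_sigma \<tau>)" by (rule subalgebra_pre_sigma[OF \<tau>])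
    show "subalgebra (pre_sigma \<tau>) (pre_sigma \<sigma>)" by (rule subalgebra_pre_sigma_mono[OF ord])
    show "null_sets M \<subseteq> sets (pre_sigma \<tau>)" by (rule null_sets_pre_sigma[OF \<tau>])
  next
    fix X assume "X \<in> Linf M (pre_sigma \<tau>)"
    then show "\<rho> \<sigma> \<tau> X \<in> Linf M (pre_sigma \<sigma>)" using D by blast
  next
    fix X Y assume "X \<in> Linf M (pre_sigma \<tau>)" "Y \<in> Linf M (pre_sigma \<tau>)" "AE x in M. X x \<le> Y x"
    then show "AE x in M. \<rho> \<sigma> \<tau> Y x \<le> \<rho> \<sigma> \<tau> X x" using D by blast
  next
    fix X Z assume "X \<in> Linf M (pre_sigma \<tau>)" "Z \<in> Linf M (pre_sigma \<sigma>)"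
    then show "AE x in M. \<rho> \<sigma> \<tau> (\<lambda>y. X y + Z y) x = \<rho> \<sigma> \<tau> X x - Z x" using D by blast
  next
    fix X Y and c :: real
    assume "X \<in> Linf M (pre_sigma \<tau>)" "Y \<in> Linf M (pre_sigma \<tau>)" "0 \<le> c" "c \<le> 1"
    moreover from this have "c \<in> {0..1}" by simp
    ultimately show "AE x in M. \<rho> \<sigma> \<tau> (\<lambda>y. c * X y + (1 - c) * Y y) x
        \<le> c * \<rho> \<sigma> \<tau> X x + (1 - c) * \<rho> \<sigma> \<tau> Y x" using D by blast
  next
    fix Xs :: "nat \<Rightarrow> 'a \<Rightarrow> real" and X
    assume "\<And>n. Xs n \<in> Linf M (pre_sigma \<tau>)" "X \<in> Linf M (pre_sigma \<tau>)"
      "AE x in M. decseq (\<lambda>n. Xs n x)" "AE x in M. (\<lambda>n. Xs n x) \<longlonglongrightarrow> X x"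
    then show "AE x in M. (\<lambda>n. \<rho> \<sigma> \<tau> (Xs n) x) \<longlonglongrightarrow> \<rho> \<sigma> \<tau> X x"
      by (intro C conjI allI)
  qed
qed

lemma min_penalty_eq_penalty:
  "min_penalty M F \<rho> \<sigma> \<tau> = penalty M (stopped_sigma M F \<tau>) (stopped_sigma M F \<sigma>) (\<rho> \<sigma> \<tau>)"
  by (simp add: min_penalty_def penalty_def fun_eq_iff)

theorem proposition1p8:
  fixes M :: "'a measure" and F :: "ennreal \<Rightarrow> 'a measure"
    and \<rho> :: "('a \<Rightarrow> ennreal) \<Rightarrow> ('a \<Rightarrow> ennreal) \<Rightarrow> ('a \<Rightarrow> real) \<Rightarrow> ('a \<Rightarrow> real)"
  assumes "filtered_prob_space M F"
    and "dynamic_risk_measure M F \<rho>"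
    and "continuous_from_above M F \<rho>"
  shows "time_consistent M F \<rho> \<longleftrightarrow>
    (\<forall>\<nu> \<sigma> \<tau>. ordered_stopping_times M F \<nu> \<sigma> \<and> ordered_stopping_times M F \<sigma> \<tau> \<longrightarrow>
      (\<forall>Q. ac_prob_measure M (stopped_sigma M F \<tau>) Q \<and>
           \<bar>ereal_expectation Q (min_penalty M F \<rho> \<nu> \<tau> Q)\<bar> \<noteq> \<infinity> \<longrightarrow>
        (\<forall>X \<in> Linf M (stopped_sigma M F \<tau>).
           AE \<omega> in Q.
             ereal_cond_exp Q (stopped_sigma M F \<nu>)
                 (\<lambda>\<omega>'. ereal (\<rho> \<sigma> \<tau> X \<omega>') + min_penalty M F \<rho> \<sigma> \<tau> Q \<omega>') \<omega>
               \<le> ereal (\<rho> \<nu> \<tau> X \<omega>) + min_penalty M F \<rho> \<nu> \<tau> Q \<omega>)) \<and>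
      (\<forall>Z \<in> Linf M (stopped_sigma M F \<sigma>).
         AE \<omega> in M. \<rho> \<nu> \<sigma> Z \<omega> = \<rho> \<nu> \<tau> (\<lambda>\<omega>'. Z \<omega>' + \<rho> \<sigma> \<tau> (\<lambda>_. 0) \<omega>') \<omega>))"
    (is "_ \<longleftrightarrow> (\<forall>\<nu> \<sigma> \<tau>. ?O \<nu> \<sigma> \<tau> \<longrightarrow> ?P \<nu> \<sigma> \<tau> \<and> ?R \<nu> \<sigma> \<tau>)")
proof
  note crm = cond_risk_measure_dynamic[OF assms]
  assume TC: "time_consistent M F \<rho>"
  show "\<forall>\<nu> \<sigma> \<tau>. ?O \<nu> \<sigma> \<tau> \<longrightarrow> ?P \<nu> \<sigma> \<tau> \<and> ?R \<nu> \<sigma> \<tau>"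
  proof (intro allI impI)
    fix \<nu> \<sigma> \<tau> assume O: "?O \<nu> \<sigma> \<tau>"
    then have \<nu>\<tau>: "ordered_stopping_times M F \<nu> \<tau>"
      by (auto simp: ordered_stopping_times_def intro: order_trans)
    interpret a: cond_risk_measure M "stopped_sigma M F \<tau>" "stopped_sigma M F \<sigma>" "\<rho> \<sigma> \<tau>"
      using O by (intro crm) simp
    interpret b: cond_risk_measure M "stopped_sigma M F \<sigma>" "stopped_sigma M F \<nu>" "\<rho> \<nu> \<sigma>"
      using O by (intro crm) simp
    interpret c: cond_risk_measure M "stopped_sigma M F \<tau>" "stopped_sigma M F \<nu>" "\<rho> \<nu> \<tau>"
      by (intro crm \<nu>\<tau>)
    have tc: "AE \<omega> in M. \<rho> \<nu> \<sigma> (\<lambda>\<omega>'. - \<rho> \<sigma> \<tau> X \<omega>') \<omega> = \<rho> \<nu> \<tau> X \<omega>"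
      if "X \<in> Linf M (stopped_sigma M F \<tau>)" for X
      using TC O that unfolding time_consistent_def by blast
    have consistent: "AE x in M. \<rho> \<nu> \<tau> X x = \<rho> \<nu> \<tau> Y x"
      if X: "X \<in> Linf M (stopped_sigma M F \<tau>)" and Y: "Y \<in> Linf M (stopped_sigma M F \<tau>)"
        and eq: "AE x in M. \<rho> \<sigma> \<tau> X x = \<rho> \<sigma> \<tau> Y x" for X Y
    proof -
      have "AE x in M. - \<rho> \<sigma> \<tau> X x = - \<rho> \<sigma> \<tau> Y x" using eq by eventually_elim simp
      from b.r_cong[OF Linf_uminus[OF a.r_Linf[OF X]] Linf_uminus[OF a.r_Linf[OF Y]] this] tc[OF X] tc[OF Y]
      show ?thesis by eventually_elim simp
    qed
    have "?P \<nu> \<sigma> \<tau>"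
    proof (intro allI impI ballI)
      fix Q X
      assume Q: "ac_prob_measure M (stopped_sigma M F \<tau>) Q \<and>
        \<bar>ereal_expectation Q (min_penalty M F \<rho> \<nu> \<tau> Q)\<bar> \<noteq> \<infinity>"
        and X: "X \<in> Linf M (stopped_sigma M F \<tau>)"
      show "AE \<omega> in Q. ereal_cond_exp Q (stopped_sigma M F \<nu>)
          (\<lambda>\<omega>'. ereal (\<rho> \<sigma> \<tau> X \<omega>') + min_penalty M F \<rho> \<sigma> \<tau> Q \<omega>') \<omega>
          \<le> ereal (\<rho> \<nu> \<tau> X \<omega>) + min_penalty M F \<rho> \<nu> \<tau> Q \<omega>"
        unfolding min_penalty_eq_penalty
      proof (rule cond_risk_supermartingale[OF _ _ b.sub_H consistent X])
        show "cond_risk_measure_ac M (stopped_sigma M F \<tau>) (stopped_sigma M F \<sigma>) (\<rho> \<sigma> \<tau>) Q"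
          by (intro cond_risk_measure_ac.intro cond_risk_measure_ac_axioms.intro
              a.cond_risk_measure_axioms conjunct1[OF Q])
        show "cond_risk_measure_ac M (stopped_sigma M F \<tau>) (stopped_sigma M F \<nu>) (\<rho> \<nu> \<tau>) Q"
          by (intro cond_risk_measure_ac.intro cond_risk_measure_ac_axioms.intro
              c.cond_risk_measure_axioms conjunct1[OF Q])
      qed
    qed
    moreover have "?R \<nu> \<sigma> \<tau>"
    proof
      fix Z assume Z: "Z \<in> Linf M (stopped_sigma M F \<sigma>)"
      \<comment> \<open>Translation invariance gives \<open>- \<rho> \<sigma> \<tau> ?V = Z\<close>,
        so consistency at \<open>?V\<close> is property 2. The summand
        \<open>\<rho> \<sigma> \<tau> (\<lambda>_. 0)\<close> compensates for the missing
        normalisation.\<close>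
      let ?V = "\<lambda>x. Z x + \<rho> \<sigma> \<tau> (\<lambda>_. 0) x"
      have r0: "\<rho> \<sigma> \<tau> (\<lambda>_. 0) \<in> Linf M (stopped_sigma M F \<sigma>)" by (rule a.r_Linf[OF Linf_const])
      have V: "?V \<in> Linf M (stopped_sigma M F \<sigma>)" by (rule Linf_add[OF Z r0])
      have "AE x in M. \<rho> \<sigma> \<tau> ?V x = \<rho> \<sigma> \<tau> (\<lambda>_. 0) x - ?V x"
        using a.r_trans[OF Linf_const[of 0] V] by simp
      then have "AE x in M. - \<rho> \<sigma> \<tau> ?V x = Z x" by eventually_elim simp
      from b.r_cong[OF Linf_uminus[OF a.r_Linf[OF a.Linf_HG[OF V]]] Z this] tc[OF a.Linf_HG[OF V]]
      show "AE x in M. \<rho> \<nu> \<sigma> Z x = \<rho> \<nu> \<tau> ?V x" by eventually_elim simp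
    qed
    ultimately show "?P \<nu> \<sigma> \<tau> \<and> ?R \<nu> \<sigma> \<tau>" ..
  qed
next
  note crm = cond_risk_measure_dynamic[OF assms]
  assume PR: "\<forall>\<nu> \<sigma> \<tau>. ?O \<nu> \<sigma> \<tau> \<longrightarrow> ?P \<nu> \<sigma> \<tau> \<and> ?R \<nu> \<sigma> \<tau>"
  show "time_consistent M F \<rho>"
    unfolding time_consistent_def
  proof (intro allI impI ballI)
    fix \<nu> \<sigma> \<tau> X assume O: "?O \<nu> \<sigma> \<tau>" and X: "X \<in> Linf M (stopped_sigma M F \<tau>)"
    have \<nu>\<tau>: "ordered_stopping_times M F \<nu> \<tau>"
      using O by (auto simp: ordered_stopping_times_def intro: order_trans)
    interpret a: cond_risk_measure M "stopped_sigma M F \<tau>" "stopped_sigma M F \<sigma>" "\<rho> \<sigma> \<tau>"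
      using O by (intro crm) simp
    interpret b: cond_risk_measure M "stopped_sigma M F \<sigma>" "stopped_sigma M F \<nu>" "\<rho> \<nu> \<sigma>"
      using O by (intro crm) simp
    interpret c: cond_risk_measure M "stopped_sigma M F \<tau>" "stopped_sigma M F \<nu>" "\<rho> \<nu> \<tau>"
      by (intro crm \<nu>\<tau>)
    note PR' = mp[OF spec[OF spec[OF spec[OF PR]]] O]
    have P: "?P \<nu> \<sigma> \<tau>" by (rule conjunct1[OF PR'])
    have R: "?R \<nu> \<sigma> \<tau>" by (rule conjunct2[OF PR'])
    \<comment> \<open>The hypothesis is symmetric in \<open>V\<close> and \<open>W\<close>, so two
      uses of this inequality give equality.\<close>
    have mono: "AE x in M. \<rho> \<nu> \<tau> W x \<le> \<rho> \<nu> \<tau> V x"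
      if V: "V \<in> Linf M (stopped_sigma M F \<tau>)" and W: "W \<in> Linf M (stopped_sigma M F \<tau>)"
        and eq: "AE x in M. \<rho> \<sigma> \<tau> V x = \<rho> \<sigma> \<tau> W x" for V W
      by (rule cond_risk_AE_le[OF a.cond_risk_measure_axioms c.cond_risk_measure_axioms b.sub_H _ V W eq])
        (use P in \<open>simp add: min_penalty_eq_penalty\<close>)
    \<comment> \<open>A position measurable at \<sigma> with the same risk at \<sigma> as
      \<open>X\<close>, by translation invariance. Property 2 at
      \<open>- \<rho> \<sigma> \<tau> X\<close> identifies its risk at \<nu>.\<close>
    define Y where "Y x = - \<rho> \<sigma> \<tau> X x + \<rho> \<sigma> \<tau> (\<lambda>_. 0) x" for x
    have rX: "(\<lambda>x. - \<rho> \<sigma> \<tau> X x) \<in> Linf M (stopped_sigma M F \<sigma>)"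
      by (rule Linf_uminus[OF a.r_Linf[OF X]])
    have Y: "Y \<in> Linf M (stopped_sigma M F \<sigma>)"
      unfolding Y_def by (rule Linf_add[OF rX a.r_Linf[OF Linf_const]])
    have "AE x in M. \<rho> \<sigma> \<tau> Y x = \<rho> \<sigma> \<tau> (\<lambda>_. 0) x - Y x"
      using a.r_trans[OF Linf_const[of 0] Y] by simp
    then have eq: "AE x in M. \<rho> \<sigma> \<tau> Y x = \<rho> \<sigma> \<tau> X x" by eventually_elim (simp add: Y_def)
    then have eq': "AE x in M. \<rho> \<sigma> \<tau> X x = \<rho> \<sigma> \<tau> Y x" by eventually_elim simp
    have "AE x in M. \<rho> \<nu> \<sigma> (\<lambda>x. - \<rho> \<sigma> \<tau> X x) x = \<rho> \<nu> \<tau> Y x"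
      using bspec[OF R rX] unfolding Y_def .
    with mono[OF a.Linf_HG[OF Y] X eq] mono[OF X a.Linf_HG[OF Y] eq']
    show "AE x in M. \<rho> \<nu> \<sigma> (\<lambda>\<omega>'. - \<rho> \<sigma> \<tau> X \<omega>') x = \<rho> \<nu> \<tau> X x"
      by eventually_elim simp
  qed
qed

end
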